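(* Let $N\ge1$ be an integer, $z=x+iy$ in the upper half plane. Then $$\lim_{s\to1}\Big(\mathcal E(N,z,s)-\varphi(N)\zeta^*(2s-1)\Big)=-\frac1{12}\log\big(y^{6\varphi(N)}|\Delta_N(z)|\big)$$ and $$\lim_{s\to1}\Big(\mathcal E(N,w_Nz,s)-\varphi(N)\zeta^*(2s-1)\Big)=-\frac1{12}\log\big(y^{6\varphi(N)}|\Delta_N^0(z)|\big),$$ where $w_N=\begin{pmatrix}0&-1\\N&0\end{pmatrix}$ and $\Delta_N^0=\Delta_N|w_N$.
   Context: $\varphi$ is Euler's function, $\mu$ the Möbius function, $\zeta^*(s)=\pi^{-s/2}\Gamma(\frac s2)\zeta(s)$, $\zeta^{(N)}(s)=\zeta(s)\prod_{p\mid N}(1-p^{-s})$. $E(N,z,s)=\sum_{\gamma\in\Gamma_\infty\backslash\Gamma_0(N)}(\mathrm{Im}(\gamma z))^s$ with $\Gamma_\infty=\{\pm\begin{pmatrix}1&m\\0&1\end{pmatrix}:m\in\mathbb Z\}$ (for $\mathrm{Re}(s)>1$, then meromorphically continued), and $\mathcal E(N,z,s)=N^{2s}\pi^{-s}\Gamma(s)\zeta^{(N)}(2s)E(N,z,s)$. $\Delta(z)=q_z\prod_{n\ge1}(1-q_z^n)^{24}$, $q_z=e^{2\pi iz}$, and $$\Delta_N(z)=\prod_{t\mid N}\Delta(tz)^{a(t)},\qquad a(t)=\sum_{r\mid t}\mu\Big(\frac tr\Big)\mu\Big(\frac Nr\Big)\frac{\varphi(N)}{\varphi(N/r)},$$ a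 modular form of weight $k=12\varphi(N)$ for $\Gamma_0(N)$. For a matrix $g=\begin{pmatrix}a&b\\c&d\end{pmatrix}$ of positive determinant, $(f|g)(z)=(\det g)^{k/2}(cz+d)^{-k}f(gz)$ in weight $k$. *)

theory Defs
  imports
    "HOL-Complex_Analysis.Complex_Analysis"
    "HOL-Computational_Algebra.Squarefree"
    "HOL-Number_Theory.Totient"
begin

section \<open>Meromorphic continuation from the half-plane \<open>Re s > 1\<close>\<close>

text \<open>
  The value at \<open>s\<close> of the meromorphic continuation of \<open>f\<close>, given on \<open>Re s > 1\<close>, to any open
  half-plane \<open>Re w > c\<close> that contains \<open>s\<close>. By the identity theorem the value does not depend on
  \<open>c\<close> or \<open>F\<close>, so where \<open>f\<close> continues to the whole plane this is that continuation. As usual for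
  \<^const>\<open>nicely_meromorphic_on\<close>, the value at a pole is \<open>0\<close>.
\<close>
definition mero_cont :: "(complex \<Rightarrow> complex) \<Rightarrow> complex \<Rightarrow> complex" where
  "mero_cont f s = (THE v. \<exists>c F. c \<le> 1 \<and> c < Re s \<and> F nicely_meromorphic_on {w. Re w > c} \<and>
                       (\<forall>w. Re w > 1 \<longrightarrow> F w = f w) \<and> v = F s)"

section \<open>The zeta function\<close>

definition zeta :: "complex \<Rightarrow> complex" where
  "zeta = mero_cont (\<lambda>s. \<Sum>n. 1 / of_nat (Suc n) powr s)"

definition zeta_star :: "complex \<Rightarrow> complex" where
  "zeta_star s = of_real pi powr (- s / 2) * Gamma (s / 2) * zeta s"

definition zeta_level :: "nat \<Rightarrow> complex \<Rightarrow> complex" where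
  "zeta_level N s = zeta s * (\<Prod>p\<in>prime_factors N. 1 - of_nat p powr (- s))"

section \<open>Matrices\<close>

definition mat2 :: "real \<Rightarrow> real \<Rightarrow> real \<Rightarrow> real \<Rightarrow> real^2^2" where
  "mat2 a b c d = vector [vector [a, b], vector [c, d]]"

definition automorphy :: "real^2^2 \<Rightarrow> complex \<Rightarrow> complex" where
  "automorphy g z = of_real (g$2$1) * z + of_real (g$2$2)"

definition mat_act :: "real^2^2 \<Rightarrow> complex \<Rightarrow> complex" where
  "mat_act g z = (of_real (g$1$1) * z + of_real (g$1$2)) / automorphy g z"

definition slash :: "nat \<Rightarrow> (complex \<Rightarrow> complex) \<Rightarrow> real^2^2 \<Rightarrow> complex \<Rightarrow> complex" where
  "slash k f g z =
     of_real (det g powr (real k / 2)) * automorphy g z powi (- int k) * f (mat_act g z)"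

definition Gamma0 :: "nat \<Rightarrow> (real^2^2) set" where
  "Gamma0 N = {g. (\<forall>i j. g$i$j \<in> \<int>) \<and> det g = 1 \<and> (\<exists>k::int. g$2$1 = of_int (int N * k))}"

definition Gamma_inf :: "(real^2^2) set" where
  "Gamma_inf = (\<Union>m::int. {mat2 1 (of_int m) 0 1, - mat2 1 (of_int m) 0 1})"

definition w_mat :: "nat \<Rightarrow> real^2^2" where
  "w_mat N = mat2 0 (- 1) (real N) 0"

section \<open>Eisenstein series\<close>

text \<open>The coset space \<open>\<Gamma>\<^sub>\<infinity> \ \<Gamma>\<^sub>0(N)\<close>; its elements are the sets \<open>\<Gamma>\<^sub>\<infinity> g\<close> with \<open>g \<in> \<Gamma>\<^sub>0(N)\<close>.\<close>
definition cosets :: "nat \<Rightarrow> (real^2^2) set set" where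
  "cosets N = Gamma0 N // {(g, h). \<exists>p\<in>Gamma_inf. h = p ** g}"

text \<open>The summand does not depend on the chosen representative, as \<open>\<Gamma>\<^sub>\<infinity>\<close> preserves \<^const>\<open>Im\<close>.\<close>
definition eisenstein :: "nat \<Rightarrow> complex \<Rightarrow> complex \<Rightarrow> complex" where
  "eisenstein N z =
     mero_cont (\<lambda>s. \<Sum>\<^sub>\<infinity>C\<in>cosets N. of_real (Im (mat_act (SOME g. g \<in> C) z)) powr s)"

definition eisenstein_completed :: "nat \<Rightarrow> complex \<Rightarrow> complex \<Rightarrow> complex" where
  "eisenstein_completed N z s =
     of_nat N powr (2 * s) * of_real pi powr (- s) * Gamma s * zeta_level N (2 * s) * eisenstein N z s"

section \<open>The forms \<open>\<Delta>\<close> and \<open>\<Delta>\<^sub>N\<close>\<close>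

definition moebius_mu :: "nat \<Rightarrow> int" where
  "moebius_mu n = (if squarefree n then (- 1) ^ card (prime_factors n) else 0)"

definition Delta :: "complex \<Rightarrow> complex" where
  "Delta z = (let q = exp (2 * of_real pi * \<i> * z) in q * (\<Prod>n. (1 - q ^ Suc n) ^ 24))"

text \<open>The division of totients is exact, because \<open>d dvd N\<close> implies \<open>totient d dvd totient N\<close>.\<close>
definition a_exp :: "nat \<Rightarrow> nat \<Rightarrow> int" where
  "a_exp N t = (\<Sum>r | r dvd t. moebius_mu (t div r) * moebius_mu (N div r) *
                               int (totient N div totient (N div r)))"

definition Delta_level :: "nat \<Rightarrow> complex \<Rightarrow> complex" where
  "Delta_level N z = (\<Prod>t | t dvd N. Delta (of_nat t * z) powi a_exp N t)"

definition Delta_level0 :: "nat \<Rightarrow> complex \<Rightarrow> complex" where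
  "Delta_level0 N = slash (12 * totient N) (Delta_level N) (w_mat N)"

end

theory Submission
  imports Defs "HOL-Probability.Distributions"
begin

text \<open>
  For the lattice sum \<open>Z(z,s) = \<Sum>' |m z + n|\<^bsup>-2s\<^esup>\<close>, sieving by the Moebius function turns
  \<open>\<zeta>\<^bsup>(N)\<^esup>(2s) E(N,z,s)\<close> into a combination of the \<open>Z(t z, s)\<close> with \<open>t dvd N\<close>. In each row \<open>m \<ge> 1\<close> of
  \<open>Z\<close> the sum over \<open>n\<close> is compared with the integral \<open>\<integral> |m z + t|\<^bsup>-2s\<^esup> dt\<close>, a Beta integral. This gives
  \<open>Z(z,s) = 2 (\<zeta>(2s) + y\<^bsup>1-2s\<^esup> \<surd>\<pi> \<Gamma>(s-1/2)/\<Gamma>(s) \<zeta>(2s-1) + D(z,s))\<close>, where the sum \<open>D\<close> of the differences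
  converges for \<open>Re s > 1/2\<close> already, without any Fourier expansion or functional equation.
  At \<open>s = 1\<close> the row sums are elementary (partial fractions of the cotangent), and \<open>D(z,1)\<close> is a
  Lambert series whose value is a multiple of \<open>\<Sum> ln |1 - q\<^sup>k|\<close>, that is, of \<open>ln |\<Delta>(z)| + 2 \<pi> y\<close>.
\<close>

section \<open>Meromorphic continuation and holomorphic sums\<close>

text \<open>The power \<open>N^(2s)\<close> of the completed series turns the sieve weight
  \<open>d^(-2s)\<close> into \<open>t^(2s)\<close> with \<open>t = N/d\<close>. Together with
  \<open>y^s\<close> and the factor \<open>(t y)^(1-2s)\<close> of the polar term this leaves
  exactly \<open>t y^(1-s)\<close>, so the polar terms add up to
  \<open>phi(N) y^(1-s) zeta_star(2s-1)\<close>: this is why phi(N) copies of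
  \<open>zeta_star\<close> are subtracted. The residue of \<open>zeta_star(2s-1)\<close> at 1 is
  1/2, and against \<open>y^(1-s) - 1\<close> it leaves \<open>-(ln y)/2\<close>, hence the power
  \<open>y^(6 phi(N))\<close> behind the factor -1/12. In the regular terms
  \<open>zeta(2) = pi^2/6\<close> cancels the \<open>2 pi y\<close>, and
  \<open>-(1/12) t mu(N/t) ln |Delta(t z)|\<close> remains. The bridge to \<open>Delta_level\<close>
  is the identity \<open>a(t) = t mu(N/t)\<close>. The definition of the continuation accepts any
  half-plane that contains the point, so Re s > 1/2 is far enough, and dividing by
  \<open>zeta_level N (2s)\<close> is harmless near 1 because this function does not vanish at 2.
  The second limit is the first one at \<open>w_N z\<close>.\<close>

lemma of_real_powr_eq_exp:
  fixes s :: complex assumes "x > 0" shows "of_real x powr s = exp (s * of_real (ln x))"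
  using assms by (simp add: powr_def Ln_of_real)

text \<open>The witness for the description is \<open>remove_sings G\<close>, which agrees with
  \<open>G\<close> wherever \<open>G\<close> is analytic and is normalised as
  \<open>nicely_meromorphic_on\<close> demands. Uniqueness is the identity theorem on the
  intersection of the two half-planes, which contains the point 2 because both abscissae are at most
  1.\<close>

lemma mero_cont_eqI:
  assumes c: "c \<le> 1" "c < Re s" and G: "G meromorphic_on {w. Re w > c}"
    and f: "\<And>w. Re w > 1 \<Longrightarrow> G w = f w"
    and an: "G analytic_on {w. Re w > 1}" "G analytic_on {s}"
  shows "mero_cont f s = G s"
  unfolding mero_cont_def
proof (rule the_equality)
  let ?F = "remove_sings G"
  have F1: "?F w = f w" if "Re w > 1" for w
  proof -
    have "G analytic_on {w}" using an(1) that analytic_on_subset by blast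
    then show ?thesis using f[OF that] by simp
  qed
  have Fs: "?F s = G s" using an(2) by simp
  have F: "?F nicely_meromorphic_on {w. Re w > c}"
    using G by (rule remove_sings_nicely_meromorphic)
  show "\<exists>c F. c \<le> 1 \<and> c < Re s \<and> F nicely_meromorphic_on {w. c < Re w} \<and>
          (\<forall>w. 1 < Re w \<longrightarrow> F w = f w) \<and> G s = F s"
    using c F F1 Fs by metis
  fix v assume "\<exists>c F. c \<le> 1 \<and> c < Re s \<and> F nicely_meromorphic_on {w. c < Re w} \<and>
          (\<forall>w. 1 < Re w \<longrightarrow> F w = f w) \<and> v = F s"
  then obtain c' F' where c': "c' \<le> 1" "c' < Re s" and F': "F' nicely_meromorphic_on {w. c' < Re w}"
    and F'f: "\<And>w. 1 < Re w \<Longrightarrow> F' w = f w" and v: "v = F' s" by blast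
  define A where "A = {w. Re w > max c c'}"
  have A: "open A" "connected A" unfolding A_def
    by (rule open_halfspace_Re_gt, rule convex_connected, rule convex_halfspace_Re_gt)
  have sA: "s \<in> A" using c c' by (auto simp: A_def)
  have nF: "?F nicely_meromorphic_on A" "F' nicely_meromorphic_on A"
    using F F' by (auto simp: A_def intro: nicely_meromorphic_on_subset)
  define H where "H = (\<lambda>w. ?F w - F' w)"
  have H: "H meromorphic_on A" unfolding H_def
    using nF by (auto simp: nicely_meromorphic_on_def intro!: meromorphic_intros)
  have H0: "remove_sings H w = 0" if "w \<in> A" for w
  proof (rule frequently_eq_meromorphic_imp_constant[where f = "remove_sings H" and A = A])
    have "2 \<in> {w. Re w > 1}" by simp
    then have "\<forall>\<^sub>F w in at 2. Re w > 1"
      using eventually_at_in_open'[of "{w. Re w > 1}" 2] open_halfspace_Re_gt by auto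
    then have "\<forall>\<^sub>F w in at 2. remove_sings H w = 0"
    proof eventually_elim
      case (elim w)
      have "\<forall>\<^sub>F w in nhds w. Re w > 1"
        using eventually_nhds_in_open[of "{w. Re w > 1}" w] open_halfspace_Re_gt elim by auto
      then have "\<forall>\<^sub>F x in at w. H x = 0"
        unfolding eventually_at_filter by eventually_elim (auto simp: H_def F1 F'f)
      then have "H \<midarrow>w\<rightarrow> 0" by (simp add: tendsto_eventually)
      then show ?case by (rule remove_sings_eqI)
    qed
    then show "\<exists>\<^sub>F w in at 2. remove_sings H w = 0"
      by (simp add: eventually_frequently)
    show "remove_sings H nicely_meromorphic_on A" using H by (rule remove_sings_nicely_meromorphic)
    show "2 \<in> A" using c c' by (auto simp: A_def)
  qed (use A that in auto)
  have "\<forall>\<^sub>F w in at s. remove_sings H w = H w"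
    by (intro eventually_remove_sings_eq_at meromorphic_on_isolated_singularity meromorphic_on_subset[OF H])
       (use sA in auto)
  moreover have "\<forall>\<^sub>F w in at s. w \<in> A"
    using eventually_at_in_open'[OF A(1) sA] .
  ultimately have ev: "\<forall>\<^sub>F w in at s. ?F w = F' w"
    by eventually_elim (use H0 in \<open>auto simp: H_def\<close>)
  \<comment> \<open>Agreement near \<open>s\<close> does not by itself give agreement at
    \<open>s\<close>. At a pole both values are the default 0; otherwise both are the common
    limit.\<close>
  have "?F s = F' s"
  proof (cases "is_pole ?F s")
    case True
    moreover have "is_pole F' s" using True is_pole_cong[OF ev refl] by simp
    ultimately show ?thesis
      using nF sA unfolding nicely_meromorphic_on_def
      by (metis at_neq_bot is_pole_def not_tendsto_and_filterlim_at_infinity)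
  next
    case False
    moreover have "\<not> is_pole F' s" using False is_pole_cong[OF ev refl] by simp
    ultimately have "?F \<midarrow>s\<rightarrow> ?F s" "F' \<midarrow>s\<rightarrow> F' s"
      using nF sA unfolding nicely_meromorphic_on_def by auto
    then show ?thesis using tendsto_cong[OF ev] LIM_unique by blast
  qed
  then show "v = G s" using v Fs by simp
qed

text \<open>Weierstrass' theorem along the filter of finite subsets. The majorant may depend on the
  disc: the exponents of the majorants used later degrade towards the boundary of the
  half-plane.\<close>

lemma holomorphic_on_infsum:
  fixes f :: "'a \<Rightarrow> complex \<Rightarrow> complex"
  assumes A: "open A" and f: "\<And>i. i \<in> I \<Longrightarrow> f i holomorphic_on A"
    and bd: "\<And>z. z \<in> A \<Longrightarrow> \<exists>r>0. \<exists>M. M summable_on I \<and> (\<forall>i\<in>I. \<forall>w\<in>cball z r. norm (f i w) \<le> M i)"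
  shows "(\<lambda>w. \<Sum>\<^sub>\<infinity>i\<in>I. f i w) holomorphic_on A"
proof -
  have "\<exists>r>0. (\<lambda>w. \<Sum>\<^sub>\<infinity>i\<in>I. f i w) holomorphic_on ball z r" if z: "z \<in> A" for z
  proof -
    obtain r M where r: "r > 0" "M summable_on I" "\<And>i w. i \<in> I \<Longrightarrow> w \<in> cball z r \<Longrightarrow> norm (f i w) \<le> M i"
      using bd[OF z] by blast
    obtain r' where r': "r' > 0" "cball z r' \<subseteq> A" using A z open_contains_cball by blast
    define \<rho> where "\<rho> = min r r'"
    have \<rho>: "\<rho> > 0" "cball z \<rho> \<subseteq> A" "cball z \<rho> \<subseteq> cball z r" "ball z \<rho> \<subseteq> A"
      using r r' ball_subset_cball by (auto simp: \<rho>_def)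
    have "uniform_limit (cball z \<rho>) (\<lambda>X w. \<Sum>i\<in>X. f i w) (\<lambda>w. \<Sum>\<^sub>\<infinity>i\<in>I. f i w) (finite_subsets_at_top I)"
      by (rule Weierstrass_m_test_general[where M = M]) (use r \<rho> in auto)
    moreover have "\<forall>\<^sub>F X in finite_subsets_at_top I.
        continuous_on (cball z \<rho>) (\<lambda>w. \<Sum>i\<in>X. f i w) \<and> (\<lambda>w. \<Sum>i\<in>X. f i w) holomorphic_on ball z \<rho>"
      using \<rho> ball_subset_cball[of z \<rho>]
      by (intro eventually_finite_subsets_at_top_weakI)
         (auto intro!: continuous_on_sum holomorphic_on_sum holomorphic_on_imp_continuous_on
            intro: holomorphic_on_subset[OF f] dest: order_trans)
    ultimately have "(\<lambda>w. \<Sum>\<^sub>\<infinity>i\<in>I. f i w) holomorphic_on ball z \<rho>"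
      by (auto elim: holomorphic_uniform_limit[rotated 1])
    then show ?thesis using \<rho>(1) by blast
  qed
  then have "(\<lambda>w. \<Sum>\<^sub>\<infinity>i\<in>I. f i w) analytic_on A"
    by (simp add: analytic_on_def)
  then show ?thesis by (rule analytic_imp_holomorphic)
qed

section \<open>Comparison of a value with the integral over a unit interval\<close>

text \<open>The first-order Euler--Maclaurin remainder of \<open>q\<^bsup>-s\<^esup>\<close> on \<open>[0,1]\<close>; it gains one power of decay over \<open>q\<^bsup>-s\<^esup>\<close>.\<close>
definition sum_int_diff :: "(real \<Rightarrow> real) \<Rightarrow> complex \<Rightarrow> complex" where
  "sum_int_diff q s = of_real (q 0) powr (- s) - integral {0..1} (\<lambda>t. of_real (q t) powr (- s))"

lemma continuous_on_powr_comp: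
  fixes s :: complex
  assumes "continuous_on S q" "\<And>t. t \<in> S \<Longrightarrow> q t > (0::real)"
  shows "continuous_on S (\<lambda>t. of_real (q t) powr s)"
proof -
  have "continuous_on S (\<lambda>t. exp (s * of_real (ln (q t))))"
    using assms by (intro continuous_intros) force+
  then show ?thesis
    by (rule continuous_on_eq) (use assms of_real_powr_eq_exp in auto)
qed

lemma sum_int_diff_holomorphic:
  assumes "continuous_on {0..1} q" "\<And>t. t \<in> {0..1} \<Longrightarrow> q t > 0"
  shows "sum_int_diff q holomorphic_on A"
proof -
  have "(\<lambda>s. integral (cbox 0 1) (\<lambda>t. of_real (q t) powr (- s))) holomorphic_on UNIV"
  proof (rule leibniz_rule_holomorphic)
    let ?f' = "\<lambda>(s::complex) (t::real). - of_real (ln (q t)) * exp (- s * of_real (ln (q t)))"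
    fix s :: complex and t :: real
    { assume t: "t \<in> cbox 0 1"
      have "((\<lambda>s. exp (- s * of_real (ln (q t)))) has_field_derivative ?f' s t) (at s)"
        by (auto intro!: derivative_eq_intros)
      moreover have "(\<lambda>s::complex. of_real (q t) powr (- s)) = (\<lambda>s. exp (- s * of_real (ln (q t))))"
        using of_real_powr_eq_exp[OF assms(2)] t by auto
      ultimately show "((\<lambda>s. of_real (q t) powr (- s)) has_field_derivative ?f' s t) (at s within UNIV)"
        by simp }
    show "(\<lambda>t. of_real (q t) powr (- s)) integrable_on cbox 0 1"
      using assms by (intro integrable_continuous continuous_on_powr_comp) auto
    have "continuous_on (UNIV \<times> {0..1}) (\<lambda>x. q (snd x))"
      using assms(1) by (rule continuous_on_compose2) (auto intro!: continuous_intros)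
    then have lnc: "continuous_on (UNIV \<times> cbox 0 1) (\<lambda>x. ln (q (snd x)))"
      using assms(2) by (intro continuous_on_ln) (auto dest: less_imp_neq[OF assms(2)])
    show "continuous_on (UNIV \<times> cbox 0 1) (\<lambda>(s, t). ?f' s t)"
      unfolding case_prod_unfold
      by (intro continuous_on_mult continuous_on_minus continuous_on_exp continuous_on_of_real lnc
            continuous_on_fst continuous_on_id)
  qed simp
  then have "(\<lambda>s. of_real (q 0) powr (- s) - integral (cbox 0 1) (\<lambda>t. of_real (q t) powr (- s))) holomorphic_on UNIV"
    using assms(2)[of 0] by (intro holomorphic_intros) auto
  then have "sum_int_diff q holomorphic_on UNIV" by (simp add: sum_int_diff_def[abs_def])
  then show ?thesis by (rule holomorphic_on_subset) auto
qed

text \<open>The interval has length 1, so the remainder is the integral of \<open>g 0 - g t\<close>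
  with \<open>g = q^(-s)\<close>, and the mean value inequality bounds it by the supremum of
  \<open>|g'| = |s q'| q^(-Re s - 1)\<close>. This derivative is where the extra decay comes
  from.\<close>

lemma norm_sum_int_diff_le:
  assumes q: "\<And>t. t \<in> {0..1} \<Longrightarrow> (q has_real_derivative q' t) (at t within {0..1})"
    and pos: "\<And>t. t \<in> {0..1} \<Longrightarrow> q t > 0"
    and B: "\<And>t. t \<in> {0..1} \<Longrightarrow> norm s * \<bar>q' t\<bar> * q t powr (- Re s - 1) \<le> B"
  shows "norm (sum_int_diff q s) \<le> B"
proof -
  let ?g = "\<lambda>t. exp (- s * of_real (ln (q t)))"
  let ?g' = "\<lambda>t. - s * of_real (q' t / q t) * ?g t"
  have cont: "continuous_on {0..1} q"
    using q by (meson DERIV_continuous continuous_on_eq_continuous_within)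
  have g': "(?g has_vector_derivative ?g' t) (at t within {0..1})" if "t \<in> {0..1}" for t
  proof -
    have "((\<lambda>t. ln (q t)) has_real_derivative q' t / q t) (at t within {0..1})"
      using q[OF that] pos[OF that] by (auto intro!: derivative_eq_intros)
    then have "((\<lambda>t. complex_of_real (ln (q t))) has_vector_derivative of_real (q' t / q t)) (at t within {0..1})"
      using has_vector_derivative_of_real has_real_derivative_iff_has_vector_derivative by blast
    then have v: "((\<lambda>t. - s * complex_of_real (ln (q t))) has_vector_derivative - s * of_real (q' t / q t)) (at t within {0..1})"
      using has_vector_derivative_mult_right by blast
    have "(exp has_field_derivative exp (- s * of_real (ln (q t)))) (at (- s * of_real (ln (q t))) within ((\<lambda>t. - s * complex_of_real (ln (q t))) ` {0..1}))"
      using DERIV_exp has_field_derivative_at_within by blast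
    from field_vector_diff_chain_within[OF v this] show ?thesis by (simp add: o_def)
  qed
  have bnd: "norm (?g' t) \<le> B" if "t \<in> {0..1}" for t
  proof -
    have "norm (?g' t) = norm s * \<bar>q' t\<bar> * (q t powr (- Re s) / q t)"
      using pos[OF that] by (simp add: norm_mult norm_divide powr_def field_simps)
    also have "q t powr (- Re s) / q t = q t powr (- Re s - 1)"
      using pos[OF that] by (simp add: powr_diff)
    finally show ?thesis using B[OF that] by simp
  qed
  have B0: "B \<ge> 0" using bnd[of 0] norm_ge_zero order_trans by (metis atLeastAtMost_iff order_refl zero_le_one)
  have diff: "norm (?g 0 - ?g t) \<le> B" if t: "t \<in> {0..1}" for t
  proof -
    have "norm (?g 0 - ?g t) \<le> B * norm (0 - t)"
    proof (rule differentiable_bound[of "{0..1}" ?g "\<lambda>t h. h *\<^sub>R ?g' t"])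
      show "(?g has_derivative (\<lambda>h. h *\<^sub>R ?g' x)) (at x within {0..1})" if "x \<in> {0..1}" for x
        using g'[OF that] by (simp add: has_vector_derivative_def)
      show "onorm (\<lambda>h. h *\<^sub>R ?g' x) \<le> B" if "x \<in> {0..1}" for x
      proof (rule onorm_le)
        show "norm (h *\<^sub>R ?g' x) \<le> B * norm h" for h
          unfolding norm_scaleR real_norm_def
          using mult_left_mono[OF bnd[OF that], of "\<bar>h\<bar>"] by (simp only: mult.commute[of B] abs_ge_zero)
      qed
    qed (use t in auto)
    also have "\<dots> \<le> B * 1" using t B0 by (intro mult_left_mono) auto
    finally show ?thesis by simp
  qed
  have eq: "integral {0..1} (\<lambda>t. of_real (q t) powr (- s)) = integral {0..1} ?g"
    by (rule integral_cong) (use pos of_real_powr_eq_exp in auto)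
  have int: "?g integrable_on {0..1}"
    using g' by (intro integrable_continuous_real continuous_on_vector_derivative) auto
  have "sum_int_diff q s = integral {0..1} (\<lambda>t. ?g 0 - ?g t)"
    unfolding sum_int_diff_def eq using pos[of 0] int
    by (subst integral_diff) (auto simp: of_real_powr_eq_exp)
  also have "norm \<dots> \<le> integral {0..1::real} (\<lambda>_. B)"
    using diff int by (intro integral_norm_bound_integral integrable_diff) auto
  finally show ?thesis by simp
qed

section \<open>The zeta function\<close>

lemma summable_on_Suc_powr:
  assumes "a > 1" shows "(\<lambda>n. real (Suc n) powr (- a)) summable_on (UNIV :: nat set)"
proof -
  have "summable (\<lambda>n. real n powr (- a))" using assms by (subst summable_real_powr_iff) auto
  then have "summable (\<lambda>n. real (Suc n) powr (- a))" by (subst summable_Suc_iff)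
  then show ?thesis by (intro summable_nonneg_imp_summable_on) auto
qed

text \<open>This is \<open>zeta(s) - 1/(s-1)\<close>, written as the sum over \<open>n >= 1\<close>
  of \<open>n^(-s)\<close> minus the integral of \<open>x^(-s)\<close> over
  \<open>[n, n+1]\<close>.\<close>

definition zeta_reg :: "complex \<Rightarrow> complex" where
  "zeta_reg s = (\<Sum>\<^sub>\<infinity>n::nat. sum_int_diff (\<lambda>t. real (Suc n) + t) s)"

lemma zeta_reg_holomorphic: "zeta_reg holomorphic_on {s. Re s > 0}"
  unfolding zeta_reg_def[abs_def]
proof (rule holomorphic_on_infsum)
  show "open {s. Re s > 0}" by (rule open_halfspace_Re_gt)
  show "sum_int_diff (\<lambda>t. real (Suc n) + t) holomorphic_on {s. Re s > 0}" for n
    by (rule sum_int_diff_holomorphic) (auto intro!: continuous_intros)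
  fix z :: complex assume z: "z \<in> {s. Re s > 0}"
  \<comment> \<open>Half the distance to the boundary line: on the disc Re w >= r, so the terms
    decay like \<open>n^(-1-r)\<close>.\<close>
  define r where "r = Re z / 2"
  have r: "r > 0" using z by (simp add: r_def)
  define M where "M n = (norm z + r) * real (Suc n) powr (- (1 + r))" for n
  have "M summable_on UNIV" unfolding M_def
    using r by (intro summable_on_cmult_right summable_on_Suc_powr) auto
  moreover have "norm (sum_int_diff (\<lambda>t. real (Suc n) + t) w) \<le> M n" if w: "w \<in> cball z r" for n w
  proof (rule norm_sum_int_diff_le)
    show "((\<lambda>t. real (Suc n) + t) has_real_derivative 1) (at t within {0..1})" for t
      by (auto intro!: derivative_eq_intros)
    fix t :: real assume t: "t \<in> {0..1}"
    then show "real (Suc n) + t > 0" by auto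
    have r0: "norm z + r \<ge> 0" using r by (simp add: add_nonneg_nonneg)
    have "\<bar>Re (z - w)\<bar> \<le> r" using w abs_Re_le_cmod[of "z - w"] by (simp add: dist_norm)
    from abs_le_D1[OF this] have re: "Re w \<ge> r" by (simp add: r_def)
    have nw: "norm w \<le> norm z + r" using w norm_triangle_ineq3[of w z]
      by (simp add: dist_norm norm_minus_commute abs_le_iff)
    have "(real (Suc n) + t) powr (- Re w - 1) \<le> real (Suc n) powr (- Re w - 1)"
      using t re r by (intro powr_mono2') auto
    also have "\<dots> \<le> real (Suc n) powr (- (1 + r))" using re by (intro powr_mono) auto
    finally show "norm w * \<bar>1\<bar> * (real (Suc n) + t) powr (- Re w - 1) \<le> M n"
      unfolding M_def using nw r0 by (intro mult_mono) auto
  qed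
  ultimately show "\<exists>r>0. \<exists>M. M summable_on UNIV \<and>
      (\<forall>i\<in>UNIV. \<forall>w\<in>cball z r. norm (sum_int_diff (\<lambda>t. real (Suc i) + t) w) \<le> M i)"
    using r by blast
qed

lemma integral_Suc_powr:
  assumes "s \<noteq> 1"
  shows "integral {0..1} (\<lambda>t. of_real (real (Suc n) + t) powr (- s)) =
           (of_nat (Suc n) powr (1 - s) - of_nat (Suc (Suc n)) powr (1 - s)) / (s - 1 :: complex)"
proof -
  let ?F = "\<lambda>t. of_real (real (Suc n) + t) powr (1 - s) / (1 - s)"
  have "((\<lambda>t. of_real (real (Suc n) + t) powr (- s)) has_integral (?F 1 - ?F 0)) {0..1}"
  proof (rule fundamental_theorem_of_calculus)
    fix t :: real assume t: "t \<in> {0..1}"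
    have "of_real (real (Suc n) + t) \<notin> (\<real>\<^sub>\<le>\<^sub>0 :: complex set)"
      using t by (auto simp: complex_nonpos_Reals_iff)
    then have "((\<lambda>u. (of_nat (Suc n) + u) powr (1 - s) / (1 - s)) has_field_derivative
             (of_real (real (Suc n) + t)) powr (- s)) (at (of_real t))"
      using assms by (auto intro!: derivative_eq_intros simp: add_ac)
    then have "((\<lambda>u. (of_nat (Suc n) + of_real u) powr (1 - s) / (1 - s)) has_vector_derivative
             (of_real (real (Suc n) + t)) powr (- s)) (at t within {0..1})"
      by (rule has_vector_derivative_real_field[THEN has_vector_derivative_at_within])
    then show "(?F has_vector_derivative of_real (real (Suc n) + t) powr (- s)) (at t within {0..1})"
      by simp
  qed auto
  then have "integral {0..1} (\<lambda>t. of_real (real (Suc n) + t) powr (- s)) = ?F 1 - ?F 0"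
    by (rule integral_unique)
  also have "\<dots> = - (of_nat (Suc n) powr (1 - s) - of_nat (Suc (Suc n)) powr (1 - s)) / - (s - 1)"
    by (simp add: diff_divide_distrib add_ac)
  finally show ?thesis by (simp only: minus_divide_divide)
qed

text \<open>The integrals subtracted in \<open>zeta_reg\<close> telescope to the integral over
  \<open>[1, infinity)\<close>, which is \<open>1/(s-1)\<close> for Re s > 1.\<close>

lemma zeta_reg_eq_sum:
  assumes s: "Re s > 1"
  shows "((\<lambda>n. of_nat (Suc n) powr (- s)) has_sum (zeta_reg s + 1 / (s - 1))) UNIV"
proof -
  have s1: "s \<noteq> 1" using s by auto
  have nrm: "norm (of_nat (Suc n) powr (- s) :: complex) = real (Suc n) powr (- Re s)" for n
    using norm_powr_real_powr[of "of_nat (Suc n)" "-s"] by simp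
  have abs: "(\<lambda>n. norm (of_nat (Suc n) powr (- s) :: complex)) summable_on UNIV"
    unfolding nrm using s by (rule summable_on_Suc_powr)
  let ?u = "\<lambda>n. of_nat (Suc n) powr (1 - s) / (s - 1) :: complex"
  have "((\<lambda>n. real (Suc n) powr (- (Re s - 1))) \<longlongrightarrow> 0) sequentially"
    using s tendsto_neg_powr[OF _ filterlim_compose[OF filterlim_real_sequentially filterlim_Suc]] by force
  moreover have "norm (of_nat (Suc n) powr (1 - s) :: complex) = real (Suc n) powr (- (Re s - 1))" for n
    using norm_powr_real_powr[of "of_nat (Suc n)" "1 - s"] by simp
  ultimately have "(\<lambda>n. norm (of_nat (Suc n) powr (1 - s) :: complex)) \<longlonglongrightarrow> 0" by presburger
  then have "(\<lambda>n. of_nat (Suc n) powr (1 - s) :: complex) \<longlonglongrightarrow> 0"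
    by (rule tendsto_norm_zero_cancel)
  then have "?u \<longlonglongrightarrow> 0 / (s - 1)" using s1 by (intro tendsto_intros) auto
  then have "(\<lambda>n. ?u n - ?u (Suc n)) sums (?u 0 - 0)" by (intro telescope_sums') auto
  moreover have "sum_int_diff (\<lambda>t. real (Suc n) + t) s = of_nat (Suc n) powr (- s) - (?u n - ?u (Suc n))" for n
    unfolding sum_int_diff_def using integral_Suc_powr[OF s1, of n] by (simp add: diff_divide_distrib)
  ultimately have 1: "(\<lambda>n. of_nat (Suc n) powr (- s) - sum_int_diff (\<lambda>t. real (Suc n) + t) s) sums (1 / (s - 1))"
    by simp
  have "(\<lambda>n. norm (sum_int_diff (\<lambda>t. real (Suc n) + t) s)) summable_on UNIV"
  proof (rule Infinite_Sum.abs_summable_on_comparison_test')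
    have "- (Re s + 1) = - Re s - 1" by simp
    moreover have "(\<lambda>n. real (Suc n) powr (- (Re s + 1))) summable_on UNIV"
      using s by (intro summable_on_Suc_powr) simp
    ultimately show "(\<lambda>n. norm s * real (Suc n) powr (- Re s - 1)) summable_on UNIV"
      by (simp only: summable_on_cmult_right)
    show "norm (sum_int_diff (\<lambda>t. real (Suc n) + t) s) \<le> norm s * real (Suc n) powr (- Re s - 1)" for n
      using s by (intro norm_sum_int_diff_le[where q' = "\<lambda>_. 1"])
        (auto intro!: derivative_eq_intros mult_left_mono powr_mono2')
  qed
  then have 2: "(\<lambda>n. sum_int_diff (\<lambda>t. real (Suc n) + t) s) summable_on UNIV"
    by (rule abs_summable_summable)
  have "(\<lambda>n. sum_int_diff (\<lambda>t. real (Suc n) + t) s) sums zeta_reg s"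
    unfolding zeta_reg_def by (rule has_sum_imp_sums) (rule has_sum_infsum[OF 2])
  from sums_add[OF 1 this] have "(\<lambda>n. of_nat (Suc n) powr (- s)) sums (zeta_reg s + 1 / (s - 1))"
    by (simp add: add_ac)
  then show ?thesis
    using abs by (intro norm_summable_imp_has_sum summable_on_imp_summable)
qed

text \<open>This replaces the abstract continuation by an explicit formula; the half-plane Re s > 0
  is where \<open>zeta_reg\<close> converges.\<close>

lemma zeta_eq:
  assumes s: "Re s > 0" "s \<noteq> 1"
  shows "zeta s = zeta_reg s + 1 / (s - 1)"
proof -
  let ?G = "\<lambda>s. zeta_reg s + 1 / (s - 1)"
  have hp: "open {s::complex. Re s > 0}" by (rule open_halfspace_Re_gt)
  have an: "zeta_reg analytic_on {s. Re s > 0}"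
    using zeta_reg_holomorphic hp analytic_on_open by blast
  have "mero_cont (\<lambda>s. \<Sum>n. 1 / of_nat (Suc n) powr s) s = ?G s"
  proof (rule mero_cont_eqI[where c = 0])
    have "zeta_reg meromorphic_on {w. 0 < Re w}" using an by (rule analytic_on_imp_meromorphic_on)
    then show "?G meromorphic_on {w. 0 < Re w}" by (intro meromorphic_intros)
    show "?G w = (\<Sum>n. 1 / of_nat (Suc n) powr w)" if "1 < Re w" for w
      using has_sum_imp_sums[OF zeta_reg_eq_sum[OF that]] by (simp add: sums_iff powr_minus_divide)
    have "zeta_reg analytic_on {w. 1 < Re w}" using an by (rule analytic_on_subset) auto
    then show "?G analytic_on {w. 1 < Re w}" by (intro analytic_intros) auto
    have "zeta_reg analytic_on {s}" using an by (rule analytic_on_subset) (use s in auto)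
    then show "?G analytic_on {s}" using s by (intro analytic_intros) auto
  qed (use s in auto)
  then show ?thesis by (simp add: zeta_def)
qed

lemma zeta_holomorphic: "zeta holomorphic_on ({s. Re s > 0} - {1})"
proof -
  have "(\<lambda>s. zeta_reg s + 1 / (s - 1)) holomorphic_on ({s. Re s > 0} - {1})"
    by (intro holomorphic_intros holomorphic_on_subset[OF zeta_reg_holomorphic]) auto
  then show ?thesis by (rule holomorphic_transform) (auto simp: zeta_eq)
qed

lemma zeta_has_sum:
  assumes "Re s > 1"
  shows "((\<lambda>n. of_nat n powr (- s)) has_sum zeta s) {0<..}"
proof -
  have "zeta s = zeta_reg s + 1 / (s - 1)" using assms by (intro zeta_eq) auto
  then have "((\<lambda>n. of_nat (Suc n) powr (- s)) has_sum zeta s) UNIV"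
    using zeta_reg_eq_sum[OF assms] by simp
  then show ?thesis
    by (subst (asm) has_sum_reindex_bij_witness[of _ "\<lambda>n. n - 1" Suc "{0<..}" "\<lambda>n. of_nat n powr (- s)" _ "zeta s"]) auto
qed

lemma zeta_2: "zeta 2 = of_real (pi\<^sup>2 / 6)"
proof -
  have "(\<lambda>n. complex_of_real (1 / (real n + 1)\<^sup>2)) sums of_real (pi\<^sup>2 / 6)"
    using inverse_squares_sums by (subst sums_of_real_iff) (simp add: add_ac)
  moreover have "complex_of_real (1 / (real n + 1)\<^sup>2) = of_nat (Suc n) powr (- 2)" for n
    by (simp add: powr_minus powr_numeral field_simps)
  ultimately have "(\<lambda>n. of_nat (Suc n) powr (- 2) :: complex) sums of_real (pi\<^sup>2 / 6)" by simp
  moreover have "(\<lambda>n. of_nat (Suc n) powr (- 2) :: complex) sums zeta 2"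
    using has_sum_imp_sums[OF zeta_reg_eq_sum[of 2]] zeta_eq[of 2] by simp
  ultimately show ?thesis using sums_unique2 by blast
qed

lemma tendsto_zeta_at_1: "((\<lambda>s. (s - 1) * zeta s) \<longlongrightarrow> 1) (at 1)"
proof -
  have "isCont zeta_reg 1"
    using zeta_reg_holomorphic open_halfspace_Re_gt[of 0]
    by (metis continuous_on_eq_continuous_at holomorphic_on_imp_continuous_on mem_Collect_eq one_complex.simps(1) zero_less_one)
  then have "((\<lambda>s. (s - 1) * zeta_reg s + 1) \<longlongrightarrow> (1 - 1) * zeta_reg 1 + 1) (at 1)"
    by (intro tendsto_intros) (auto simp: isCont_def)
  moreover have "\<forall>\<^sub>F s in at 1. (s - 1) * zeta_reg s + 1 = (s - 1) * zeta s"
  proof -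
    have "\<forall>\<^sub>F s in at (1::complex). s \<in> {s. Re s > 0}"
      by (intro eventually_at_in_open' open_halfspace_Re_gt) auto
    then show ?thesis unfolding eventually_at_filter
      by eventually_elim (auto simp: zeta_eq field_simps)
  qed
  ultimately show ?thesis using tendsto_cong by force
qed

section \<open>Moebius sums\<close>

lemma prime_factors_prod_primes:
  fixes X :: "nat set"
  assumes "finite X" "\<And>p. p \<in> X \<Longrightarrow> prime p"
  shows "prime_factors (\<Prod>X) = X"
proof -
  have "prime_factors (\<Prod>X) = \<Union>(prime_factors ` X)"
  proof (subst prime_factors_prod)
    show "0 \<notin> (\<lambda>p. p) ` X" using assms(2)[of 0] by auto
  qed (use assms(1) in \<open>auto simp: o_def\<close>)
  also have "\<dots> = X" using assms(2) by (auto simp: prime_prime_factors)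
  finally show ?thesis .
qed

lemma squarefree_prod_primes:
  fixes X :: "nat set"
  assumes "\<And>p. p \<in> X \<Longrightarrow> prime p"
  shows "squarefree (\<Prod>X)"
  using assms primes_coprime squarefree_prime by (intro squarefree_prod_coprime) blast+

lemma prod_prime_factors_squarefree:
  assumes "squarefree (d :: nat)" shows "\<Prod>(prime_factors d) = d"
proof -
  have d: "d \<noteq> 0" using assms by (metis not_squarefree_0)
  have "(\<Prod>p\<in>prime_factors d. p) = (\<Prod>p\<in>prime_factors d. p ^ multiplicity p d)"
    using assms squarefree_factorial_semiring'[OF d] by (intro prod.cong) auto
  also have "\<dots> = d" using prod_prime_factors[OF d] by simp
  finally show ?thesis by simp
qed

lemma prod_primes_dvd:
  assumes "N > 0" "X \<subseteq> prime_factors (N :: nat)" shows "\<Prod>X dvd N"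
proof -
  have "(\<Prod>p\<in>X. p) dvd (\<Prod>p\<in>prime_factors N. p)" using assms by (intro prod_dvd_prod_subset) auto
  also have "\<dots> dvd (\<Prod>p\<in>prime_factors N. p ^ multiplicity p N)"
    by (intro prod_dvd_prod) (auto simp: prime_factors_multiplicity intro!: dvd_power)
  also have "\<dots> = N" using prod_prime_factors[of N] assms by simp
  finally show ?thesis .
qed

text \<open>Only squarefree \<open>d\<close> contribute, and these are the products of subsets of
  the prime factors; the sum is the expansion of the product over subsets. Multiplicativity of
  \<open>F\<close> is asked only on products of distinct primes, so that indicators of divisibility
  or coprimality qualify.\<close>

lemma sum_moebius_mu_mult:
  fixes F :: "nat \<Rightarrow> 'a :: comm_ring_1"
  assumes N: "N > 0" and F: "\<And>X. X \<subseteq> prime_factors N \<Longrightarrow> F (\<Prod>X) = (\<Prod>p\<in>X. f p)"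
  shows "(\<Sum>d | d dvd N. of_int (moebius_mu d) * F d) = (\<Prod>p\<in>prime_factors N. 1 - f p)"
proof -
  let ?P = "prime_factors N"
  have fin: "finite X" and pr: "\<And>p. p \<in> X \<Longrightarrow> prime p" if "X \<subseteq> ?P" for X
    using that finite_subset by (auto dest: in_prime_factors_imp_prime)
  have "(\<Sum>d | d dvd N. of_int (moebius_mu d) * F d) = (\<Sum>d | d dvd N \<and> squarefree d. of_int (moebius_mu d) * F d)"
    using N by (intro sum.mono_neutral_right) (auto simp: moebius_mu_def)
  also have "\<dots> = (\<Sum>X\<in>Pow ?P. (\<Prod>p\<in>X. - f p) * (\<Prod>p\<in>?P - X. 1))"
  proof (rule sum.reindex_bij_witness[where i = "\<lambda>X. \<Prod>X" and j = prime_factors])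
    fix d assume d: "d \<in> {d. d dvd N \<and> squarefree d}"
    then show "\<Prod>(prime_factors d) = d" by (simp add: prod_prime_factors_squarefree)
    show "prime_factors d \<in> Pow ?P" using d N dvd_prime_factors[of N d] by blast
    then have "F (\<Prod>(prime_factors d)) = (\<Prod>p\<in>prime_factors d. f p)" by (intro F) auto
    then show "(\<Prod>p\<in>prime_factors d. - f p) * (\<Prod>p\<in>?P - prime_factors d. 1) = of_int (moebius_mu d) * F d"
      using d by (simp add: prod_prime_factors_squarefree moebius_mu_def prod_uminus)
  next
    fix X assume X: "X \<in> Pow ?P"
    then show "prime_factors (\<Prod>X) = X" by (intro prime_factors_prod_primes fin pr) auto
    show "\<Prod>X \<in> {d. d dvd N \<and> squarefree d}"
      using X N by (auto intro!: prod_primes_dvd squarefree_prod_primes pr)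
  qed
  also have "\<dots> = (\<Prod>p\<in>?P. - f p + 1)" by (rule prod_add[symmetric]) auto
  finally show ?thesis by simp
qed

lemma sum_moebius_mu:
  assumes "N > 0" shows "(\<Sum>d | d dvd N. moebius_mu d) = (if N = 1 then 1 else 0)"
proof -
  have "(\<Sum>d | d dvd N. of_int (moebius_mu d) * 1) = (\<Prod>p\<in>prime_factors N. 1 - (1::int))"
    using assms by (rule sum_moebius_mu_mult) auto
  also have "\<dots> = (if N = 1 then 1 else 0)"
  proof (cases "N = 1")
    case False
    then obtain p where "prime p" "p dvd N" using prime_factor_nat by blast
    then have "p \<in> prime_factors N" using assms by (auto simp: in_prime_factors_iff)
    then have "card (prime_factors N) \<noteq> 0" by (auto simp: card_eq_0_iff)
    then show ?thesis using False by (simp add: card_gt_0_iff)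
  qed simp
  finally show ?thesis by simp
qed

lemma sum_dvd_flip:
  assumes "N > 0" shows "(\<Sum>d | d dvd N. f d (N div d)) = (\<Sum>d | d dvd (N::nat). f (N div d) d)"
proof (rule sum.reindex_bij_witness[where i = "\<lambda>d. N div d" and j = "\<lambda>d. N div d"])
  fix d assume "d \<in> {d. d dvd N}"
  then obtain k where "N = d * k" by auto
  then show "N div (N div d) = d" "N div (N div d) = d" "N div d \<in> {d. d dvd N}" "N div d \<in> {d. d dvd N}"
     "f (N div (N div d)) (N div d) = f d (N div d)"
    using assms by auto
qed

text \<open>The left side is the total coefficient of the polar term after the sieve. With
  \<open>t = N/d\<close> it is \<open>N\<close> times the product of \<open>1 - 1/p\<close>.\<close>

lemma sum_moebius_mu_totient:
  assumes "N > 0"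
  shows "(\<Sum>t | t dvd N. of_int (moebius_mu (N div t)) * real t) = real (totient N)"
proof -
  have "(\<Sum>t | t dvd N. of_int (moebius_mu (N div t)) * real t) = (\<Sum>d | d dvd N. of_int (moebius_mu d) * real (N div d))"
    using sum_dvd_flip[OF assms, of "\<lambda>t d. of_int (moebius_mu d) * real t"] by simp
  also have "\<dots> = (\<Sum>d | d dvd N. of_int (moebius_mu d) * (1 / real d)) * real N"
    unfolding sum_distrib_right by (intro sum.cong) (auto simp: real_of_nat_div)
  also have "(\<Sum>d | d dvd N. of_int (moebius_mu d) * (1 / real d)) = (\<Prod>p\<in>prime_factors N. 1 - 1 / real p)"
    using assms by (rule sum_moebius_mu_mult) (auto simp: prod_dividef)
  finally show ?thesis by (simp add: totient_formula2)
qed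

lemma moebius_mu_mult:
  assumes "m > 0" "u > 0"
  shows "moebius_mu (m * u) = (if coprime m u then moebius_mu m * moebius_mu u else 0)"
proof (cases "coprime m u")
  case True
  have "prime_factors m \<inter> prime_factors u = {}"
    using True by (metis coprime_common_divisor disjoint_iff in_prime_factors_iff not_prime_unit)
  then have "card (prime_factors (m * u)) = card (prime_factors m) + card (prime_factors u)"
    using assms by (subst prime_factors_product) (auto intro: card_Un_disjoint)
  moreover have "squarefree (m * u) \<longleftrightarrow> squarefree m \<and> squarefree u"
    using squarefree_mult_coprime[OF True] squarefree_multD by blast
  ultimately show ?thesis using True by (auto simp: moebius_mu_def power_add)
next
  case False
  then obtain p where p: "prime p" "p dvd m" "p dvd u"
    using prime_factor_nat[of "gcd m u"] by (auto simp: coprime_iff_gcd_eq_1)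
  then have "p\<^sup>2 dvd m * u" by (simp add: mult_dvd_mono power2_eq_square)
  then have "\<not> squarefree (m * u)" using p by (intro not_squarefreeI[of p]) auto
  then show ?thesis using False by (simp add: moebius_mu_def)
qed

text \<open>Write \<open>N = m r\<close> and replace \<open>u\<close> by \<open>r/u\<close>. In
  \<open>mu(m u)\<close> only \<open>u\<close> coprime to \<open>m\<close> survive, so the sum is
  \<open>mu(m) r\<close> times the product of \<open>1 - 1/p\<close> over the primes of
  \<open>r\<close> that do not divide \<open>m\<close>. By Euler's product formula this is
  \<open>mu(m) phi(N)/phi(m)\<close>. The computation runs in the reals, where \<open>1/u\<close> is
  a multiplicative weight.\<close>

lemma sum_mult_moebius_mu_cofactor:
  assumes N: "N > 0" and r: "r dvd N"
  shows "(\<Sum>u | u dvd r. int u * moebius_mu (N div u)) =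
           moebius_mu (N div r) * int (totient N div totient (N div r))"
proof -
  obtain m where m: "N = m * r" using r by (metis dvdE mult.commute)
  have m0: "m > 0" "r > 0" using N m by auto
  have "(\<Sum>u | u dvd r. int u * moebius_mu (N div u)) =
        (\<Sum>u | u dvd r. int (r div u) * moebius_mu (m * u))"
  proof -
    have "(\<Sum>u | u dvd r. int u * moebius_mu (N div u)) = (\<Sum>u | u dvd r. int u * moebius_mu (m * (r div u)))"
      using m by (intro sum.cong) (auto simp: div_mult_swap)
    then show ?thesis using sum_dvd_flip[OF m0(2), of "\<lambda>u v. int u * moebius_mu (m * v)"] by simp
  qed
  also have "real_of_int \<dots> = of_int (moebius_mu m) * real r *
      (\<Sum>u | u dvd r. of_int (moebius_mu u) * (if coprime m u then 1 / real u else 0))"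
    unfolding of_int_sum sum_distrib_left using m0
    by (intro sum.cong) (auto simp: moebius_mu_mult real_of_nat_div dest: dvd_pos_nat)
  also have "(\<Sum>u | u dvd r. of_int (moebius_mu u) * (if coprime m u then 1 / real u else 0)) =
      (\<Prod>p\<in>prime_factors r. 1 - (if coprime m p then 1 / real p else 0))"
  proof (rule sum_moebius_mu_mult[OF m0(2)])
    fix X assume X: "X \<subseteq> prime_factors r"
    then have "finite X" using finite_subset by blast
    then show "(if coprime m (\<Prod>X) then 1 / real (\<Prod>X) else 0) = (\<Prod>p\<in>X. if coprime m p then 1 / real p else 0)"
      by induction (auto simp: divide_inverse mult.commute)
  qed
  also have "\<dots> = (\<Prod>p\<in>prime_factors r - prime_factors m. 1 - 1 / real p)"
  proof (rule prod.mono_neutral_cong_right)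
    show "\<forall>p\<in>prime_factors r - (prime_factors r - prime_factors m). 1 - (if coprime m p then 1 / real p else 0) = 1"
    proof
      fix p assume "p \<in> prime_factors r - (prime_factors r - prime_factors m)"
      then have "prime p" "p dvd m" by (auto dest: in_prime_factors_imp_prime in_prime_factors_imp_dvd)
      then have "\<not> coprime m p" using coprime_common_divisor[of m p p] by auto
      then show "1 - (if coprime m p then 1 / real p else 0) = 1" by simp
    qed
    show "1 - (if coprime m p then 1 / real p else 0) = 1 - 1 / real p" if "p \<in> prime_factors r - prime_factors m" for p
      using that m0 prime_imp_coprime[of p m] by (auto simp: in_prime_factors_iff coprime_commute)
  qed auto
  finally have *: "real_of_int (\<Sum>u | u dvd r. int u * moebius_mu (N div u)) =
      of_int (moebius_mu m) * (real r * (\<Prod>p\<in>prime_factors r - prime_factors m. 1 - 1 / real p))" by simp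
  have "prime_factors N = prime_factors m \<union> (prime_factors r - prime_factors m)"
    unfolding m using m0 by (subst prime_factors_product) auto
  then have "(\<Prod>p\<in>prime_factors N. 1 - 1 / real p) =
     (\<Prod>p\<in>prime_factors m. 1 - 1 / real p) * (\<Prod>p\<in>prime_factors r - prime_factors m. 1 - 1 / real p)"
    by (simp only:) (rule prod.union_disjoint, auto)
  then have "real (totient N) = real (totient m) * (real r * (\<Prod>p\<in>prime_factors r - prime_factors m. 1 - 1 / real p))"
    unfolding totient_formula2[of N] totient_formula2[of m] using m by (simp only: of_nat_mult mult_ac)
  moreover have "totient m dvd totient N" by (rule totient_dvd) (use m in auto)
  moreover have "real (totient m) \<noteq> 0" using m0 by simp
  ultimately have "real (totient N div totient m) = real r * (\<Prod>p\<in>prime_factors r - prime_factors m. 1 - 1 / real p)"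
    by (simp add: real_of_nat_div)
  with * have "real_of_int (\<Sum>u | u dvd r. int u * moebius_mu (N div u)) =
      of_int (moebius_mu m * int (totient N div totient m))" by (simp only: of_int_mult of_int_of_nat_eq)
  then have "(\<Sum>u | u dvd r. int u * moebius_mu (N div u)) = moebius_mu m * int (totient N div totient m)"
    by (simp only: of_int_eq_iff)
  moreover have "N div r = m" using m m0 by simp
  ultimately show ?thesis by (simp only:)
qed

text \<open>By the preceding lemma the factor attached to \<open>r\<close> is itself a divisor sum
  of \<open>u mu(N/u)\<close>, so \<open>a_exp\<close> is the Moebius inverse of a summatory
  function and inversion returns the summand. In this form the exponents match the coefficients that
  the sieve produces.\<close>

lemma a_exp_eq:
  assumes N: "N > 0" and t: "t dvd N"
  shows "a_exp N t = int t * moebius_mu (N div t)"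
proof -
  have t0: "t > 0" using N t by (rule dvd_pos_nat)
  have "a_exp N t = (\<Sum>r | r dvd t. moebius_mu (t div r) * (\<Sum>u | u dvd r. int u * moebius_mu (N div u)))"
    unfolding a_exp_def using N t
    by (intro sum.cong) (auto simp: sum_mult_moebius_mu_cofactor dvd_trans)
  also have "\<dots> = (\<Sum>r\<in>{r. r dvd t}. \<Sum>u\<in>{u\<in>{u. u dvd t}. u dvd r}. moebius_mu (t div r) * (int u * moebius_mu (N div u)))"
    unfolding sum_distrib_left by (intro sum.cong refl) (auto intro: dvd_trans)
  also have "\<dots> = (\<Sum>u\<in>{u. u dvd t}. \<Sum>r\<in>{r\<in>{r. r dvd t}. u dvd r}. moebius_mu (t div r) * (int u * moebius_mu (N div u)))"
    using t0 by (intro sum.swap_restrict) auto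
  also have "\<dots> = (\<Sum>u\<in>{u. u dvd t}. if u = t then int u * moebius_mu (N div u) else 0)"
  proof (intro sum.cong refl)
    fix u assume "u \<in> {u. u dvd t}"
    then obtain v where v: "t = u * v" by auto
    have uv: "u > 0" "v > 0" using t0 v by auto
    \<comment> \<open>The divisors \<open>r\<close> of \<open>t = u v\<close> that are multiples of
      \<open>u\<close> correspond to the divisors \<open>w = t/r\<close> of \<open>v\<close>, and
      the Moebius sum keeps only \<open>v = 1\<close>.\<close>
    have "(\<Sum>r\<in>{r\<in>{r. r dvd t}. u dvd r}. moebius_mu (t div r)) = (\<Sum>w | w dvd v. moebius_mu w)"
      by (rule sum.reindex_bij_witness[where i = "\<lambda>w. t div w" and j = "\<lambda>r. t div r"])
         (use v uv in \<open>auto elim!: dvdE\<close>)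
    also have "\<dots> = (if v = 1 then 1 else 0)" using uv(2) by (rule sum_moebius_mu)
    finally show "(\<Sum>r\<in>{r\<in>{r. r dvd t}. u dvd r}. moebius_mu (t div r) * (int u * moebius_mu (N div u))) =
          (if u = t then int u * moebius_mu (N div u) else 0)"
      using v uv unfolding sum_distrib_right[symmetric] by auto
  qed
  also have "\<dots> = int t * moebius_mu (N div t)" using t0 by (simp add: sum.delta)
  finally show ?thesis .
qed

section \<open>The Beta integral over the real line\<close>

lemma nn_integral_gaussian:
  assumes "a > 0"
  shows "(\<integral>\<^sup>+t. ennreal (exp (- (a * t\<^sup>2))) \<partial>lborel) = ennreal (sqrt (pi / a))"
proof -
  \<comment> \<open>With variance \<open>1/(2a)\<close> the normal density is the integrand divided
    by its integral.\<close>
  define \<sigma> where "\<sigma> = sqrt (1 / (2 * a))"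
  have \<sigma>: "\<sigma> > 0" "\<sigma>\<^sup>2 = 1 / (2 * a)" using assms by (auto simp: \<sigma>_def)
  have "(\<integral>\<^sup>+t. ennreal (normal_density 0 \<sigma> t) \<partial>lborel) = ennreal (\<integral>t. normal_density 0 \<sigma> t \<partial>lborel)"
    using \<sigma> by (intro nn_integral_eq_integral integrable_normal_density) auto
  also have "\<dots> = 1" using \<sigma> by simp
  finally have *: "(\<integral>\<^sup>+t. ennreal (normal_density 0 \<sigma> t) \<partial>lborel) = 1" .
  have "ennreal (exp (- (a * t\<^sup>2))) = ennreal (sqrt (pi / a)) * ennreal (normal_density 0 \<sigma> t)" for t
  proof -
    have "exp (- (a * t\<^sup>2)) = sqrt (pi / a) * normal_density 0 \<sigma> t"
      using assms \<sigma> by (simp add: normal_density_def real_sqrt_divide mult.commute)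
    then show ?thesis using assms by (simp add: ennreal_mult')
  qed
  then show ?thesis by (simp add: nn_integral_cmult *)
qed

lemma nn_integral_Gamma_scaled:
  assumes "\<sigma> > 0" "c > 0"
  shows "(\<integral>\<^sup>+u. ennreal (indicator {0..} u * u powr (\<sigma> - 1) * exp (- (c * u))) \<partial>lborel) = ennreal (Gamma \<sigma> * c powr (- \<sigma>))"
proof -
  have "(\<integral>\<^sup>+u. ennreal (indicator {0..} u * u powr (\<sigma> - 1) * exp (- (c * u))) \<partial>lborel) =
        ennreal \<bar>1 / c\<bar> * (\<integral>\<^sup>+u. ennreal (indicator {0..} (0 + 1 / c * u) * (0 + 1 / c * u) powr (\<sigma> - 1) * exp (- (c * (0 + 1 / c * u)))) \<partial>lborel)"
    using assms by (intro nn_integral_real_affine) auto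
  also have "\<dots> = (\<integral>\<^sup>+u. ennreal (c powr (- \<sigma>)) * ennreal (indicator {0..} u * u powr (\<sigma> - 1) / exp u) \<partial>lborel)"
  proof (subst nn_integral_cmult[symmetric], simp, intro nn_integral_cong)
    fix u :: real
    have "1 / c * (indicator {0..} (0 + 1 / c * u) * (0 + 1 / c * u) powr (\<sigma> - 1) * exp (- (c * (0 + 1 / c * u)))) =
          c powr (- \<sigma>) * (indicator {0..} u * u powr (\<sigma> - 1) / exp u)"
      using assms by (cases "u \<ge> 0")
        (auto simp: indicator_def powr_divide powr_diff powr_minus exp_minus field_simps zero_le_divide_iff)
    then show "ennreal \<bar>1 / c\<bar> * ennreal (indicator {0..} (0 + 1 / c * u) * (0 + 1 / c * u) powr (\<sigma> - 1) * exp (- (c * (0 + 1 / c * u)))) =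
          ennreal (c powr (- \<sigma>)) * ennreal (indicator {0..} u * u powr (\<sigma> - 1) / exp u)"
      using assms by (simp add: ennreal_mult'[symmetric])
  qed
  also have "\<dots> = ennreal (c powr (- \<sigma>)) * ennreal (Gamma \<sigma>)"
    using assms(1) by (simp add: nn_integral_cmult Gamma_conv_nn_integral_real)
  finally show ?thesis using assms by (simp add: ennreal_mult' mult.commute)
qed

text \<open>Write \<open>Gamma \<sigma> (1+t^2)^(-\<sigma>)\<close> as the Gamma integral of
  \<open>u^(\<sigma>-1) exp(-(1+t^2) u)\<close>, exchange the integrals and do the Gaussian in
  \<open>t\<close>. It contributes \<open>sqrt(pi/u)\<close>, which shifts the Gamma argument by
  1/2. All integrands are nonnegative, so Tonelli justifies the exchange.\<close>

lemma nn_integral_one_plus_square_powr: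
  assumes "\<sigma> > 1 / 2"
  shows "(\<integral>\<^sup>+t. ennreal ((1 + t\<^sup>2) powr (- \<sigma>)) \<partial>lborel) = ennreal (sqrt pi * Gamma (\<sigma> - 1 / 2) / Gamma \<sigma>)"
proof -
  let ?g = "\<lambda>(u::real) (t::real). ennreal (indicator {0..} u * u powr (\<sigma> - 1) * exp (- ((1 + t\<^sup>2) * u)))"
  have G: "Gamma \<sigma> > 0" using assms by (intro Gamma_real_pos) auto
  have "ennreal (Gamma \<sigma>) * (\<integral>\<^sup>+t. ennreal ((1 + t\<^sup>2) powr (- \<sigma>)) \<partial>lborel) = (\<integral>\<^sup>+t. ennreal (Gamma \<sigma> * (1 + t\<^sup>2) powr (- \<sigma>)) \<partial>lborel)"
    using G by (subst nn_integral_cmult[symmetric]) (auto simp: ennreal_mult')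
  also have "\<dots> = (\<integral>\<^sup>+t. \<integral>\<^sup>+u. ?g u t \<partial>lborel \<partial>lborel)"
    using assms by (intro nn_integral_cong nn_integral_Gamma_scaled[symmetric]) (auto simp: add_pos_nonneg)
  also have "\<dots> = (\<integral>\<^sup>+u. \<integral>\<^sup>+t. ?g u t \<partial>lborel \<partial>lborel)"
    by (rule lborel_pair.Fubini') (simp add: case_prod_unfold)
  also have "\<dots> = (\<integral>\<^sup>+u. ennreal (sqrt pi) * ennreal (indicator {0..} u * u powr (\<sigma> - 1 / 2 - 1) * exp (- (1 * u))) \<partial>lborel)"
  \<comment> \<open>The Gaussian formula needs \<open>u > 0\<close>; the point \<open>u = 0\<close>
    is discarded as a null set.\<close>
  proof (intro nn_integral_cong_AE eventually_mono[OF AE_lborel_singleton[of 0]])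
    fix u :: real assume u: "u \<noteq> 0"
    show "(\<integral>\<^sup>+t. ?g u t \<partial>lborel) = ennreal (sqrt pi) * ennreal (indicator {0..} u * u powr (\<sigma> - 1 / 2 - 1) * exp (- (1 * u)))"
    proof (cases "u > 0")
      case True
      have "(\<integral>\<^sup>+t. ?g u t \<partial>lborel) = (\<integral>\<^sup>+t. ennreal (u powr (\<sigma> - 1) * exp (- u)) * ennreal (exp (- (u * t\<^sup>2))) \<partial>lborel)"
        using True by (intro nn_integral_cong)
          (auto simp: ennreal_mult'[symmetric] exp_add[symmetric] algebra_simps simp flip: mult.assoc)
      also have "\<dots> = ennreal (u powr (\<sigma> - 1) * exp (- u)) * ennreal (sqrt (pi / u))"
        using True by (subst nn_integral_cmult) (auto simp: nn_integral_gaussian)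
      also have "\<dots> = ennreal (sqrt pi * (u powr (\<sigma> - 1) * u powr (- (1 / 2)) * exp (- u)))"
        using True by (simp add: ennreal_mult'[symmetric] real_sqrt_divide powr_minus powr_half_sqrt field_simps)
      also have "u powr (\<sigma> - 1) * u powr (- (1 / 2)) = u powr (\<sigma> - 1 / 2 - 1)"
        by (subst powr_add[symmetric]) (simp add: algebra_simps)
      finally show ?thesis using True by (simp add: ennreal_mult')
    qed (use u in auto)
  qed
  also have "\<dots> = ennreal (sqrt pi) * ennreal (Gamma (\<sigma> - 1 / 2) * 1 powr (- (\<sigma> - 1 / 2)))"
    using assms by (subst nn_integral_cmult, simp, subst nn_integral_Gamma_scaled) auto
  finally have *: "ennreal (Gamma \<sigma>) * (\<integral>\<^sup>+t. ennreal ((1 + t\<^sup>2) powr (- \<sigma>)) \<partial>lborel) = ennreal (sqrt pi * Gamma (\<sigma> - 1 / 2))"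
    by (simp add: ennreal_mult')
  have "(\<integral>\<^sup>+t. ennreal ((1 + t\<^sup>2) powr (- \<sigma>)) \<partial>lborel) =
      ennreal (1 / Gamma \<sigma>) * (ennreal (Gamma \<sigma>) * (\<integral>\<^sup>+t. ennreal ((1 + t\<^sup>2) powr (- \<sigma>)) \<partial>lborel))"
    unfolding mult.assoc[symmetric] using G by (subst ennreal_mult'[symmetric]) auto
  also have "\<dots> = ennreal (1 / Gamma \<sigma> * (sqrt pi * Gamma (\<sigma> - 1 / 2)))"
    unfolding * using G by (subst ennreal_mult'[symmetric]) auto
  finally show ?thesis by simp
qed

lemma nn_integral_quadratic_powr:
  assumes "\<sigma> > 1 / 2" "v > 0"
  shows "(\<integral>\<^sup>+t. ennreal (((t + u)\<^sup>2 + v\<^sup>2) powr (- \<sigma>)) \<partial>lborel) =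
           ennreal (v powr (1 - 2 * \<sigma>) * (sqrt pi * Gamma (\<sigma> - 1 / 2) / Gamma \<sigma>))"
proof -
  have "(\<integral>\<^sup>+t. ennreal (((t + u)\<^sup>2 + v\<^sup>2) powr (- \<sigma>)) \<partial>lborel) =
        ennreal \<bar>v\<bar> * (\<integral>\<^sup>+t. ennreal (((- u + v * t + u)\<^sup>2 + v\<^sup>2) powr (- \<sigma>)) \<partial>lborel)"
    using assms by (intro nn_integral_real_affine) auto
  also have "\<dots> = (\<integral>\<^sup>+t. ennreal (v powr (1 - 2 * \<sigma>)) * ennreal ((1 + t\<^sup>2) powr (- \<sigma>)) \<partial>lborel)"
  proof (subst nn_integral_cmult[symmetric], simp, intro nn_integral_cong)
    fix t :: real
    have "(- u + v * t + u)\<^sup>2 + v\<^sup>2 = v powr 2 * (1 + t\<^sup>2)" using assms by (simp add: field_simps power2_eq_square)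
    then have "((- u + v * t + u)\<^sup>2 + v\<^sup>2) powr (- \<sigma>) = v powr (- 2 * \<sigma>) * (1 + t\<^sup>2) powr (- \<sigma>)"
      by (simp only: powr_mult powr_powr) simp
    moreover have "v * v powr (- 2 * \<sigma>) = v powr (1 - 2 * \<sigma>)"
      using assms powr_add[of v 1 "- 2 * \<sigma>"] by simp
    ultimately have "v * ((- u + v * t + u)\<^sup>2 + v\<^sup>2) powr (- \<sigma>) = v powr (1 - 2 * \<sigma>) * (1 + t\<^sup>2) powr (- \<sigma>)"
      by (metis mult.assoc)
    then show "ennreal \<bar>v\<bar> * ennreal (((- u + v * t + u)\<^sup>2 + v\<^sup>2) powr (- \<sigma>)) =
               ennreal (v powr (1 - 2 * \<sigma>)) * ennreal ((1 + t\<^sup>2) powr (- \<sigma>))"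
      using assms by (simp add: ennreal_mult'[symmetric])
  qed
  also have "\<dots> = ennreal (v powr (1 - 2 * \<sigma>)) * ennreal (sqrt pi * Gamma (\<sigma> - 1 / 2) / Gamma \<sigma>)"
    using assms by (subst nn_integral_cmult) (auto simp: nn_integral_one_plus_square_powr)
  finally show ?thesis by (simp only: ennreal_mult'[OF powr_ge_zero])
qed

text \<open>Half-open unit intervals tile the line, and nonnegativity turns countable additivity
  into an unordered sum. This brings the Beta integral into the form in which
  \<open>sum_int_diff\<close> subtracts it.\<close>

lemma has_sum_unit_integrals:
  fixes f :: "real \<Rightarrow> real"
  assumes cont: "continuous_on UNIV f" and nn: "\<And>x. f x \<ge> 0"
    and I: "(\<integral>\<^sup>+t. ennreal (f t) \<partial>lborel) = ennreal I" "I \<ge> 0"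
  shows "((\<lambda>n::int. integral {0..1} (\<lambda>t. f (of_int n + t))) has_sum I) UNIV"
proof -
  define g where "g n = integral {0..1} (\<lambda>t. f (of_int n + t))" for n :: int
  have meas: "f \<in> borel_measurable borel" using cont by (rule borel_measurable_continuous_onI)
  have cont': "continuous_on {0..1} (\<lambda>t. f (of_int n + t))" for n :: int
    by (rule continuous_on_compose2[OF cont]) (auto intro!: continuous_intros)
  have g0: "g n \<ge> 0" for n unfolding g_def
    by (intro integral_nonneg integrable_continuous_real cont') (auto simp: nn)
  have piece: "(\<integral>\<^sup>+x\<in>{of_int n..<of_int n + 1}. ennreal (f x) \<partial>lborel) = ennreal (g n)" for n :: int
  proof -
    have "(\<integral>\<^sup>+x. ennreal (f x) * indicator {of_int n..<of_int n + 1} x \<partial>lborel) =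
        ennreal \<bar>1\<bar> * (\<integral>\<^sup>+x. ennreal (f (of_int n + 1 * x)) * indicator {of_int n..<of_int n + 1} (of_int n + 1 * x) \<partial>lborel)"
      using meas by (intro nn_integral_real_affine) auto
    also have "\<dots> = (\<integral>\<^sup>+x. ennreal (f (of_int n + 1 * x)) * indicator {of_int n..<of_int n + 1} (of_int n + 1 * x) \<partial>lborel)"
      by simp
    \<comment> \<open>Half-open for the tiling, closed for the gauge integral: the two differ in the
      point 1 only.\<close>
    also have "\<dots> = (\<integral>\<^sup>+x. ennreal (indicator {0..1} x * f (of_int n + x)) \<partial>lborel)"
      by (intro nn_integral_cong_AE eventually_mono[OF AE_lborel_singleton[of 1]]) (auto simp: indicator_def)
    also have "\<dots> = ennreal (g n)" unfolding g_def
      by (intro nn_integral_has_integral_lebesgue nn integrable_integral integrable_continuous_real cont')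
    finally show ?thesis .
  qed
  define B where "B i = {real_of_int (int_decode i)..<of_int (int_decode i) + 1}" for i
  have "disjoint_family B"
    unfolding disjoint_family_on_def
  proof (intro ballI impI)
    fix i j :: nat assume "i \<noteq> j"
    then have "int_decode i \<noteq> int_decode j" by (metis int_decode_inverse)
    then show "B i \<inter> B j = {}" by (auto simp: B_def)
  qed
  moreover have "(\<Union>i. B i) = UNIV"
  proof -
    have "x \<in> B (int_encode \<lfloor>x\<rfloor>)" for x by (simp add: B_def)
    then show ?thesis by blast
  qed
  ultimately have "(\<Sum>i. ennreal (g (int_decode i))) = ennreal I"
    using nn_integral_disjoint_family[of "\<lambda>x. ennreal (f x)" lborel B] meas I
    by (simp add: piece B_def)
  moreover from this have "summable (\<lambda>i. g (int_decode i))"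
    using g0 by (intro summable_suminf_not_top) auto
  ultimately have "(\<lambda>i. g (int_decode i)) sums I"
    using g0 I(2) by (simp add: suminf_ennreal2 suminf_nonneg sums_iff)
  then have "((\<lambda>i. g (int_decode i)) has_sum I) UNIV"
    using g0 by (intro sums_nonneg_imp_has_sum) auto
  then have "(g has_sum I) UNIV"
    using has_sum_reindex_bij_betw[OF bij_int_decode, of g I] by simp
  then show ?thesis by (simp add: g_def[abs_def])
qed

section \<open>Lattice sums\<close>

lemma summable_on_one_plus_abs_int_powr:
  assumes "a > 1" shows "(\<lambda>n::int. (1 + \<bar>real_of_int n\<bar>) powr (- a)) summable_on UNIV"
proof -
  let ?f = "\<lambda>n::int. (1 + \<bar>real_of_int n\<bar>) powr (- a)"
  have S: "(\<lambda>n. real (Suc n) powr (- a)) summable_on (UNIV :: nat set)"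
    using assms by (rule summable_on_Suc_powr)
  have "?f summable_on {0..}"
    using S by (subst summable_on_reindex_bij_witness[of "{0..}" int nat UNIV "\<lambda>n. real (Suc n) powr (- a)"]) (auto simp: add_ac)
  moreover have "?f summable_on {..0}"
    using S by (subst summable_on_reindex_bij_witness[of "{..0}" "\<lambda>n. - int n" "\<lambda>n. nat (- n)" UNIV "\<lambda>n. real (Suc n) powr (- a)"]) (auto simp: add_ac)
  ultimately have "?f summable_on ({0..} \<union> {..0})" by (rule summable_on_union)
  moreover have "{0..} \<union> {..0} = (UNIV :: int set)" by auto
  ultimately show ?thesis by simp
qed

text \<open>A lower bound, up to a constant, for \<open>|m z + n|^2\<close> away from the origin.
  Being a product, it lets the majorant of a double sum split into two single sums, each convergent
  for exponents above 1.\<close>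

definition lattice_weight :: "int \<times> int \<Rightarrow> real" where
  "lattice_weight p = (1 + \<bar>real_of_int (fst p)\<bar>) * (1 + \<bar>real_of_int (snd p)\<bar>)"

lemma lattice_weight_ge_1: "lattice_weight p \<ge> 1"
proof -
  have "1 * 1 \<le> (1 + \<bar>real_of_int (fst p)\<bar>) * (1 + \<bar>real_of_int (snd p)\<bar>)" by (intro mult_mono) auto
  then show ?thesis by (simp add: lattice_weight_def)
qed

lemma summable_on_lattice_weight:
  assumes "a > 1" shows "(\<lambda>p. lattice_weight p powr (- a)) summable_on A"
proof -
  let ?g = "\<lambda>n::int. (1 + \<bar>real_of_int n\<bar>) powr (- a)"
  have S: "?g summable_on UNIV" using assms by (rule summable_on_one_plus_abs_int_powr)
  have "(\<lambda>p. lattice_weight p powr (- a)) summable_on (Sigma UNIV (\<lambda>_. UNIV))"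
  proof (rule summable_on_SigmaI)
    show "((\<lambda>y. lattice_weight (x, y) powr (- a)) has_sum ?g x * (\<Sum>\<^sub>\<infinity>y. ?g y)) UNIV" for x
      unfolding lattice_weight_def fst_conv snd_conv powr_mult
      by (intro has_sum_cmult_right has_sum_infsum S)
    show "(\<lambda>x. ?g x * (\<Sum>\<^sub>\<infinity>y. ?g y)) summable_on UNIV" by (intro summable_on_cmult_left S)
  qed auto
  then show ?thesis using summable_on_subset by (metis UNIV_Times_UNIV subset_UNIV)
qed

text \<open>The last argument is real so that one function serves both the lattice points and the
  integrals along a row.\<close>

definition lattice_form :: "complex \<Rightarrow> int \<Rightarrow> real \<Rightarrow> real" where
  "lattice_form z m t = (norm (of_int m * z + of_real t))\<^sup>2"

lemma lattice_form_eq: "lattice_form z m t = (t + of_int m * Re z)\<^sup>2 + (of_int m * Im z)\<^sup>2"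
  by (simp add: lattice_form_def cmod_power2 algebra_simps)

text \<open>The positive definite form dominates \<open>m^2 + t^2\<close>, which in turn dominates
  the weight. The second bound holds along the whole unit interval after \<open>n\<close>; it
  concerns \<open>m >= 1\<close> because on the row \<open>m = 0\<close> the form has a
  zero.\<close>

lemma lattice_form_lower:
  assumes "Im z > 0"
  obtains \<kappa> where "\<kappa> > 0" "\<kappa> \<le> 1"
    "\<And>m n. (m, n) \<noteq> (0, 0) \<Longrightarrow> lattice_form z m (of_int n) \<ge> \<kappa> * lattice_weight (m, n)"
    "\<And>m n t. m \<ge> 1 \<Longrightarrow> t \<in> {0..1} \<Longrightarrow> lattice_form z m (of_int n + t) \<ge> \<kappa> * lattice_weight (m, n)"
proof -
  \<comment> \<open>With \<open>u = t + m x\<close> one has \<open>t^2 <= 2 u^2 + 2 (m x)^2\<close>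
    and \<open>m^2 = (m y)^2 / y^2\<close>. The fraction absorbs the multiples of
    \<open>m^2\<close>, the summand 2 the term \<open>2 u^2\<close>.\<close>
  define C where "C = 2 + (2 * (Re z)\<^sup>2 + 1) / (Im z)\<^sup>2"
  have C: "C \<ge> 2" by (simp add: C_def)
  have base: "(of_int m)\<^sup>2 + t\<^sup>2 \<le> C * lattice_form z m t" for m t
  proof -
    define u where "u = t + of_int m * Re z"
    have "0 \<le> (t + 2 * (of_int m * Re z))\<^sup>2" by simp
    then have "t\<^sup>2 \<le> 2 * u\<^sup>2 + 2 * (of_int m * Re z)\<^sup>2" by (simp add: u_def power2_eq_square algebra_simps)
    moreover have "(of_int m * Im z)\<^sup>2 * ((2 * (Re z)\<^sup>2 + 1) / (Im z)\<^sup>2) = (of_int m)\<^sup>2 * (2 * (Re z)\<^sup>2 + 1)"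
      using assms by (simp add: power_mult_distrib)
    moreover have "C * lattice_form z m t = 2 * u\<^sup>2 + 2 * (of_int m * Im z)\<^sup>2 +
        u\<^sup>2 * ((2 * (Re z)\<^sup>2 + 1) / (Im z)\<^sup>2) + (of_int m * Im z)\<^sup>2 * ((2 * (Re z)\<^sup>2 + 1) / (Im z)\<^sup>2)"
      unfolding lattice_form_eq C_def u_def by (simp only: algebra_simps)
    moreover have "u\<^sup>2 * ((2 * (Re z)\<^sup>2 + 1) / (Im z)\<^sup>2) \<ge> 0" by simp
    moreover have "(of_int m)\<^sup>2 * (2 * (Re z)\<^sup>2 + 1) = 2 * (of_int m * Re z)\<^sup>2 + (of_int m)\<^sup>2"
      by (simp add: power_mult_distrib algebra_simps)
    moreover have "(of_int m * Im z)\<^sup>2 \<ge> 0" by simp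
    ultimately show ?thesis by linarith
  qed
  \<comment> \<open>The 5 is a constant with which \<open>m^2\<close> plus the square of the second
    coordinate dominates the weight in both cases below.\<close>
  define \<kappa> where "\<kappa> = 1 / (5 * C)"
  show thesis
  proof (rule that)
    show "\<kappa> > 0" "\<kappa> \<le> 1" using C by (auto simp: \<kappa>_def)
    show "lattice_form z m (of_int n) \<ge> \<kappa> * lattice_weight (m, n)" if "(m, n) \<noteq> (0, 0)" for m n
    proof -
      define p q where "p = \<bar>real_of_int m\<bar>" and "q = \<bar>real_of_int n\<bar>"
      have pp: "p \<le> p\<^sup>2" "q \<le> q\<^sup>2"
      proof -
        have "\<bar>k\<bar> \<le> k\<^sup>2" for k :: int
          by (metis abs_ge_zero abs_le_square_iff int_one_le_iff_zero_less linorder_not_less mult_le_cancel_left1 order_le_less power2_abs power2_eq_square zero_less_mult_iff)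
        then show "p \<le> p\<^sup>2" "q \<le> q\<^sup>2" unfolding p_def q_def
          by (metis of_int_abs of_int_le_iff of_int_power power2_abs)+
      qed
      have "1 \<le> \<bar>m\<bar> + \<bar>n\<bar>" using that by auto
      then have pq1: "1 \<le> p + q" unfolding p_def q_def
        by (metis of_int_1 of_int_abs of_int_add of_int_le_iff)
      have "0 \<le> (p - q)\<^sup>2" by simp
      then have "2 * (p * q) \<le> p\<^sup>2 + q\<^sup>2" by (simp add: power2_eq_square algebra_simps)
      then have "(1 + p) * (1 + q) \<le> 5 * (p\<^sup>2 + q\<^sup>2)" using pp pq1 by (simp add: algebra_simps)
      then have "lattice_weight (m, n) \<le> 5 * ((of_int m)\<^sup>2 + (of_int n)\<^sup>2)" by (simp add: p_def q_def lattice_weight_def)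
      also have "\<dots> \<le> 5 * (C * lattice_form z m (of_int n))" using base[of m "of_int n"] by simp
      finally show ?thesis using C by (simp add: \<kappa>_def field_simps)
    qed
    show "lattice_form z m (of_int n + t) \<ge> \<kappa> * lattice_weight (m, n)" if m: "m \<ge> 1" and t: "t \<in> {0..1}" for m n t
    proof -
      define p q r where "p = \<bar>real_of_int m\<bar>" and "q = \<bar>real_of_int n\<bar>" and "r = \<bar>of_int n + t\<bar>"
      have p: "p \<ge> 1" using m by (simp add: p_def)
      \<comment> \<open>Here \<open>p >= 1\<close> absorbs the constants: \<open>1 + p <= 2p\<close>
        and \<open>1 + q <= 2 + r <= 2p + r\<close>.\<close>
      have "q \<le> 1 + r" using t by (auto simp: q_def r_def)
      then have "(1 + p) * (1 + q) \<le> (2 * p) * (2 * p + r)"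
        using p by (intro mult_mono) (auto simp: q_def r_def)
      also have "\<dots> \<le> 5 * (p\<^sup>2 + r\<^sup>2)"
      proof -
        have "5 * (p\<^sup>2 + r\<^sup>2) - 2 * p * (2 * p + r) = (p - r)\<^sup>2 + 4 * r\<^sup>2"
          by (simp add: power2_eq_square algebra_simps)
        also have "\<dots> \<ge> 0" by simp
        finally show ?thesis by simp
      qed
      finally have "lattice_weight (m, n) \<le> 5 * ((of_int m)\<^sup>2 + (of_int n + t)\<^sup>2)" by (simp add: p_def q_def r_def lattice_weight_def)
      also have "\<dots> \<le> 5 * (C * lattice_form z m (of_int n + t))" using base[of m "of_int n + t"] by simp
      finally show ?thesis using C by (simp add: \<kappa>_def field_simps)
    qed
  qed
qed

text \<open>Uniform for exponents \<open>e\<close> between \<open>a\<close> and \<open>R\<close>: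
  \<open>\<kappa>^(-e)\<close> is largest at \<open>R\<close> since \<open>\<kappa> <= 1\<close>,
  and \<open>W^(-e)\<close> is largest at \<open>a\<close> since \<open>W >= 1\<close>. This turns a
  pointwise bound into a majorant on a whole disc of \<open>s\<close>.\<close>

lemma powr_minus_le_weight:
  fixes q :: real
  assumes "q \<ge> \<kappa> * W" "W \<ge> 1" "\<kappa> > 0" "\<kappa> \<le> 1" "0 \<le> a" "a \<le> e" "e \<le> R"
  shows "q powr (- e) \<le> \<kappa> powr (- R) * W powr (- a)"
proof -
  have "q powr (- e) \<le> (\<kappa> * W) powr (- e)" using assms by (intro powr_mono2') auto
  also have "\<dots> = \<kappa> powr (- e) * W powr (- e)" by (rule powr_mult)
  also have "\<dots> \<le> \<kappa> powr (- R) * W powr (- a)"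
    using assms by (intro mult_mono powr_mono powr_mono') auto
  finally show ?thesis .
qed

lemma lattice_form_pos:
  assumes "Im z > 0" "m \<noteq> 0" shows "lattice_form z m t > 0"
proof -
  have "(of_int m * Im z)\<^sup>2 > 0" using assms by simp
  then show ?thesis unfolding lattice_form_eq using zero_le_power2[of "t + of_int m * Re z"] by linarith
qed

lemma continuous_on_lattice_form: "continuous_on A (lattice_form z m)"
  unfolding lattice_form_def[abs_def] by (intro continuous_intros)

lemma norm_of_real_powr:
  "x \<ge> 0 \<Longrightarrow> norm (of_real x powr s :: complex) = x powr Re s"
  by (subst norm_powr_real_powr) auto

lemma cball_complex_bounds:
  assumes "w \<in> cball z r" shows "Re w \<ge> Re z - r" "Re w \<le> Re z + r" "norm w \<le> norm z + r"
proof -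
  have "norm (z - w) \<le> r" using assms by (simp add: dist_norm)
  then have "\<bar>Re (z - w)\<bar> \<le> r" using abs_Re_le_cmod[of "z - w"] by linarith
  then show "Re w \<ge> Re z - r" "Re w \<le> Re z + r" by (auto simp: abs_le_iff)
  show "norm w \<le> norm z + r" using \<open>norm (z - w) \<le> r\<close> norm_triangle_ineq2[of w z]
    by (simp add: norm_minus_commute)
qed

section \<open>The full lattice sum and the sum of row remainders, each in its half-plane of
  convergence\<close>

definition lattice_zeta :: "complex \<Rightarrow> complex \<Rightarrow> complex" where
  "lattice_zeta z s = (\<Sum>\<^sub>\<infinity>p\<in>- {(0, 0)}. of_real (lattice_form z (fst p) (of_int (snd p))) powr (- s))"

lemma lattice_zeta_bound:
  assumes "Im z > 0" "Re s > 1"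
  shows "\<exists>r>0. \<exists>M. M summable_on - {(0, 0)} \<and>
    (\<forall>p\<in>- {(0, 0)}. \<forall>w\<in>cball s r. norm (of_real (lattice_form z (fst p) (of_int (snd p))) powr (- w)) \<le> M p)"
proof -
  obtain \<kappa> where \<kappa>: "\<kappa> > 0" "\<kappa> \<le> 1"
    "\<And>m n. (m, n) \<noteq> (0, 0) \<Longrightarrow> lattice_form z m (of_int n) \<ge> \<kappa> * lattice_weight (m, n)"
    using lattice_form_lower[OF assms(1)] by metis
  define r where "r = (Re s - 1) / 2"
  have r: "r > 0" "Re s - r > 1" using assms by (auto simp: r_def field_simps)
  let ?M = "\<lambda>p. \<kappa> powr (- (Re s + r)) * lattice_weight p powr (- (Re s - r))"
  have "?M summable_on - {(0, 0)}" using r by (intro summable_on_cmult_right summable_on_lattice_weight)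
  moreover have "norm (of_real (lattice_form z (fst p) (of_int (snd p))) powr (- w)) \<le> ?M p"
    if p: "p \<in> - {(0, 0)}" and w: "w \<in> cball s r" for p w
  proof -
    have "norm (of_real (lattice_form z (fst p) (of_int (snd p))) powr (- w)) = lattice_form z (fst p) (of_int (snd p)) powr (- Re w)"
      by (subst norm_of_real_powr) (auto simp: lattice_form_def)
    also have "\<dots> \<le> ?M p"
      by (rule powr_minus_le_weight) (use cball_complex_bounds[OF w] r \<kappa>(3)[of "fst p" "snd p"] \<kappa>(1,2) p lattice_weight_ge_1 in auto)
    finally show ?thesis .
  qed
  ultimately show ?thesis using r(1) by blast
qed

lemma lattice_zeta_summable:
  assumes "Im z > 0" "Re s > 1"
  shows "(\<lambda>p. norm (of_real (lattice_form z (fst p) (of_int (snd p))) powr (- s) :: complex)) summable_on - {(0, 0)}"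
proof -
  obtain r M where "r > 0" "M summable_on - {(0, 0)}"
    "\<And>p w. p \<in> - {(0, 0)} \<Longrightarrow> w \<in> cball s r \<Longrightarrow> norm (of_real (lattice_form z (fst p) (of_int (snd p))) powr (- w)) \<le> M p"
    using lattice_zeta_bound[OF assms] by blast
  then show ?thesis by (intro Infinite_Sum.abs_summable_on_comparison_test'[where g = M]) auto
qed

lemma lattice_zeta_holomorphic:
  assumes "Im z > 0" shows "lattice_zeta z holomorphic_on {s. Re s > 1}"
  unfolding lattice_zeta_def[abs_def]
proof (rule holomorphic_on_infsum)
  show "(\<lambda>s. of_real (lattice_form z (fst p) (of_int (snd p))) powr (- s)) holomorphic_on {s. Re s > 1}"
    if "p \<in> - {(0, 0)}" for p
  proof -
    have "lattice_form z (fst p) (of_int (snd p)) \<noteq> 0"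
      using that assms lattice_form_pos[of z "fst p" "of_int (snd p)"]
      by (cases "fst p = 0") (auto simp: lattice_form_def prod_eq_iff)
    then show ?thesis by (auto intro!: holomorphic_intros)
  qed
qed (use lattice_zeta_bound[OF assms] open_halfspace_Re_gt in auto)

text \<open>This is \<open>D(z,s)\<close> of the overview. The rows \<open>m <= -1\<close> are
  mirror images of these; the row \<open>m = 0\<close>, whose form vanishes at the origin, is kept
  apart and yields the term \<open>zeta(2s)\<close>.\<close>

definition lattice_reg :: "complex \<Rightarrow> complex \<Rightarrow> complex" where
  "lattice_reg z s = (\<Sum>\<^sub>\<infinity>p\<in>{1..} \<times> UNIV. sum_int_diff (\<lambda>t. lattice_form z (fst p) (of_int (snd p) + t)) s)"

text \<open>The derivative of the form along a row satisfies \<open>|q'| <= 2 q^(1/2)\<close>, so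
  the remainder is at most \<open>2 |s| q^(-Re s - 1/2)\<close> up to constants. The gained half
  power moves the abscissa of convergence from 1 to 1/2.\<close>

lemma lattice_reg_bound:
  assumes "Im z > 0" "Re s > 1 / 2"
  shows "\<exists>r>0. \<exists>M. M summable_on {1..} \<times> UNIV \<and>
    (\<forall>p\<in>{1..} \<times> UNIV. \<forall>w\<in>cball s r. norm (sum_int_diff (\<lambda>t. lattice_form z (fst p) (of_int (snd p) + t)) w) \<le> M p)"
proof -
  obtain \<kappa> where \<kappa>: "\<kappa> > 0" "\<kappa> \<le> 1"
    "\<And>m n t. m \<ge> 1 \<Longrightarrow> t \<in> {0..1} \<Longrightarrow> lattice_form z m (of_int n + t) \<ge> \<kappa> * lattice_weight (m, n)"
    using lattice_form_lower[OF assms(1)] by metis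
  define r where "r = (Re s - 1 / 2) / 2"
  have r: "r > 0" "Re s - r + 1 / 2 > 1" using assms by (auto simp: r_def field_simps)
  let ?M = "\<lambda>p. 2 * (norm s + r) * (\<kappa> powr (- (Re s + r + 1 / 2)) * lattice_weight p powr (- (Re s - r + 1 / 2)))"
  have "?M summable_on {1..} \<times> UNIV" using r by (intro summable_on_cmult_right summable_on_lattice_weight)
  moreover have "norm (sum_int_diff (\<lambda>t. lattice_form z (fst p) (of_int (snd p) + t)) w) \<le> ?M p"
    if p: "p \<in> {1..} \<times> UNIV" and w: "w \<in> cball s r" for p w
  proof (rule norm_sum_int_diff_le)
    let ?q = "\<lambda>t. lattice_form z (fst p) (of_int (snd p) + t)"
    let ?q' = "\<lambda>t. 2 * (of_int (snd p) + t + of_int (fst p) * Re z)"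
    fix t :: real assume t: "t \<in> {0..1}"
    show "(?q has_real_derivative ?q' t) (at t within {0..1})"
      unfolding lattice_form_eq by (auto intro!: derivative_eq_intros)
    show pos: "?q t > 0" using p assms(1) by (intro lattice_form_pos) auto
    have "(of_int (snd p) + t + of_int (fst p) * Re z)\<^sup>2 \<le> ?q t" unfolding lattice_form_eq by simp
    from real_sqrt_le_mono[OF this] have "\<bar>?q' t\<bar> \<le> 2 * ?q t powr (1 / 2)"
      using pos by (simp add: powr_half_sqrt abs_mult)
    then have "\<bar>?q' t\<bar> * ?q t powr (- Re w - 1) \<le> 2 * ?q t powr (1 / 2) * ?q t powr (- Re w - 1)"
      by (intro mult_right_mono) auto
    also have "\<dots> = 2 * ?q t powr (- (Re w + 1 / 2))"
      by (simp add: powr_add[symmetric] algebra_simps)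
    also have "\<dots> \<le> 2 * (\<kappa> powr (- (Re s + r + 1 / 2)) * lattice_weight p powr (- (Re s - r + 1 / 2)))"
      using cball_complex_bounds[OF w] r \<kappa>(3)[of "fst p" t "snd p"] \<kappa>(1,2) p t lattice_weight_ge_1
      by (intro mult_left_mono powr_minus_le_weight) auto
    finally have *: "\<bar>?q' t\<bar> * ?q t powr (- Re w - 1) \<le> \<dots>" .
    have "norm w * (\<bar>?q' t\<bar> * ?q t powr (- Re w - 1)) \<le>
        (norm s + r) * (2 * (\<kappa> powr (- (Re s + r + 1 / 2)) * lattice_weight p powr (- (Re s - r + 1 / 2))))"
      by (rule mult_mono) (use cball_complex_bounds(3)[OF w] * r(1) in auto)
    then show "norm w * \<bar>?q' t\<bar> * ?q t powr (- Re w - 1) \<le> ?M p" by (simp only: mult_ac)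
  qed
  ultimately show ?thesis using r(1) by blast
qed

lemma lattice_reg_summable:
  assumes "Im z > 0" "Re s > 1 / 2"
  shows "(\<lambda>p. sum_int_diff (\<lambda>t. lattice_form z (fst p) (of_int (snd p) + t)) s) summable_on {1..} \<times> UNIV"
proof -
  obtain r M where rM: "r > 0" "M summable_on {1..} \<times> UNIV"
    "\<And>p w. p \<in> {1..} \<times> UNIV \<Longrightarrow> w \<in> cball s r \<Longrightarrow> norm (sum_int_diff (\<lambda>t. lattice_form z (fst p) (of_int (snd p) + t)) w) \<le> M p"
    using lattice_reg_bound[OF assms] by blast
  then have "(\<lambda>p. norm (sum_int_diff (\<lambda>t. lattice_form z (fst p) (of_int (snd p) + t)) s)) summable_on {1..} \<times> UNIV"
    by (intro Infinite_Sum.abs_summable_on_comparison_test'[where g = M]) auto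
  then show ?thesis by (rule abs_summable_summable)
qed

lemma lattice_reg_holomorphic:
  assumes "Im z > 0" shows "lattice_reg z holomorphic_on {s. Re s > 1 / 2}"
  unfolding lattice_reg_def[abs_def]
proof (rule holomorphic_on_infsum)
  show "sum_int_diff (\<lambda>t. lattice_form z (fst p) (of_int (snd p) + t)) holomorphic_on {s. Re s > 1 / 2}"
    if "p \<in> {1..} \<times> UNIV" for p
  proof (rule sum_int_diff_holomorphic)
    show "continuous_on {0..1} (\<lambda>t. lattice_form z (fst p) (of_int (snd p) + t))"
      unfolding lattice_form_def by (intro continuous_intros)
  qed (use that assms in \<open>auto intro!: lattice_form_pos\<close>)
  show "open {s. Re s > 1 / 2}" by (rule open_halfspace_Re_gt)
qed (use lattice_reg_bound[OF assms] in auto)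

section \<open>The row sums at \<open>s = 1\<close>\<close>

text \<open>Logarithmic derivative of the reflection formula, taken for the entire function
  \<open>rGamma\<close>.\<close>

lemma Digamma_reflection_complex:
  fixes w :: complex assumes "w \<notin> \<int>"
  shows "Digamma (1 - w) - Digamma w = of_real pi * cot (of_real pi * w)"
proof -
  have w: "w \<notin> \<int>\<^sub>\<le>\<^sub>0" "1 - w \<notin> \<int>\<^sub>\<le>\<^sub>0"
  proof -
    show "w \<notin> \<int>\<^sub>\<le>\<^sub>0" using assms nonpos_Ints_Int by blast
    show "1 - w \<notin> \<int>\<^sub>\<le>\<^sub>0"
    proof
      assume "1 - w \<in> \<int>\<^sub>\<le>\<^sub>0"
      then have "1 - (1 - w) \<in> \<int>" using nonpos_Ints_Int by (intro Ints_diff) auto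
      then show False using assms by simp
    qed
  qed
  have "((\<lambda>z. rGamma z * rGamma (1 - z)) has_field_derivative
          (rGamma w * rGamma (1 - w)) * (Digamma (1 - w) - Digamma w)) (at w)"
    using w by (auto intro!: derivative_eq_intros simp: algebra_simps)
  then have "((\<lambda>z. sin (of_real pi * z) / of_real pi) has_field_derivative
          (sin (of_real pi * w) / of_real pi) * (Digamma (1 - w) - Digamma w)) (at w)"
    by (simp add: rGamma_reflection_complex)
  moreover have "((\<lambda>z. sin (of_real pi * z) / of_real pi) has_field_derivative cos (of_real pi * w)) (at w)"
    by (auto intro!: derivative_eq_intros)
  ultimately have "(sin (of_real pi * w) / of_real pi) * (Digamma (1 - w) - Digamma w) = cos (of_real pi * w)"
    by (rule DERIV_unique)
  moreover have "sin (of_real pi * w) \<noteq> 0"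
  proof
    assume "sin (of_real pi * w) = 0"
    then obtain n :: int where "of_real pi * w = of_real (of_int n * pi)"
      using sin_eq_0 by metis
    then have "w = of_int n" by simp
    then show False using assms by auto
  qed
  ultimately show ?thesis by (simp add: cot_def field_simps)
qed

lemma Digamma_sums:
  fixes z :: complex assumes "z \<notin> \<int>"
  shows "(\<lambda>n. inverse (of_nat (Suc n)) - inverse (z + of_nat n)) sums (Digamma z + euler_mascheroni)"
proof -
  have "z \<noteq> 0" using assms by auto
  from summable_Digamma[OF this] show ?thesis
    by (simp add: Digamma_def summable_sums)
qed

text \<open>Multiplication by \<open>2 i Im w\<close> splits each term into
  \<open>1/(cnj w + n) - 1/(w + n)\<close>. The half \<open>n >= 0\<close> gives Digamma at
  \<open>w\<close> and \<open>cnj w\<close>, the half \<open>n < 0\<close> gives Digamma at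
  \<open>1 - w\<close> and \<open>1 - cnj w\<close>. Reflection joins them to cotangents, that is,
  to \<open>(1+Q)/(1-Q)\<close> and its conjugate. Unconditional summability is what permits cutting
  the sum into halves.\<close>

lemma has_sum_inverse_norm_square:
  assumes v: "Im w > 0"
  defines "Q \<equiv> exp (2 * of_real pi * \<i> * w)"
  assumes smm: "(\<lambda>n::int. 1 / (norm (w + of_int n))\<^sup>2) summable_on UNIV"
  shows "((\<lambda>n::int. 1 / (norm (w + of_int n))\<^sup>2) has_sum (pi / Im w * Re ((1 + Q) / (1 - Q)))) UNIV"
proof -
  let ?f = "\<lambda>n::int. 1 / (norm (w + of_int n))\<^sup>2"
  have nInt: "w \<notin> \<int>" "cnj w \<notin> \<int>" "1 - w \<notin> \<int>" "1 - cnj w \<notin> \<int>"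
    using v by (auto simp: complex_is_Int_iff)
  have ne: "w + of_int n \<noteq> 0" "cnj w + of_int n \<noteq> 0" for n
    using v by (auto simp: complex_eq_iff)
  have f_eq: "of_real (?f n) * (2 * \<i> * of_real (Im w)) = inverse (cnj w + of_int n) - inverse (w + of_int n)" for n
  proof -
    have "inverse (cnj w + of_int n) - inverse (w + of_int n) = (w - cnj w) / ((w + of_int n) * cnj (w + of_int n))"
      using ne[of n] by (simp add: field_simps)
    also have "(w + of_int n) * cnj (w + of_int n) = of_real ((norm (w + of_int n))\<^sup>2)"
      by (simp only: complex_norm_square[symmetric] of_real_power)
    also have "w - cnj w = 2 * \<i> * of_real (Im w)" by (simp add: complex_eq_iff)
    finally show ?thesis by simp
  qed
  \<comment> \<open>The terms \<open>1/(n+1)\<close> that make each Digamma series converge cancel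
    in the difference of two such series.\<close>
  define T1 T2 where "T1 = Digamma w - Digamma (cnj w)" and "T2 = Digamma (1 - cnj w) - Digamma (1 - w)"
  have s1: "(\<lambda>n. of_real (?f (int n)) * (2 * \<i> * of_real (Im w))) sums T1"
    using sums_diff[OF Digamma_sums[OF nInt(1)] Digamma_sums[OF nInt(2)]] unfolding f_eq T1_def by simp
  have neg: "inverse (cnj w + of_int (- int (Suc n))) - inverse (w + of_int (- int (Suc n))) =
     (inverse (of_nat (Suc n)) - inverse (1 - cnj w + of_nat n)) - (inverse (of_nat (Suc n)) - inverse (1 - w + of_nat n))" for n
  proof -
    have "cnj w + of_int (- int (Suc n)) = - (1 - cnj w + of_nat n)" "w + of_int (- int (Suc n)) = - (1 - w + of_nat n)"
      by (auto simp: complex_eq_iff)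
    then show ?thesis by (simp only: inverse_minus_eq) simp
  qed
  have s2: "(\<lambda>n. of_real (?f (- int (Suc n))) * (2 * \<i> * of_real (Im w))) sums T2"
    using sums_diff[OF Digamma_sums[OF nInt(4)] Digamma_sums[OF nInt(3)]] unfolding f_eq neg T2_def by simp
  define S where "S = (\<Sum>\<^sub>\<infinity>n. ?f n)"
  let ?g = "\<lambda>n. of_real (?f n) * (2 * \<i> * of_real (Im w)) :: complex"
  have gs: "(?g has_sum (of_real S * (2 * \<i> * of_real (Im w)))) UNIV"
    unfolding S_def by (intro has_sum_cmult_left has_sum_of_real has_sum_infsum smm)
  have "?g summable_on A" for A
    by (rule summable_on_subset[OF has_sum_imp_summable[OF gs]]) auto
  then have "?g summable_on {0..}" "?g summable_on {..<0}" by blast+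
  then obtain A B where A: "(?g has_sum A) {0..}" and B: "(?g has_sum B) {..<0}"
    by (auto simp: summable_on_def)
  have "(?g has_sum (A + B)) ({0..} \<union> {..<0})" by (intro has_sum_Un_disjoint A B) auto
  moreover have "{0..} \<union> {..<0} = (UNIV :: int set)" by auto
  ultimately have "(?g has_sum (A + B)) UNIV" by (simp only:)
  with gs have AB: "of_real S * (2 * \<i> * of_real (Im w)) = A + B" by (rule has_sum_unique)
  have "((\<lambda>n. ?g (int n)) has_sum A) UNIV"
    using A by (subst (asm) has_sum_reindex_bij_witness[of _ int nat UNIV "\<lambda>n. ?g (int n)" _ A]) auto
  then have A': "A = T1" using s1 by (blast intro: sums_unique2 has_sum_imp_sums)
  have "((\<lambda>n. ?g (- int (Suc n))) has_sum B) UNIV"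
    using B by (subst (asm) has_sum_reindex_bij_witness[of _ "\<lambda>n. - int (Suc n)" "\<lambda>n. nat (- n - 1)" UNIV "\<lambda>n. ?g (- int (Suc n))" _ B]) auto
  then have B': "B = T2" using s2 by (blast intro: sums_unique2 has_sum_imp_sums)
  define R where "R = (1 + Q) / (1 - Q)"
  have "cot (of_real pi * w) = - \<i> * R"
  proof -
    define E where "E = exp (\<i> * (of_real pi * w))"
    have E: "E \<noteq> 0" "Q = E * E" by (auto simp: E_def Q_def exp_add[symmetric] algebra_simps)
    have "cos (of_real pi * w) = (E + 1 / E) / 2" "sin (of_real pi * w) = (E - 1 / E) / (2 * \<i>)"
      by (simp_all add: cos_exp_eq sin_exp_eq E_def exp_minus field_simps)
    moreover have "(X / 2) / (Y / (2 * \<i>)) = \<i> * (X / Y)" for X Y by (cases "Y = 0") (auto simp: field_simps)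
    ultimately have "cot (of_real pi * w) = \<i> * ((E + 1 / E) / (E - 1 / E))" by (simp only: cot_def)
    also have "(E + 1 / E) / (E - 1 / E) = (E * (E + 1 / E)) / (E * (E - 1 / E))" using E by simp
    also have "\<dots> = (Q + 1) / (Q - 1)" using E by (simp add: algebra_simps)
    also have "\<dots> = - R"
      unfolding R_def by (metis add.commute minus_diff_eq minus_divide_right)
    finally show ?thesis by simp
  qed
  note cot_w = this
  have "of_real pi * cnj w = cnj (of_real pi * w)" by simp
  then have "cot (of_real pi * cnj w) = cnj (cot (of_real pi * w))"
    by (simp only: cot_def complex_cnj_divide cnj_sin cnj_cos)
  also have "\<dots> = \<i> * cnj R" unfolding cot_w by simp
  finally have cot_cnj: "cot (of_real pi * cnj w) = \<i> * cnj R" .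
  have "A + B = - (Digamma (1 - w) - Digamma w) + (Digamma (1 - cnj w) - Digamma (cnj w))"
    unfolding A' B' T1_def T2_def by simp
  also have "\<dots> = of_real pi * \<i> * (R + cnj R)"
    unfolding Digamma_reflection_complex[OF nInt(1)] Digamma_reflection_complex[OF nInt(2)] cot_w cot_cnj
    by (simp add: algebra_simps)
  also have "R + cnj R = of_real (2 * Re R)" by (rule complex_add_cnj)
  also have "of_real pi * \<i> * of_real (2 * Re R) = of_real (2 * Re R * pi) * \<i>" by simp
  finally have "of_real S * (2 * \<i> * of_real (Im w)) = of_real (2 * Re R * pi) * \<i>" using AB by (simp only:)
  then have "complex_of_real (S * Im w) = of_real (Re R * pi)" by (simp add: complex_eq_iff)
  then have "S * Im w = Re R * pi" by (simp only: of_real_eq_iff)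
  then have "S = pi / Im w * Re R" using v by (simp add: field_simps)
  then show ?thesis using has_sum_infsum[OF smm] by (simp add: S_def R_def)
qed

section \<open>Continuation of the lattice sum\<close>

text \<open>Completing the square puts the row into the shape of the Beta integral with shift
  \<open>m x\<close> and scale \<open>m y\<close>. The exponent is real because the cutting into
  unit intervals rests on a nonnegative integrand.\<close>

lemma lattice_form_row_integrals:
  assumes z: "Im z > 0" and \<sigma>: "\<sigma> > 1 / 2" and m: "m \<ge> 1"
  shows "((\<lambda>n::int. integral {0..1} (\<lambda>t. of_real (lattice_form z m (of_int n + t)) powr (- of_real \<sigma>)) :: complex)
     has_sum of_real ((of_int m * Im z) powr (1 - 2 * \<sigma>) * (sqrt pi * Gamma (\<sigma> - 1 / 2) / Gamma \<sigma>))) UNIV"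
proof -
  let ?f = "\<lambda>t. lattice_form z m t powr (- \<sigma>)"
  let ?I = "(of_int m * Im z) powr (1 - 2 * \<sigma>) * (sqrt pi * Gamma (\<sigma> - 1 / 2) / Gamma \<sigma>)"
  have v: "of_int m * Im z > 0" using z m by simp
  have cont: "continuous_on A ?f" for A
  proof -
    have "lattice_form z m t \<noteq> 0" for t using lattice_form_pos[of z m t] z m by auto
    then show ?thesis by (intro continuous_intros continuous_on_lattice_form) auto
  qed
  have "Gamma (\<sigma> - 1 / 2) > 0" "Gamma \<sigma> > 0" using \<sigma> by (auto intro!: Gamma_real_pos)
  then have "?I \<ge> 0" by simp
  then have "((\<lambda>n::int. integral {0..1} (\<lambda>t. ?f (of_int n + t))) has_sum ?I) UNIV"
    using nn_integral_quadratic_powr[OF \<sigma> v]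
    by (intro has_sum_unit_integrals cont) (simp_all add: lattice_form_eq)
  then have "((\<lambda>n::int. of_real (integral {0..1} (\<lambda>t. ?f (of_int n + t))) :: complex) has_sum of_real ?I) UNIV"
    by (rule has_sum_of_real)
  moreover have "of_real (integral {0..1} (\<lambda>t. ?f (of_int n + t))) =
      (integral {0..1} (\<lambda>t. of_real (lattice_form z m (of_int n + t)) powr (- of_real \<sigma>)) :: complex)" for n :: int
  proof -
    have c: "continuous_on {0..1} (\<lambda>t. ?f (of_int n + t))"
      by (rule continuous_on_compose2[OF cont[of UNIV]]) (auto intro!: continuous_intros)
    have "((\<lambda>t. of_real (?f (of_int n + t)) :: complex) has_integral of_real (integral {0..1} (\<lambda>t. ?f (of_int n + t)))) {0..1}"
      by (intro has_integral_of_real integrable_integral integrable_continuous_real c)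
    moreover have "of_real (?f (of_int n + t)) = (of_real (lattice_form z m (of_int n + t)) powr (- of_real \<sigma>) :: complex)" for t
      by (subst powr_of_real[symmetric]) (auto simp: lattice_form_def)
    ultimately show ?thesis by (simp add: integral_unique)
  qed
  ultimately show ?thesis by (simp only:)
qed

lemma zeta_has_sum_int:
  assumes "Re s > 1"
  shows "((\<lambda>m::int. of_int m powr (- s)) has_sum zeta s) {1..}"
  using zeta_has_sum[OF assms]
  by (subst has_sum_reindex_bij_witness[of _ int nat "{0<..}" "\<lambda>n. of_nat n powr (- s)" _ "zeta s"]) auto

text \<open>The Beta value \<open>B(1/2, s - 1/2)\<close>, the integral of
  \<open>(1 + t^2)^(-s)\<close> over the line for Re s > 1/2.\<close>

definition beta_factor :: "complex \<Rightarrow> complex" where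
  "beta_factor s = of_real (sqrt pi) * Gamma (s - 1 / 2) / Gamma s"

definition lattice_zeta_cont :: "complex \<Rightarrow> complex \<Rightarrow> complex" where
  "lattice_zeta_cont z s = 2 * (zeta (2 * s) +
     of_real (Im z) powr (1 - 2 * s) * beta_factor s * zeta (2 * s - 1) + lattice_reg z s)"

text \<open>Real exponents suffice: both sides are holomorphic, so the identity theorem extends this to \<open>Re s > 1\<close>.\<close>
lemma lattice_zeta_real:
  assumes z: "Im z > 0" and \<sigma>: "\<sigma> > 1"
  shows "lattice_zeta z (of_real \<sigma>) = lattice_zeta_cont z (of_real \<sigma>)"
proof -
  define g where "g p = (of_real (lattice_form z (fst p) (of_int (snd p))) powr (- of_real \<sigma>) :: complex)" for p :: "int \<times> int"
  define J where "J p = (integral {0..1} (\<lambda>t. of_real (lattice_form z (fst p) (of_int (snd p) + t)) powr (- of_real \<sigma>)) :: complex)" for p :: "int \<times> int"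
  define P where "P = ({1..} \<times> UNIV :: (int \<times> int) set)"
  define c where "c = sqrt pi * Gamma (\<sigma> - 1 / 2) / Gamma \<sigma>"
  have c: "of_real c = beta_factor (of_real \<sigma>)"
  proof -
    have "complex_of_real \<sigma> - 1 / 2 = of_real (\<sigma> - 1 / 2)" by simp
    then show ?thesis unfolding c_def beta_factor_def by (simp only: Gamma_complex_of_real of_real_mult of_real_divide)
  qed
  have sg: "g summable_on - {(0, 0)}"
    using abs_summable_summable[OF lattice_zeta_summable[OF z, of "of_real \<sigma>"]] \<sigma> by (simp add: g_def[abs_def])
  have sgA: "g summable_on A" if "A \<subseteq> - {(0, 0)}" for A using summable_on_subset[OF sg that] .
  have d: "(\<lambda>p. g p - J p) summable_on P" "(\<Sum>\<^sub>\<infinity>p\<in>P. g p - J p) = lattice_reg z (of_real \<sigma>)"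
    using lattice_reg_summable[OF z, of "of_real \<sigma>"] \<sigma>
    by (simp_all add: g_def J_def P_def sum_int_diff_def lattice_reg_def)
  have gP: "g summable_on P" by (rule sgA) (auto simp: P_def)
  \<comment> \<open>The lattice terms and the remainders are summable, hence so are the integrals,
    and their sum may be taken row by row.\<close>
  have JP: "J summable_on P"
  proof -
    have "(\<lambda>p. g p + - (g p - J p)) summable_on P"
      using gP d(1) by (intro summable_on_add) (simp_all only: summable_on_uminus)
    then show ?thesis by simp
  qed
  then obtain I where I: "(J has_sum I) P" by (auto simp: summable_on_def)
  \<comment> \<open>Row \<open>m\<close> contributes a constant times
    \<open>m^(1-2\<sigma>)\<close>, so the rows add up to a multiple of
    \<open>zeta(2\<sigma> - 1)\<close>.\<close>
  have "((\<lambda>m. of_real ((of_int m * Im z) powr (1 - 2 * \<sigma>) * c)) has_sum I) {1..}"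
    unfolding c_def
    by (rule has_sum_SigmaD[OF I[unfolded P_def]])
       (use lattice_form_row_integrals[OF z, of \<sigma>] \<sigma> in \<open>auto simp: J_def\<close>)
  moreover have "((\<lambda>m. of_int m powr (- of_real (2 * \<sigma> - 1)) * of_real (Im z powr (1 - 2 * \<sigma>) * c)) has_sum
      (zeta (of_real (2 * \<sigma> - 1)) * of_real (Im z powr (1 - 2 * \<sigma>) * c))) {1..}"
    using \<sigma> by (intro has_sum_cmult_left zeta_has_sum_int) auto
  moreover have "of_int m powr (- of_real (2 * \<sigma> - 1)) * of_real (Im z powr (1 - 2 * \<sigma>) * c) =
      (of_real ((of_int m * Im z) powr (1 - 2 * \<sigma>) * c) :: complex)" if "m \<in> {1..}" for m :: int
  proof -
    have "(of_int m powr (- of_real (2 * \<sigma> - 1)) :: complex) = of_real (real_of_int m powr (- (2 * \<sigma> - 1)))"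
      using that by (subst powr_of_real[symmetric]) auto
    then show ?thesis using that z by (simp add: powr_mult)
  qed
  ultimately have "I = zeta (of_real (2 * \<sigma> - 1)) * of_real (Im z powr (1 - 2 * \<sigma>) * c)"
    using has_sum_unique has_sum_cong by (smt (verit, best))
  moreover have "complex_of_real (Im z powr (1 - 2 * \<sigma>)) = of_real (Im z) powr (1 - 2 * of_real \<sigma>)"
    using z by (subst powr_of_real[symmetric]) auto
  ultimately have I_eq: "I = of_real (Im z) powr (1 - 2 * of_real \<sigma>) * beta_factor (of_real \<sigma>) * zeta (2 * of_real \<sigma> - 1)"
    by (simp add: c)
  have "((\<lambda>p. (g p - J p) + J p) has_sum (lattice_reg z (of_real \<sigma>) + I)) P"
    using has_sum_infsum[OF d(1)] d(2) I by (intro has_sum_add) auto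
  then have gsP: "(g has_sum (lattice_reg z (of_real \<sigma>) + I)) P" by simp
  \<comment> \<open>The symmetry of the form under negation of the lattice point accounts for the
    overall factor 2.\<close>
  have sym: "g (- m, - n) = g (m, n)" for m n
  proof -
    have "lattice_form z (- m) (of_int (- n)) = lattice_form z m (of_int n)"
      by (simp add: lattice_form_eq power2_eq_square algebra_simps)
    then show ?thesis by (simp add: g_def)
  qed
  have gsP': "(g has_sum (lattice_reg z (of_real \<sigma>) + I)) ({..- 1} \<times> UNIV)"
    using gsP by (subst has_sum_reindex_bij_witness[of _ "\<lambda>(a, b). (- a, - b)" "\<lambda>(a, b). (- a, - b)" P g])
      (auto simp: P_def sym)
  have g0: "g (0, n) = of_int n powr (- (2 * of_real \<sigma>))" if "n \<ge> 1" for n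
  proof -
    have "g (0, n) = of_real (of_int n * of_int n) powr (- of_real \<sigma>)"
      by (simp add: g_def lattice_form_eq power2_eq_square)
    also have "\<dots> = exp (- of_real \<sigma> * of_real (ln (of_int n * of_int n)))"
      using that by (intro of_real_powr_eq_exp) auto
    also have "ln (of_int n * of_int n) = 2 * ln (real_of_int n)" using that by (simp add: ln_mult)
    also have "exp (- of_real \<sigma> * of_real (2 * ln (of_int n))) = (of_real (of_int n) powr (- (2 * of_real \<sigma>)) :: complex)"
      using that by (subst of_real_powr_eq_exp) (auto simp: algebra_simps)
    finally show ?thesis by simp
  qed
  have gs0: "(g has_sum zeta (2 * of_real \<sigma>)) ({0} \<times> {1..})"
    using zeta_has_sum_int[of "2 * of_real \<sigma>"] \<sigma>
    by (subst has_sum_reindex_bij_witness[of _ "\<lambda>n. (0, n)" snd "{1..}" "\<lambda>n. of_int n powr (- (2 * of_real \<sigma>))"])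
       (auto simp: g0)
  have gs0': "(g has_sum zeta (2 * of_real \<sigma>)) ({0} \<times> {..- 1})"
    using gs0 by (subst has_sum_reindex_bij_witness[of _ "\<lambda>(a, b). (- a, - b)" "\<lambda>(a, b). (- a, - b)" "{0} \<times> {1..}" g])
      (auto simp: sym[of 0, simplified])
  have "(g has_sum ((lattice_reg z (of_real \<sigma>) + I) + (lattice_reg z (of_real \<sigma>) + I)) +
      (zeta (2 * of_real \<sigma>) + zeta (2 * of_real \<sigma>))) ((P \<union> {..- 1} \<times> UNIV) \<union> ({0} \<times> {1..} \<union> {0} \<times> {..- 1}))"
    by (intro has_sum_Un_disjoint gsP gsP' gs0 gs0') (auto simp: P_def)
  moreover have "(P \<union> {..- 1} \<times> UNIV) \<union> ({0} \<times> {1..} \<union> {0} \<times> {..- 1}) = - {(0, 0)}"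
    by (auto simp: P_def)
  ultimately have "(g has_sum (2 * (zeta (2 * of_real \<sigma>) + I + lattice_reg z (of_real \<sigma>)))) (- {(0, 0)})"
    by (simp add: algebra_simps)
  then have "lattice_zeta z (of_real \<sigma>) = 2 * (zeta (2 * of_real \<sigma>) + I + lattice_reg z (of_real \<sigma>))"
    unfolding lattice_zeta_def g_def[abs_def] by (rule infsumI)
  then show ?thesis by (simp add: lattice_zeta_cont_def I_eq)
qed

section \<open>Holomorphy of the continued lattice sum and passage to complex exponents\<close>

lemma zeta_double_holomorphic: "(\<lambda>s. zeta (2 * s)) holomorphic_on {s. Re s > 1 / 2}"
proof -
  have "(zeta \<circ> (\<lambda>s. 2 * s)) holomorphic_on {s. Re s > 1 / 2}"
    by (rule holomorphic_on_compose_gen[OF _ zeta_holomorphic])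
       (auto intro!: holomorphic_intros dest!: arg_cong[of _ _ Re])
  then show ?thesis by (simp add: o_def)
qed

lemma beta_factor_holomorphic: "beta_factor holomorphic_on {s. Re s > 1 / 2}"
proof -
  have "s \<notin> \<int>\<^sub>\<le>\<^sub>0" "s - 1 / 2 \<notin> \<int>\<^sub>\<le>\<^sub>0" if "s \<in> {s. Re s > 1 / 2}" for s
    using that by (auto elim!: nonpos_Ints_cases simp: complex_eq_iff)
  then show ?thesis unfolding beta_factor_def[abs_def]
    by (auto intro!: holomorphic_intros simp: Gamma_eq_zero_iff)
qed

lemma lattice_zeta_cont_holomorphic:
  assumes z: "Im z > 0"
  shows "lattice_zeta_cont z holomorphic_on ({s. Re s > 1 / 2} - {1})"
proof -
  let ?H = "{s. Re s > 1 / 2} - {1 :: complex}"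
  have "(zeta \<circ> (\<lambda>s. 2 * s - 1)) holomorphic_on ?H"
    by (rule holomorphic_on_compose_gen[OF _ zeta_holomorphic]) (auto intro!: holomorphic_intros simp: complex_eq_iff)
  moreover have "(\<lambda>s. zeta (2 * s)) holomorphic_on ?H" "lattice_reg z holomorphic_on ?H" "beta_factor holomorphic_on ?H"
    using zeta_double_holomorphic lattice_reg_holomorphic[OF z] beta_factor_holomorphic
    by (auto elim!: holomorphic_on_subset)
  ultimately show ?thesis
    unfolding lattice_zeta_cont_def[abs_def] o_def using z by (auto intro!: holomorphic_intros)
qed

lemma lattice_zeta_eq:
  assumes z: "Im z > 0" and s: "Re s > 1"
  shows "lattice_zeta z s = lattice_zeta_cont z s"
proof -
  let ?S = "{s. Re s > (1::real)}" and ?U = "complex_of_real ` {1<..}"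
  have "lattice_zeta z s - lattice_zeta_cont z s = 0"
  proof (rule analytic_continuation[where f = "\<lambda>s. lattice_zeta z s - lattice_zeta_cont z s"
        and S = ?S and U = ?U and \<xi> = 2 and w = s])
    show "(\<lambda>s. lattice_zeta z s - lattice_zeta_cont z s) holomorphic_on ?S"
      by (intro holomorphic_intros lattice_zeta_holomorphic z
            holomorphic_on_subset[OF lattice_zeta_cont_holomorphic[OF z]]) auto
    show "open ?S" by (rule open_halfspace_Re_gt)
    show "connected ?S" by (rule convex_connected) (rule convex_halfspace_Re_gt)
    show "?U \<subseteq> ?S" by auto
    show "2 \<in> ?S" by simp
    show "2 islimpt ?U"
      unfolding islimpt_approachable
    proof (intro allI impI)
      fix e :: real assume e: "e > 0"
      show "\<exists>x'\<in>?U. x' \<noteq> 2 \<and> dist x' 2 < e"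
      proof (intro bexI conjI)
        show "complex_of_real (2 + e / 2) \<in> ?U" by (rule imageI) (use e in auto)
        show "complex_of_real (2 + e / 2) \<noteq> 2" using e by (auto simp: complex_eq_iff)
        show "dist (complex_of_real (2 + e / 2)) 2 < e"
          using e by (simp add: dist_norm)
      qed
    qed
    show "lattice_zeta z w - lattice_zeta_cont z w = 0" if "w \<in> ?U" for w
      using that lattice_zeta_real[OF z] by auto
    show "s \<in> ?S" using s by simp
  qed
  then show ?thesis by simp
qed

section \<open>The value at \<open>s = 1\<close> and the modular discriminant\<close>

lemma norm_nome:
  assumes z: "Im z > 0"
  defines "q \<equiv> exp (2 * of_real pi * \<i> * z)"
  shows "norm q < 1" "q \<noteq> 0" "norm q = exp (- 2 * pi * Im z)"
  using z by (auto simp: q_def)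

lemma norm_power_Suc_less_1:
  assumes "norm (q :: complex) < 1" shows "norm (q ^ Suc k) < 1"
proof -
  have "norm q ^ k \<le> 1" using assms by (intro power_le_one) auto
  then have "norm q * norm q ^ k \<le> norm q" by (intro mult_left_le) auto
  then show ?thesis using assms by (simp add: norm_mult norm_power)
qed

lemma sums_minus_Ln:
  assumes "norm (x :: complex) < 1"
  shows "(\<lambda>m. x ^ Suc m / of_nat (Suc m)) sums (- Ln (1 - x))"
proof -
  have "(\<lambda>n. - ((- (- x)) ^ n) / of_nat n) sums ln (1 + - x)"
    using assms by (intro Ln_series') simp
  then have "(\<lambda>n. - (- ((- (- x)) ^ n) / of_nat n)) sums (- ln (1 + - x))" by (rule sums_minus)
  then have "(\<lambda>n. x ^ n / of_nat n) sums (- Ln (1 - x))" by simp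
  then show ?thesis by (subst sums_Suc_iff) simp
qed

lemma summable_on_lambert:
  fixes q :: complex assumes q: "norm q < 1"
  shows "(\<lambda>(m, k). q ^ (Suc m * Suc k) / of_nat (Suc m)) summable_on (UNIV \<times> UNIV)"
proof -
  let ?r = "norm q"
  have S: "(\<lambda>n. ?r ^ n) summable_on (UNIV :: nat set)"
    using q by (intro summable_nonneg_imp_summable_on summable_geometric) auto
  have "(\<lambda>p. ?r ^ fst p * ?r ^ snd p) summable_on (Sigma UNIV (\<lambda>_. UNIV) :: (nat \<times> nat) set)"
  proof (rule summable_on_SigmaI)
    show "((\<lambda>y. ?r ^ fst (x, y) * ?r ^ snd (x, y)) has_sum ?r ^ x * (\<Sum>\<^sub>\<infinity>n. ?r ^ n)) UNIV" for x
      unfolding fst_conv snd_conv by (intro has_sum_cmult_right has_sum_infsum S)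
    show "(\<lambda>x. ?r ^ x * (\<Sum>\<^sub>\<infinity>n. ?r ^ n)) summable_on UNIV" by (intro summable_on_cmult_left S)
  qed auto
  then have "(\<lambda>p. norm (case p of (m, k) \<Rightarrow> q ^ (Suc m * Suc k) / of_nat (Suc m))) summable_on (UNIV \<times> UNIV)"
  proof (rule Infinite_Sum.abs_summable_on_comparison_test')
    fix p :: "nat \<times> nat"
    obtain m k where p: "p = (m, k)" by (cases p)
    have "norm (q ^ (Suc m * Suc k) / of_nat (Suc m)) = ?r ^ (Suc m * Suc k) / real (Suc m)"
      by (simp add: norm_divide norm_power norm_mult del: of_nat_Suc)
    also have "\<dots> \<le> ?r ^ (Suc m * Suc k) / 1" by (intro divide_left_mono) auto
    also have "\<dots> \<le> ?r ^ (m + k)"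
    proof -
      have "m + k \<le> Suc m * Suc k" by simp
      from power_decreasing[OF this, of ?r] q show ?thesis
        by (simp only: div_by_1 norm_ge_zero less_imp_le)
    qed
    finally show "norm (case p of (m, k) \<Rightarrow> q ^ (Suc m * Suc k) / of_nat (Suc m)) \<le> ?r ^ fst p * ?r ^ snd p"
      by (simp add: p power_add)
  qed
  then show ?thesis by (rule abs_summable_summable)
qed

text \<open>The absolutely convergent double series of \<open>q^((m+1)(k+1))/(m+1)\<close> is summed
  in both orders: over \<open>k\<close> it is geometric and gives the Lambert terms, over
  \<open>m\<close> it is the logarithmic series.\<close>

lemma lambert_eq_sum_Ln:
  fixes q :: complex assumes q: "norm q < 1"
  obtains S where "((\<lambda>m. q ^ Suc m / (1 - q ^ Suc m) / of_nat (Suc m)) has_sum - S) UNIV"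
    "(\<lambda>k. Ln (1 - q ^ Suc k)) sums S"
proof -
  define F where "F m k = q ^ (Suc m * Suc k) / of_nat (Suc m)" for m k :: nat
  define L where "L = (\<Sum>\<^sub>\<infinity>(m, k)\<in>UNIV \<times> UNIV. F m k)"
  have qk: "norm (q ^ Suc k) < 1" for k using q by (rule norm_power_Suc_less_1)
  have sm: "(\<lambda>(m, k). F m k) summable_on (UNIV \<times> UNIV)"
    unfolding F_def by (rule summable_on_lambert[OF q])
  then have L: "((\<lambda>(m, k). F m k) has_sum L) (UNIV \<times> UNIV)"
    unfolding L_def by (rule has_sum_infsum)
  then have L': "((\<lambda>(k, m). F m k) has_sum L) (UNIV \<times> UNIV)"
    by (subst (asm) has_sum_swap) (simp add: case_prod_unfold)
  then have sm': "(\<lambda>(k, m). F m k) summable_on (UNIV \<times> UNIV)" by (rule has_sum_imp_summable)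
  have row: "(F m has_sum (q ^ Suc m / (1 - q ^ Suc m) / of_nat (Suc m))) UNIV" for m
  proof -
    have "F m summable_on UNIV" by (rule summable_on_SigmaD1[OF sm]) simp
    then obtain c where c: "(F m has_sum c) UNIV" by (auto simp: summable_on_def)
    have "(\<lambda>k. q ^ Suc m / of_nat (Suc m) * (q ^ Suc m) ^ k) sums (q ^ Suc m / of_nat (Suc m) * (1 / (1 - q ^ Suc m)))"
      by (intro sums_mult geometric_sums qk)
    moreover have "q ^ Suc m / of_nat (Suc m) * (q ^ Suc m) ^ k = F m k" for k
    proof -
      have "F m k = (q ^ Suc m) ^ Suc k / of_nat (Suc m)" unfolding F_def by (simp only: power_mult)
      then show ?thesis by (simp only: power_Suc[of "q ^ Suc m"] times_divide_eq_left)
    qed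
    ultimately have "F m sums (q ^ Suc m / of_nat (Suc m) * (1 / (1 - q ^ Suc m)))" by (simp only:)
    with has_sum_imp_sums[OF c] have "c = q ^ Suc m / of_nat (Suc m) * (1 / (1 - q ^ Suc m))" by (rule sums_unique2)
    also have "\<dots> = q ^ Suc m / (1 - q ^ Suc m) / of_nat (Suc m)" by (simp only: times_divide_eq_right times_divide_eq_left mult_1_right mult_1_left divide_divide_eq_left mult.commute)
    finally show ?thesis using c by (simp only:)
  qed
  have col: "((\<lambda>m. F m k) has_sum (- Ln (1 - q ^ Suc k))) UNIV" for k
  proof -
    have "(\<lambda>m. F m k) summable_on UNIV" by (rule summable_on_SigmaD1[OF sm']) simp
    then obtain c where c: "((\<lambda>m. F m k) has_sum c) UNIV" by (auto simp: summable_on_def)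
    have "(q ^ Suc k) ^ Suc m / of_nat (Suc m) = F m k" for m
      unfolding F_def power_mult[symmetric] by (simp only: mult.commute)
    then have "(\<lambda>m. F m k) sums (- Ln (1 - q ^ Suc k))" using sums_minus_Ln[OF qk[of k]] by (simp only:)
    with has_sum_imp_sums[OF c] have "c = - Ln (1 - q ^ Suc k)" by (rule sums_unique2)
    then show ?thesis using c by (simp only:)
  qed
  have "((\<lambda>m. q ^ Suc m / (1 - q ^ Suc m) / of_nat (Suc m)) has_sum L) UNIV"
    using row by (intro has_sum_SigmaD[OF L]) simp
  moreover have "((\<lambda>k. - Ln (1 - q ^ Suc k)) has_sum L) UNIV"
    using col by (intro has_sum_SigmaD[OF L']) simp
  then have "(\<lambda>k. - Ln (1 - q ^ Suc k)) sums L" by (rule has_sum_imp_sums)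
  then have "(\<lambda>k. Ln (1 - q ^ Suc k)) sums (- L)" using sums_minus by fastforce
  ultimately show thesis using that[of "- L"] by simp
qed

text \<open>The product is the exponential of a sum of principal logarithms. Only the real part of
  that sum enters the norm, so the choice of branches is immaterial.\<close>

lemma norm_Delta:
  assumes z: "Im z > 0" and S: "(\<lambda>k. Ln (1 - exp (2 * of_real pi * \<i> * z) ^ Suc k)) sums S"
  shows "Delta z \<noteq> 0" "ln (norm (Delta z)) = - 2 * pi * Im z + 24 * Re S"
proof -
  define q where "q = exp (2 * of_real pi * \<i> * z)"
  note q = norm_nome[OF z, folded q_def]
  have "(\<lambda>k. 24 * Ln (1 - q ^ Suc k)) sums (24 * S)" using S unfolding q_def by (rule sums_mult)
  from sums_imp_has_prod_exp[OF this] have "(\<lambda>k. exp (24 * Ln (1 - q ^ Suc k))) has_prod exp (24 * S)"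
    by (simp add: has_prod_def)
  moreover have "exp (24 * Ln (1 - q ^ Suc k)) = (1 - q ^ Suc k) ^ 24" for k
  proof -
    have "norm (q ^ Suc k) < 1" using q(1) by (rule norm_power_Suc_less_1)
    then have "1 - q ^ Suc k \<noteq> 0" by auto
    then show ?thesis using exp_of_nat_mult[of 24 "Ln (1 - q ^ Suc k)"] by simp
  qed
  ultimately have "(\<lambda>k. (1 - q ^ Suc k) ^ 24) has_prod exp (24 * S)" by simp
  then have "(\<Prod>k. (1 - q ^ Suc k) ^ 24) = exp (24 * S)" by (simp add: has_prod_iff)
  then have D: "Delta z = q * exp (24 * S)" by (simp add: Delta_def q_def Let_def)
  then show "Delta z \<noteq> 0" using q by simp
  have "norm (Delta z) = exp (- 2 * pi * Im z) * exp (24 * Re S)" using D q by (simp add: norm_mult)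
  then show "ln (norm (Delta z)) = - 2 * pi * Im z + 24 * Re S" by (simp add: ln_mult)
qed

text \<open>The row sums to \<open>(pi/(m y)) Re((1+Q)/(1-Q))\<close> and its integral is
  \<open>pi/(m y)\<close>. Subtraction replaces the quotient by \<open>2 Q/(1-Q)\<close>, which
  decays geometrically in \<open>m\<close>.\<close>

lemma lattice_reg_row_at_1:
  assumes z: "Im z > 0" and m: "m \<ge> 1"
  defines "Q \<equiv> exp (2 * of_real pi * \<i> * (of_int m * z))"
  shows "((\<lambda>n::int. sum_int_diff (\<lambda>t. lattice_form z m (of_int n + t)) 1) has_sum
            of_real (2 * pi / (of_int m * Im z) * Re (Q / (1 - Q)))) UNIV"
proof -
  let ?d = "\<lambda>n::int. sum_int_diff (\<lambda>t. lattice_form z m (of_int n + t)) 1"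
  let ?J = "\<lambda>n::int. integral {0..1} (\<lambda>t. of_real (lattice_form z m (of_int n + t)) powr (- 1)) :: complex"
  have v: "Im (of_int m * z) > 0" using z m by simp
  have "(\<lambda>p. sum_int_diff (\<lambda>t. lattice_form z (fst p) (of_int (snd p) + t)) 1) summable_on {1..} \<times> UNIV"
    using z by (intro lattice_reg_summable) auto
  then have d: "?d summable_on UNIV"
    using summable_on_SigmaD1[of "\<lambda>m n. sum_int_diff (\<lambda>t. lattice_form z m (of_int n + t)) 1" "{1..}" "\<lambda>_. UNIV" m] m
    by (simp add: case_prod_unfold)
  have "((\<lambda>n. ?J n) has_sum of_real ((of_int m * Im z) powr (1 - 2 * 1) * (sqrt pi * Gamma (1 - 1 / 2) / Gamma 1))) UNIV"
  proof -
    have "(1 :: real) > 1 / 2" by simp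
    from lattice_form_row_integrals[OF z this m] show ?thesis by (simp only: of_real_1)
  qed
  moreover have "(of_int m * Im z) powr (1 - 2 * 1) * (sqrt pi * Gamma (1 - 1 / 2) / Gamma 1) = pi / (of_int m * Im z)"
  proof -
    have "(1 - 2 * 1 :: real) = - 1" "(1 - 1 / 2 :: real) = 1 / 2" by auto
    moreover have "(of_int m * Im z) powr (- 1) = 1 / (of_int m * Im z)"
      using v by (intro powr_neg_one) simp
    moreover have "sqrt pi * Gamma (1 / 2) / Gamma 1 = pi" by (simp add: Gamma_one_half_real)
    ultimately show ?thesis by (simp only: times_divide_eq_left mult_1_left)
  qed
  ultimately have J: "(?J has_sum of_real (pi / (of_int m * Im z))) UNIV" by (simp only:)
  have g: "?d n + ?J n = of_real (1 / (norm (of_int m * z + of_int n))\<^sup>2)" for n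
  proof -
    have "lattice_form z m (of_int n) > 0" using z m by (intro lattice_form_pos) auto
    then show ?thesis
      by (simp add: sum_int_diff_def powr_minus lattice_form_def divide_inverse)
  qed
  \<comment> \<open>Summability of the row itself is recovered from that of the remainders and of
    the integrals.\<close>
  have "(\<lambda>n. ?d n + ?J n) summable_on UNIV" using d J by (intro summable_on_add) (auto simp: summable_on_def)
  then have "(\<lambda>n. of_real (1 / (norm (of_int m * z + of_int n))\<^sup>2) :: complex) summable_on UNIV" by (simp only: g)
  from summable_on_Re[OF this] have "(\<lambda>n. 1 / (norm (of_int m * z + of_int n))\<^sup>2) summable_on UNIV" by simp
  from has_sum_of_real[OF has_sum_inverse_norm_square[OF v this], where ?'a = complex]
  have "((\<lambda>n. ?d n + ?J n) has_sum of_real (pi / Im (of_int m * z) * Re ((1 + Q) / (1 - Q)))) UNIV"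
    by (simp only: g Q_def)
  moreover have "((\<lambda>n. - ?J n) has_sum - of_real (pi / (of_int m * Im z))) UNIV"
    using J by (simp add: has_sum_uminus)
  ultimately have "((\<lambda>n. ?d n + ?J n + - ?J n) has_sum of_real (pi / Im (of_int m * z) * Re ((1 + Q) / (1 - Q))) + - of_real (pi / (of_int m * Im z))) UNIV"
    by (rule has_sum_add)
  then
  have "(?d has_sum of_real (pi / Im (of_int m * z) * Re ((1 + Q) / (1 - Q)) - pi / (of_int m * Im z))) UNIV" by simp
  moreover have "pi / Im (of_int m * z) * Re ((1 + Q) / (1 - Q)) - pi / (of_int m * Im z) =
      2 * pi / (of_int m * Im z) * Re (Q / (1 - Q))"
  proof -
    have "norm Q < 1" using norm_nome(1)[OF v] by (simp add: Q_def)
    then have "1 - Q \<noteq> 0" by auto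
    then have "(1 + Q) / (1 - Q) = 1 + 2 * (Q / (1 - Q))" by (simp add: field_simps)
    moreover have "Re (1 + 2 * X) = 1 + 2 * Re X" for X by simp
    ultimately have "Re ((1 + Q) / (1 - Q)) = 1 + 2 * Re (Q / (1 - Q))" by (simp only:)
    moreover have "Im (of_int m * z) = of_int m * Im z" by simp
    ultimately show ?thesis by (simp only:) (simp add: algebra_simps)
  qed
  ultimately show ?thesis by (simp only:)
qed

text \<open>The rows add up to \<open>-(2 pi/y) Re S\<close>, and
  \<open>24 Re S = ln |Delta| + 2 pi y\<close>; the quotient of 24 by 2 is the constant 12.\<close>

lemma lattice_reg_at_1:
  assumes z: "Im z > 0"
  shows "Delta z \<noteq> 0"
    "lattice_reg z 1 = of_real (- (pi / (12 * Im z)) * (ln (norm (Delta z)) + 2 * pi * Im z))"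
proof -
  define q where "q = exp (2 * of_real pi * \<i> * z)"
  note q = norm_nome[OF z, folded q_def]
  obtain S where S: "((\<lambda>m. q ^ Suc m / (1 - q ^ Suc m) / of_nat (Suc m)) has_sum - S) UNIV"
    "(\<lambda>k. Ln (1 - q ^ Suc k)) sums S" using lambert_eq_sum_Ln[OF q(1)] by blast
  note D = norm_Delta[OF z S(2)[unfolded q_def]]
  show "Delta z \<noteq> 0" by (rule D(1))
  have "((\<lambda>p. sum_int_diff (\<lambda>t. lattice_form z (fst p) (of_int (snd p) + t)) 1) has_sum lattice_reg z 1) ({1..} \<times> UNIV)"
    unfolding lattice_reg_def using z by (intro has_sum_infsum lattice_reg_summable) auto
  then have "((\<lambda>m. of_real (2 * pi / (of_int m * Im z) * Re (exp (2 * of_real pi * \<i> * (of_int m * z)) / (1 - exp (2 * of_real pi * \<i> * (of_int m * z)))))) has_sum lattice_reg z 1) {1..}"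
    by (rule has_sum_SigmaD) (use lattice_reg_row_at_1[OF z] in auto)
  then have *: "((\<lambda>m. of_real (2 * pi / (real (Suc m) * Im z) * Re (q ^ Suc m / (1 - q ^ Suc m)))) has_sum lattice_reg z 1) UNIV"
  proof (subst (asm) has_sum_reindex_bij_witness[of _ "\<lambda>m. int (Suc m)" "\<lambda>m. nat (m - 1)" UNIV _ _ "lattice_reg z 1"])
    show "of_real (2 * pi / (real (Suc (nat (m - 1))) * Im z) * Re (q ^ Suc (nat (m - 1)) / (1 - q ^ Suc (nat (m - 1))))) =
       of_real (2 * pi / (of_int m * Im z) * Re (exp (2 * of_real pi * \<i> * (of_int m * z)) / (1 - exp (2 * of_real pi * \<i> * (of_int m * z)))))"
      if "m \<in> {1..}" for m
    proof -
      have 1: "Suc (nat (m - 1)) = nat m" "real (nat m) = of_int m" using that by auto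
      have "complex_of_int m = of_nat (nat m)" using that by simp
      then have "exp (2 * of_real pi * \<i> * (of_int m * z)) = q ^ nat m"
        unfolding q_def exp_of_nat_mult[symmetric] by (simp add: algebra_simps)
      then show ?thesis by (simp only: 1)
    qed
  qed auto
  have "((\<lambda>m. Re (q ^ Suc m / (1 - q ^ Suc m) / of_nat (Suc m))) has_sum Re (- S)) UNIV"
    by (rule has_sum_Re[OF S(1)])
  then have "((\<lambda>m. 2 * pi / Im z * Re (q ^ Suc m / (1 - q ^ Suc m) / of_nat (Suc m))) has_sum (2 * pi / Im z * Re (- S))) UNIV"
    by (rule has_sum_cmult_right)
  from has_sum_of_real[OF this, where ?'a = complex]
  have **: "((\<lambda>m. of_real (2 * pi / (real (Suc m) * Im z) * Re (q ^ Suc m / (1 - q ^ Suc m))) :: complex) has_sum of_real (2 * pi / Im z * Re (- S))) UNIV"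
  proof (rule has_sum_cong[THEN iffD1, rotated])
    show "of_real (2 * pi / Im z * Re (q ^ Suc m / (1 - q ^ Suc m) / of_nat (Suc m))) =
       (of_real (2 * pi / (real (Suc m) * Im z) * Re (q ^ Suc m / (1 - q ^ Suc m))) :: complex)" for m
      by (simp only: Re_divide_of_nat of_real_eq_iff) (simp add: mult.commute)
  qed
  have "lattice_reg z 1 = of_real (2 * pi / Im z * Re (- S))" using * ** by (rule has_sum_unique)
  also have "2 * pi / Im z * Re (- S) = - (pi / (12 * Im z)) * (ln (norm (Delta z)) + 2 * pi * Im z)"
    unfolding D(2) by (simp add: field_simps)
  finally show "lattice_reg z 1 = of_real (- (pi / (12 * Im z)) * (ln (norm (Delta z)) + 2 * pi * Im z))" .
qed

section \<open>Cosets and coprime pairs\<close>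

lemma mat2_nth [simp]:
  "mat2 a b c d $ 1 $ 1 = a" "mat2 a b c d $ 1 $ 2 = b" "mat2 a b c d $ 2 $ 1 = c" "mat2 a b c d $ 2 $ 2 = d"
  by (simp_all add: mat2_def)

lemma mat2_eq_iff: "mat2 a b c d = mat2 a' b' c' d' \<longleftrightarrow> a = a' \<and> b = b' \<and> c = c' \<and> d = d'"
  by (metis mat2_nth)

lemma mat2_nth_eq: "mat2 (g $ 1 $ 1) (g $ 1 $ 2) (g $ 2 $ 1) (g $ 2 $ 2) = g"
  by (simp add: vec_eq_iff forall_2)

lemma mat2_mult: "mat2 a b c d ** mat2 a' b' c' d' = mat2 (a * a' + b * c') (a * b' + b * d') (c * a' + d * c') (c * b' + d * d')"
  by (simp add: vec_eq_iff forall_2 matrix_matrix_mult_def sum_2)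

lemma mat2_uminus: "- mat2 a b c d = mat2 (- a) (- b) (- c) (- d)"
  by (simp add: vec_eq_iff forall_2)

lemma det_mat2: "det (mat2 a b c d) = a * d - b * c"
  by (simp add: det_2)

lemma mem_Gamma0_iff:
  "g \<in> Gamma0 N \<longleftrightarrow> (\<exists>a b c d :: int. g = mat2 (of_int a) (of_int b) (of_int c) (of_int d) \<and> a * d - b * c = 1 \<and> int N dvd c)"
proof
  assume g: "g \<in> Gamma0 N"
  then have "\<forall>i j. \<exists>k::int. g $ i $ j = of_int k" by (auto simp: Gamma0_def elim!: Ints_cases)
  then obtain k where k: "\<And>i j. g $ i $ j = of_int (k i j)" by metis
  have e: "g = mat2 (of_int (k 1 1)) (of_int (k 1 2)) (of_int (k 2 1)) (of_int (k 2 2))"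
    by (simp add: k[symmetric] mat2_nth_eq)
  have "real_of_int (k 1 1 * k 2 2 - k 1 2 * k 2 1) = 1" using g by (simp add: Gamma0_def det_2 k)
  then have "k 1 1 * k 2 2 - k 1 2 * k 2 1 = 1" by (simp only: of_int_eq_1_iff)
  moreover have "int N dvd k 2 1"
  proof -
    obtain l :: int where "g $ 2 $ 1 = of_int (int N * l)" using g by (auto simp: Gamma0_def)
    then have "k 2 1 = int N * l" by (simp only: k of_int_eq_iff)
    then show ?thesis by simp
  qed
  ultimately show "\<exists>a b c d :: int. g = mat2 (of_int a) (of_int b) (of_int c) (of_int d) \<and> a * d - b * c = 1 \<and> int N dvd c"
    using e by blast
next
  assume "\<exists>a b c d :: int. g = mat2 (of_int a) (of_int b) (of_int c) (of_int d) \<and> a * d - b * c = 1 \<and> int N dvd c"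
  then obtain a b c d :: int where g: "g = mat2 (of_int a) (of_int b) (of_int c) (of_int d)" "a * d - b * c = 1" "int N dvd c"
    by blast
  have "g $ i $ j \<in> \<int>" for i j using exhaust_2[of i] exhaust_2[of j] by (auto simp: g(1))
  moreover have "det g = 1" using g(2) unfolding g(1) det_mat2 by (metis of_int_1 of_int_diff of_int_mult)
  moreover have "\<exists>k. g $ 2 $ 1 = of_int (int N * k)" using g(3) unfolding g(1) mat2_nth by (metis dvdE)
  ultimately show "g \<in> Gamma0 N" by (simp add: Gamma0_def)
qed

text \<open>A coset of \<open>Gamma_inf\<close> is determined by the bottom row up to sign; the
  alternative with the negated pair reflects the sign contained in \<open>Gamma_inf\<close>.\<close>

definition row_class :: "int \<times> int \<Rightarrow> (real^2^2) set" where
  "row_class p = {mat2 (of_int a) (of_int b) (of_int c) (of_int d) | a b c d.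
      a * d - b * c = 1 \<and> ((c, d) = p \<or> (- c, - d) = p)}"

lemma Gamma_inf_orbit:
  assumes "a * d - b * c = (1 :: int)"
  shows "{h. \<exists>p\<in>Gamma_inf. h = p ** mat2 (of_int a) (of_int b) (of_int c) (of_int d)} = row_class (c, d)"
proof (intro set_eqI iffI)
  fix h assume "h \<in> {h. \<exists>p\<in>Gamma_inf. h = p ** mat2 (of_int a) (of_int b) (of_int c) (of_int d)}"
  then obtain m :: int where
    "h = mat2 1 (of_int m) 0 1 ** mat2 (of_int a) (of_int b) (of_int c) (of_int d) \<or>
     h = - mat2 1 (of_int m) 0 1 ** mat2 (of_int a) (of_int b) (of_int c) (of_int d)"
    by (auto simp: Gamma_inf_def)
  then have "h = mat2 (of_int (a + m * c)) (of_int (b + m * d)) (of_int c) (of_int d) \<or>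
     h = mat2 (of_int (- (a + m * c))) (of_int (- (b + m * d))) (of_int (- c)) (of_int (- d))"
    by (auto simp: mat2_mult mat2_uminus mat2_eq_iff)
  moreover have "(a + m * c) * d - (b + m * d) * c = 1" using assms by (simp add: algebra_simps)
  moreover have "(- (a + m * c)) * (- d) - (- (b + m * d)) * (- c) = 1" using assms by (simp add: algebra_simps)
  ultimately show "h \<in> row_class (c, d)" unfolding row_class_def mem_Collect_eq by (metis minus_minus)
next
  fix h assume "h \<in> row_class (c, d)"
  then obtain a' b' c' d' where h: "h = mat2 (of_int a') (of_int b') (of_int c') (of_int d')" "a' * d' - b' * c' = 1"
    and cd: "(c', d') = (c, d) \<or> (- c', - d') = (c, d)" unfolding row_class_def by blast
  \<comment> \<open>\<open>a y - x b\<close> is the upper right entry of the second matrix times the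
    inverse of the first, hence the only possible translation.\<close>
  have key: "a + (a * y - x * b) * c = x" "b + (a * y - x * b) * d = y" if "x * d - y * c = 1" for x y
  proof -
    have "a + (a * y - x * b) * c = a - a * (x * d - y * c) + x * (a * d - b * c)" by (simp add: algebra_simps)
    then show "a + (a * y - x * b) * c = x" using assms that by simp
    have "b + (a * y - x * b) * d = b - b * (x * d - y * c) + y * (a * d - b * c)" by (simp add: algebra_simps)
    then show "b + (a * y - x * b) * d = y" using assms that by simp
  qed
  show "h \<in> {h. \<exists>p\<in>Gamma_inf. h = p ** mat2 (of_int a) (of_int b) (of_int c) (of_int d)}"
    using cd
  proof
    assume e: "(c', d') = (c, d)"
    define m where "m = a * b' - a' * b"
    have "a + m * c = a'" "b + m * d = b'" using key[of a' b'] h(2) e by (auto simp: m_def)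
    then have "h = mat2 1 (of_int m) 0 1 ** mat2 (of_int a) (of_int b) (of_int c) (of_int d)"
      using e by (simp add: h(1) mat2_mult mat2_eq_iff) (metis of_int_add of_int_mult)
    then show ?thesis by (auto simp: Gamma_inf_def)
  next
    assume e: "(- c', - d') = (c, d)"
    then have cd': "c' = - c" "d' = - d" by auto
    define m where "m = a * (- b') - (- a') * b"
    have "(- a') * d - (- b') * c = 1" using h(2) cd' by (simp add: algebra_simps)
    from key[OF this] have "a + m * c = - a'" "b + m * d = - b'" by (simp_all only: m_def)
    then have "real_of_int a' = - (of_int a + of_int m * of_int c)" "real_of_int b' = - (of_int b + of_int m * of_int d)"
      by (metis minus_minus of_int_add of_int_minus of_int_mult)+
    then have "h = - mat2 1 (of_int m) 0 1 ** mat2 (of_int a) (of_int b) (of_int c) (of_int d)"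
      by (simp add: h(1) mat2_mult mat2_uminus mat2_eq_iff cd')
    then show ?thesis by (auto simp: Gamma_inf_def)
  qed
qed

definition coprime_rows :: "nat \<Rightarrow> (int \<times> int) set" where
  "coprime_rows N = {(c, d). coprime c d \<and> int N dvd c}"

text \<open>One representative from each pair \<open>(c,d)\<close>, \<open>(-c,-d)\<close>. This set
  indexes the cosets, while \<open>coprime_rows\<close> keeps both signs for the factorisation of
  lattice points.\<close>

definition pos_rows :: "nat \<Rightarrow> (int \<times> int) set" where
  "pos_rows N = {(c, d). coprime c d \<and> int N dvd c \<and> (c > 0 \<or> c = 0 \<and> d > 0)}"

lemma row_class_nonempty:
  assumes "coprime c d" obtains a b where "a * d - b * c = 1" "mat2 (of_int a) (of_int b) (of_int c) (of_int d) \<in> row_class (c, d)"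
proof -
  obtain u v where "u * c + v * d = gcd c d" using bezout_int by blast
  then have "v * d - (- u) * c = 1" using assms by simp
  then show thesis using that[of v "- u"] unfolding row_class_def by blast
qed

text \<open>Bezout completes a coprime row to determinant 1, divisibility of \<open>c\<close> by
  \<open>N\<close> places the matrix in \<open>Gamma0 N\<close>, and the sign condition makes the
  row unique.\<close>

lemma bij_betw_row_class: "bij_betw row_class (pos_rows N) (cosets N)"
proof (rule bij_betw_imageI)
  show "inj_on row_class (pos_rows N)"
  proof (rule inj_onI)
    fix p q assume p: "p \<in> pos_rows N" and q: "q \<in> pos_rows N" and eq: "row_class p = row_class q"
    obtain c d where pc: "p = (c, d)" by (cases p)
    obtain a b where "mat2 (of_int a) (of_int b) (of_int c) (of_int d) \<in> row_class p"
    proof -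
      have "coprime c d" using p by (auto simp: pc pos_rows_def)
      then show thesis using row_class_nonempty[of c d] that unfolding pc by blast
    qed
    then have "mat2 (of_int a) (of_int b) (of_int c) (of_int d) \<in> row_class q" using eq by simp
    then have "(c, d) = q \<or> (- c, - d) = q" by (auto simp: row_class_def mat2_eq_iff)
    then show "p = q" using p q by (auto simp: pc pos_rows_def)
  qed
  have orbit: "{(g, h). \<exists>p\<in>Gamma_inf. h = p ** g} `` {g} = {h. \<exists>p\<in>Gamma_inf. h = p ** g}" for g by auto
  show "row_class ` pos_rows N = cosets N"
  proof (intro set_eqI iffI)
    fix C assume "C \<in> row_class ` pos_rows N"
    then obtain c d where C: "C = row_class (c, d)" and cd: "(c, d) \<in> pos_rows N" by auto
    have "coprime c d" using cd by (auto simp: pos_rows_def)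
    then obtain a b where ab: "a * d - b * c = 1" using row_class_nonempty[of c d] by blast
    have "mat2 (of_int a) (of_int b) (of_int c) (of_int d) \<in> Gamma0 N"
      using ab cd by (auto simp: mem_Gamma0_iff pos_rows_def)
    then show "C \<in> cosets N"
      unfolding cosets_def quotient_def orbit C Gamma_inf_orbit[OF ab, symmetric] by blast
  next
    fix C assume "C \<in> cosets N"
    then obtain g where g: "g \<in> Gamma0 N" "C = {h. \<exists>p\<in>Gamma_inf. h = p ** g}"
      unfolding cosets_def quotient_def orbit by blast
    then obtain a b c d where abcd: "g = mat2 (of_int a) (of_int b) (of_int c) (of_int d)" "a * d - b * c = 1" "int N dvd c"
      unfolding mem_Gamma0_iff by blast
    have C: "C = row_class (c, d)" using Gamma_inf_orbit[OF abcd(2)] g(2) abcd(1) by simp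
    have C': "C = row_class (- c, - d)" unfolding C row_class_def by (rule Collect_cong) (metis minus_minus prod.inject)
    have cop: "coprime c d"
    proof (rule coprimeI)
      fix l assume "l dvd c" "l dvd d"
      then have "l dvd a * d - b * c" by auto
      then show "is_unit l" using abcd(2) by simp
    qed
    have "c \<noteq> 0 \<or> d \<noteq> 0" using abcd(2) by auto
    then have "(c, d) \<in> pos_rows N \<or> (- c, - d) \<in> pos_rows N"
      using cop abcd(3) by (auto simp: pos_rows_def)
    then show "C \<in> row_class ` pos_rows N" using C C' by blast
  qed
qed

lemma Im_mat_act:
  assumes "a * d - b * c = (1 :: int)"
  shows "Im (mat_act (mat2 (of_int a) (of_int b) (of_int c) (of_int d)) z) = Im z / lattice_form z c (of_int d)"
proof -
  have "Im (mat_act (mat2 (of_int a) (of_int b) (of_int c) (of_int d)) z) =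
      (of_int a * Im z * (of_int c * Re z + of_int d) - (of_int a * Re z + of_int b) * (of_int c * Im z)) /
      lattice_form z c (of_int d)"
    by (simp add: mat_act_def automorphy_def Im_divide lattice_form_eq add_ac)
  also have "of_int a * Im z * (of_int c * Re z + of_int d) - (of_int a * Re z + of_int b) * (of_int c * Im z) =
      of_int (a * d - b * c) * Im z" by (simp add: algebra_simps)
  finally show ?thesis by (simp add: assms)
qed

lemma Im_mat_act_SOME:
  assumes "coprime c d"
  shows "Im (mat_act (SOME g. g \<in> row_class (c, d)) z) = Im z / lattice_form z c (of_int d)"
proof -
  have "row_class (c, d) \<noteq> {}" using row_class_nonempty[OF assms] by blast
  then have "(SOME g. g \<in> row_class (c, d)) \<in> row_class (c, d)" by (rule some_in_eq[THEN iffD2])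
  then obtain a b c' d' where g: "(SOME g. g \<in> row_class (c, d)) = mat2 (of_int a) (of_int b) (of_int c') (of_int d')"
    "a * d' - b * c' = 1" "(c', d') = (c, d) \<or> (- c', - d') = (c, d)" unfolding row_class_def by blast
  have "lattice_form z c' (of_int d') = lattice_form z c (of_int d)"
    using g(3) by (auto simp: lattice_form_eq power2_eq_square algebra_simps)
  then show ?thesis unfolding g(1) Im_mat_act[OF g(2)] by simp
qed

lemma infsum_cosets:
  "(\<Sum>\<^sub>\<infinity>C\<in>cosets N. of_real (Im (mat_act (SOME g. g \<in> C) z)) powr s) =
   (\<Sum>\<^sub>\<infinity>p\<in>pos_rows N. of_real (Im z / lattice_form z (fst p) (of_int (snd p))) powr s :: complex)"
proof -
  have "(\<Sum>\<^sub>\<infinity>C\<in>cosets N. of_real (Im (mat_act (SOME g. g \<in> C) z)) powr s) =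
      (\<Sum>\<^sub>\<infinity>p\<in>pos_rows N. of_real (Im (mat_act (SOME g. g \<in> row_class p) z)) powr s :: complex)"
    by (rule infsum_reindex_bij_betw[OF bij_betw_row_class, symmetric])
  also have "\<dots> = (\<Sum>\<^sub>\<infinity>p\<in>pos_rows N. of_real (Im z / lattice_form z (fst p) (of_int (snd p))) powr s)"
    by (intro infsum_cong) (auto simp: pos_rows_def Im_mat_act_SOME)
  finally show ?thesis .
qed

section \<open>Sieving the Eisenstein series\<close>

text \<open>Divisibility by a product of distinct primes is divisibility by each of them, so the sum
  becomes a product that has a zero factor as soon as some prime of \<open>N\<close> divides
  \<open>n\<close>.\<close>

lemma sum_moebius_mu_dvd:
  assumes N: "N > 0"
  shows "(\<Sum>d | d dvd N. of_int (moebius_mu d) * (if int d dvd n then 1 else 0)) =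
           (if coprime n (int N) then 1 else (0 :: 'a :: {comm_ring_1, semiring_no_zero_divisors}))"
proof -
  have "(\<Sum>d | d dvd N. of_int (moebius_mu d) * (if int d dvd n then 1 else 0)) =
      (\<Prod>p\<in>prime_factors N. 1 - (if int p dvd n then 1 else (0 :: 'a)))"
  proof (rule sum_moebius_mu_mult[OF N])
    fix X assume X: "X \<subseteq> prime_factors N"
    have "finite X" using X finite_subset by blast
    then show "(if int (\<Prod>X) dvd n then 1 else 0) = (\<Prod>p\<in>X. if int p dvd n then 1 else (0 :: 'a))"
      using X
    proof (induction X)
      case (insert x F)
      have "prime x" "\<And>p. p \<in> F \<Longrightarrow> prime p" using insert.prems by (auto dest: in_prime_factors_imp_prime)
      then have "coprime x (\<Prod>F)"
        using insert.hyps by (intro prod_coprime_right primes_coprime) auto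
      then have "int (x * \<Prod>F) dvd n \<longleftrightarrow> int x dvd n \<and> int (\<Prod>F) dvd n"
        by (metis coprime_int_iff divides_mult dvd_mult_left dvd_mult_right of_nat_mult)
      moreover have IH: "(\<Prod>p\<in>F. if int p dvd n then 1 else 0) = (if int (\<Prod>F) dvd n then 1 else (0 :: 'a))"
        using insert.IH insert.prems by auto
      ultimately show ?case
        unfolding prod.insert[OF insert.hyps] IH by simp
    qed simp
  qed
  also have "\<dots> = (if coprime n (int N) then 1 else 0)"
  proof (cases "coprime n (int N)")
    case True
    have "\<not> int p dvd n" if "p \<in> prime_factors N" for p
    proof
      assume p: "int p dvd n"
      have "prime p" "p dvd N" using that by (auto dest: in_prime_factors_imp_prime in_prime_factors_imp_dvd)
      then have "is_unit (int p)" using True p by (metis coprime_common_divisor int_dvd_int_iff)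
      then show False using \<open>prime p\<close> by (metis not_prime_unit nat_abs_int_diff nat_int int_dvd_int_iff of_nat_1)
    qed
    then show ?thesis using True by simp
  next
    case False
    then have "gcd (nat \<bar>n\<bar>) N \<noteq> 1"
      by (metis coprime_iff_gcd_eq_1 gcd_abs1_int gcd_int_int_eq int_nat_eq abs_ge_zero of_nat_1)
    then obtain p where p: "prime p" "p dvd gcd (nat \<bar>n\<bar>) N" using prime_factor_nat by blast
    have "p dvd nat \<bar>n\<bar>" "p dvd N" using p(2) dvd_trans gcd_dvd1 gcd_dvd2 by blast+
    then have "int p dvd n" "p \<in> prime_factors N" using N p(1)
      by (auto simp: in_prime_factors_iff dvd_nat_abs_iff)
    then show ?thesis using False by (auto intro!: prod_zero)
  qed
  finally show ?thesis .
qed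

text \<open>Logarithms of positive reals add without a branch correction; if a factor is 0, both
  sides are 0.\<close>

lemma of_nat_mult_powr: "(of_nat (a * b) :: complex) powr s = of_nat a powr s * of_nat b powr s"
proof (cases "a = 0 \<or> b = 0")
  case False
  then have pos: "real a > 0" "real b > 0" "real a * real b > 0" by auto
  have "exp (s * of_real (ln (real a * real b))) = exp (s * of_real (ln (real a))) * exp (s * of_real (ln (real b)))"
    using pos by (simp add: ln_mult distrib_left exp_add)
  then have "(of_real (real a * real b) :: complex) powr s = of_real (real a) powr s * of_real (real b) powr s"
    unfolding of_real_powr_eq_exp[OF pos(1)] of_real_powr_eq_exp[OF pos(2)] of_real_powr_eq_exp[OF pos(3)] .
  then show ?thesis by simp
qed auto

lemma sum_moebius_mu_powr:
  assumes "N > 0"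
  shows "(\<Sum>d | d dvd N. of_int (moebius_mu d) * of_nat d powr (- s)) = (\<Prod>p\<in>prime_factors N. 1 - of_nat p powr (- s :: complex))"
proof (rule sum_moebius_mu_mult[OF assms])
  fix X assume "X \<subseteq> prime_factors N"
  then have "finite X" using finite_subset by blast
  then show "of_nat (\<Prod>X) powr (- s) = (\<Prod>p\<in>X. of_nat p powr (- s :: complex))"
    by induction (simp_all add: of_nat_mult_powr del: of_nat_mult)
qed

lemma has_sum_finite_sum:
  fixes f :: "'i \<Rightarrow> 'a \<Rightarrow> 'b :: topological_comm_monoid_add"
  assumes "finite I" "\<And>i. i \<in> I \<Longrightarrow> (f i has_sum g i) B"
  shows "((\<lambda>x. \<Sum>i\<in>I. f i x) has_sum (\<Sum>i\<in>I. g i)) B"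
  using assms by (induction) (auto intro!: has_sum_add)

text \<open>Inclusion-exclusion for unordered sums, with \<open>\<nu>\<close> the quantity to be
  made coprime to \<open>N\<close>. It is applied to the integers \<open>k\<close> for the Euler
  factors and to the second coordinate of lattice points.\<close>

lemma has_sum_sieve:
  fixes h :: "'a \<Rightarrow> complex" and \<nu> :: "'a \<Rightarrow> int"
  assumes N: "N > 0" and f: "\<And>d. d dvd N \<Longrightarrow> (h has_sum f d) {x \<in> B. int d dvd \<nu> x}"
  shows "(h has_sum (\<Sum>d | d dvd N. of_int (moebius_mu d) * f d)) {x \<in> B. coprime (\<nu> x) (int N)}"
proof -
  have "((\<lambda>x. \<Sum>d | d dvd N. of_int (moebius_mu d) * ((if int d dvd \<nu> x then 1 else 0) * h x)) has_sum
      (\<Sum>d | d dvd N. of_int (moebius_mu d) * f d)) B"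
  proof (intro has_sum_finite_sum has_sum_cmult_right)
    fix d assume d: "d \<in> {d. d dvd N}"
    then have "(h has_sum f d) {x \<in> B. int d dvd \<nu> x}" using f by simp
    then show "((\<lambda>x. (if int d dvd \<nu> x then 1 else 0) * h x) has_sum f d) B"
      by (rule has_sum_cong_neutral[THEN iffD1, rotated -1]) auto
  qed (use N in auto)
  moreover have "(\<Sum>d | d dvd N. of_int (moebius_mu d) * ((if int d dvd \<nu> x then 1 else 0) * h x)) =
      (if coprime (\<nu> x) (int N) then 1 else 0) * h x" for x
    unfolding mult.assoc[symmetric] sum_distrib_right[symmetric] using sum_moebius_mu_dvd[OF N, of "\<nu> x", where ?'a = complex] by simp
  ultimately have "((\<lambda>x. (if coprime (\<nu> x) (int N) then 1 else 0) * h x) has_sum (\<Sum>d | d dvd N. of_int (moebius_mu d) * f d)) B"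
    by (simp only:)
  then show ?thesis
    by (rule has_sum_cong_neutral[THEN iffD1, rotated -1]) auto
qed

text \<open>The multiples of \<open>d\<close> contribute \<open>d^(-s) zeta(s)\<close>, and the
  Moebius sum of the \<open>d^(-s)\<close> is the finite Euler product in
  \<open>zeta_level\<close>.\<close>

lemma zeta_level_has_sum:
  assumes N: "N > 0" and s: "Re s > 1"
  shows "((\<lambda>k. of_nat k powr (- s)) has_sum zeta_level N s) {k. k > 0 \<and> coprime k N}"
proof -
  have "((\<lambda>k. of_nat k powr (- s)) has_sum (\<Sum>d | d dvd N. of_int (moebius_mu d) * (of_nat d powr (- s) * zeta s)))
      {k \<in> {0<..}. coprime (int k) (int N)}"
  proof (rule has_sum_sieve[OF N])
    fix d assume "d dvd N"
    then have d: "d > 0" using N by (rule dvd_pos_nat[rotated])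
    have "((\<lambda>k. of_nat d powr (- s) * of_nat k powr (- s)) has_sum (of_nat d powr (- s) * zeta s)) {0<..}"
      by (intro has_sum_cmult_right zeta_has_sum s)
    then show "((\<lambda>k. of_nat k powr (- s)) has_sum (of_nat d powr (- s) * zeta s)) {x \<in> {0<..}. int d dvd int x}"
      by (rule has_sum_reindex_bij_witness[of _ "\<lambda>k. k div d" "\<lambda>k. d * k", THEN iffD1, rotated -1])
         (use d in \<open>auto simp: of_nat_mult_powr simp del: of_nat_mult elim!: dvdE\<close>)
  qed
  also have "{k \<in> {0<..}. coprime (int k) (int N)} = {k. k > 0 \<and> coprime k N}" by auto
  also have "(\<Sum>d | d dvd N. of_int (moebius_mu d) * (of_nat d powr (- s) * zeta s)) = zeta_level N s"
    unfolding zeta_level_def sum_moebius_mu_powr[OF N, symmetric] by (simp add: sum_distrib_left mult_ac)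
  finally show ?thesis .
qed

text \<open>The terms with \<open>k \<ge> 2\<close> are dominated by \<open>1 / (k (k - 1))\<close>, whose sum is \<open>1\<close>.\<close>
lemma zeta_level_nonzero:
  assumes N: "N > 0" and s: "Re s \<ge> 2"
  shows "zeta_level N s \<noteq> 0"
proof
  assume Z: "zeta_level N s = 0"
  let ?K = "{k. k > 0 \<and> coprime k N}"
  let ?f = "\<lambda>k. of_nat k powr (- s) :: complex"
  have "(?f has_sum 0) ?K" using zeta_level_has_sum[OF N, of s] s Z by simp
  \<comment> \<open>The term \<open>k = 1\<close> equals 1, so a zero would force the remaining
    terms to add up to -1.\<close>
  then have "(?f has_sum (0 - sum ?f {1})) (?K - {1})"
    by (intro has_sum_Diff has_sum_finite) (auto)
  then have f: "(?f has_sum - 1) (?K - {1})" by simp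
  have b: "((\<lambda>n. 1 / real (Suc n) - 1 / real (Suc (Suc n))) has_sum 1) UNIV"
  proof -
    have "(\<lambda>n. 1 / real (Suc n)) \<longlonglongrightarrow> 0" by (rule LIMSEQ_Suc) (rule lim_1_over_n)
    then have "(\<lambda>n. 1 / real (Suc n) - 1 / real (Suc (Suc n))) sums (1 / real (Suc 0) - 0)"
      by (rule telescope_sums')
    then show ?thesis by (intro sums_nonneg_imp_has_sum) (auto simp: field_simps)
  qed
  have lt: "real (n + 2) powr (- Re s) \<le> 1 / real (Suc n) - 1 / real (Suc (Suc n))" for n
  proof -
    have "real (n + 2) powr (- Re s) \<le> real (n + 2) powr (- 2)" using s by (intro powr_mono) auto
    also have "\<dots> = 1 / (real (n + 2))\<^sup>2" by (simp add: powr_minus powr_numeral divide_inverse)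
    also have "\<dots> \<le> 1 / (real (Suc n) * real (Suc (Suc n)))"
      by (rule divide_left_mono) (auto simp: power2_eq_square algebra_simps add_pos_nonneg)
    also have "\<dots> = 1 / real (Suc n) - 1 / real (Suc (Suc n))" by (simp add: field_simps)
    finally show ?thesis .
  qed
  have sum2: "(\<lambda>n. real (n + 2) powr (- Re s)) summable_on UNIV"
    by (rule summable_on_comparison_test[OF has_sum_imp_summable[OF b]]) (use lt in auto)
  define S where "S = (\<Sum>\<^sub>\<infinity>n. real (n + 2) powr (- Re s))"
  have S: "((\<lambda>n. real (n + 2) powr (- Re s)) has_sum S) UNIV" unfolding S_def using sum2 by (rule has_sum_infsum)
  \<comment> \<open>The comparison is strict in its first term:
    \<open>2^(-Re s) <= 1/4 < 1/2\<close>.\<close>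
  have "S < 1"
  proof (rule has_sum_strict_mono[OF S b])
    show "real (0 + 2) powr (- Re s) < 1 / real (Suc 0) - 1 / real (Suc (Suc 0))"
    proof -
      have "(2 :: real) powr (- Re s) \<le> 2 powr (- 2)" using s by (intro powr_mono) auto
      also have "\<dots> < 1 / 2" by (simp add: powr_minus)
      finally show ?thesis by simp
    qed
  qed (use lt in auto)
  moreover have "norm (- 1 :: complex) \<le> S"
  proof -
    have S': "((\<lambda>k. real k powr (- Re s)) has_sum S) {2..}"
      using S by (rule has_sum_reindex_bij_witness[of _ "\<lambda>k. k - 2" "\<lambda>n. n + 2", THEN iffD1, rotated -1]) auto
    have sub: "?K - {1} \<subseteq> {2..}" by auto
    have T: "((\<lambda>k. real k powr (- Re s)) has_sum (\<Sum>\<^sub>\<infinity>k\<in>?K - {1}. real k powr (- Re s))) (?K - {1})"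
      by (intro has_sum_infsum summable_on_subset[OF has_sum_imp_summable[OF S'] sub])
    have "norm (?f k) \<le> real k powr (- Re s)" if "k \<in> ?K - {1}" for k
      using norm_of_real_powr[of "real k" "- s"] by simp
    with f T have "norm (- 1 :: complex) \<le> (\<Sum>\<^sub>\<infinity>k\<in>?K - {1}. real k powr (- Re s))"
      by (rule norm_infsum_le)
    also have "\<dots> \<le> S" by (rule has_sum_mono2[OF T S' sub]) auto
    finally show ?thesis .
  qed
  ultimately show False by simp
qed

lemma lattice_form_pos':
  assumes "Im z > 0" "(m, n) \<noteq> (0, 0 :: int)" shows "lattice_form z m (of_int n) > 0"
  using lattice_form_pos[OF assms(1), of m] assms(2) by (cases "m = 0") (auto simp: lattice_form_eq)

lemma lattice_form_scale_powr:
  assumes "Im z > 0" "(m, n) \<noteq> (0, 0 :: int)" "d > 0" "lattice_form w m' (of_int n') = (real d)\<^sup>2 * lattice_form z m (of_int n)"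
  shows "of_real (lattice_form w m' (of_int n')) powr (- s) =
           of_nat d powr (- (2 * s)) * (of_real (lattice_form z m (of_int n)) powr (- s) :: complex)"
proof -
  note pos = lattice_form_pos'[OF assms(1,2)]
  have d: "(real d)\<^sup>2 > 0" "real d > 0" using assms(3) by auto
  then have "(real d)\<^sup>2 * lattice_form z m (of_int n) > 0" using pos by simp
  then have "of_real (lattice_form w m' (of_int n')) powr (- s) =
      exp (- s * of_real (2 * ln (real d) + ln (lattice_form z m (of_int n))))"
    unfolding assms(4) using d pos by (subst of_real_powr_eq_exp) (auto simp: ln_mult ln_realpow)
  also have "\<dots> = exp (- (2 * s) * of_real (ln (real d))) * exp (- s * of_real (ln (lattice_form z m (of_int n))))"
    by (simp add: exp_add[symmetric] algebra_simps)
  also have "\<dots> = of_real (real d) powr (- (2 * s)) * of_real (lattice_form z m (of_int n)) powr (- s)"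
    unfolding of_real_powr_eq_exp[OF d(2)] of_real_powr_eq_exp[OF pos] ..
  finally show ?thesis by simp
qed

text \<open>For \<open>N = d t\<close> the points with \<open>N\<close> dividing \<open>m\<close>
  and \<open>d\<close> dividing \<open>n\<close> are \<open>(N m', d n')\<close>, and
  \<open>N m' z + d n' = d (m' t z + n')\<close>. This homogeneity is the source of the arguments
  \<open>t z\<close>.\<close>

lemma lattice_zeta_sieved:
  assumes z: "Im z > 0" and N: "N > 0" and s: "Re s > 1"
  shows "((\<lambda>p. of_real (lattice_form z (fst p) (of_int (snd p))) powr (- s)) has_sum
     (\<Sum>d | d dvd N. of_int (moebius_mu d) * (of_nat d powr (- (2 * s)) * lattice_zeta (of_nat (N div d) * z) s)))
     {p. p \<noteq> (0, 0) \<and> int N dvd fst p \<and> coprime (snd p) (int N)}"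
proof -
  let ?g = "\<lambda>z p. of_real (lattice_form z (fst p) (of_int (snd p))) powr (- s) :: complex"
  let ?B = "{p :: int \<times> int. p \<noteq> (0, 0) \<and> int N dvd fst p}"
  have "(?g z has_sum (\<Sum>d | d dvd N. of_int (moebius_mu d) * (of_nat d powr (- (2 * s)) * lattice_zeta (of_nat (N div d) * z) s)))
     {p \<in> ?B. coprime (snd p) (int N)}"
  proof (rule has_sum_sieve[OF N])
    fix d assume "d dvd N"
    then obtain t where t: "N = d * t" by auto
    have dt: "d > 0" "t > 0" "N div d = t" using N t by auto
    define w where "w = of_nat t * z"
    have w: "Im w > 0" using z dt by (simp add: w_def)
    have "?g w summable_on - {(0, 0)}" using lattice_zeta_summable[OF w s] by (rule abs_summable_summable)
    then have "(?g w has_sum lattice_zeta w s) (- {(0, 0)})" unfolding lattice_zeta_def by (rule has_sum_infsum)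
    then have "((\<lambda>p. of_nat d powr (- (2 * s)) * ?g w p) has_sum (of_nat d powr (- (2 * s)) * lattice_zeta w s)) (- {(0, 0)})"
      by (rule has_sum_cmult_right)
    then show "(?g z has_sum (of_nat d powr (- (2 * s)) * lattice_zeta (of_nat (N div d) * z) s)) {x \<in> ?B. int d dvd snd x}"
      unfolding dt(3) w_def[symmetric]
    proof (rule has_sum_reindex_bij_witness[of _ "\<lambda>p. (fst p div int N, snd p div int d)" "\<lambda>p. (int N * fst p, int d * snd p)", THEN iffD1, rotated -1])
      fix p :: "int \<times> int" assume "p \<in> - {(0, 0)}"
      then have p: "(fst p, snd p) \<noteq> (0, 0)" by auto
      show "?g z (int N * fst p, int d * snd p) = of_nat d powr (- (2 * s)) * ?g w p"
        unfolding fst_conv snd_conv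
        by (rule lattice_form_scale_powr[OF w p dt(1)])
           (simp add: lattice_form_eq w_def t power2_eq_square algebra_simps)
    qed (use dt N in auto)
  qed
  moreover have "{p \<in> ?B. coprime (snd p) (int N)} = {p. p \<noteq> (0, 0) \<and> int N dvd fst p \<and> coprime (snd p) (int N)}" by auto
  ultimately show ?thesis by (simp only:)
qed

text \<open>
  A pair \<open>(m, n) \<noteq> (0, 0)\<close> with \<open>N dvd m\<close> and \<open>n\<close> coprime to \<open>N\<close> is uniquely \<open>k (c, d)\<close> with \<open>k\<close> coprime to \<open>N\<close>
  and \<open>(c, d)\<close> the bottom row of a matrix in \<open>\<Gamma>\<^sub>0(N)\<close>; the sum over \<open>k\<close> gives \<^const>\<open>zeta_level\<close>.
\<close>
lemma eisenstein_sum_eq: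
  assumes z: "Im z > 0" and N: "N > 0" and s: "Re s > 1"
  shows "2 * zeta_level N (2 * s) * (\<Sum>\<^sub>\<infinity>C\<in>cosets N. of_real (Im (mat_act (SOME g. g \<in> C) z)) powr s) =
    of_real (Im z) powr s *
     (\<Sum>d | d dvd N. of_int (moebius_mu d) * (of_nat d powr (- (2 * s)) * lattice_zeta (of_nat (N div d) * z) s))"
    (is "_ = _ * ?T")
proof -
  let ?g = "\<lambda>p. of_real (lattice_form z (fst p) (of_int (snd p))) powr (- s) :: complex"
  let ?K = "{k. k > 0 \<and> coprime k N}" and ?P = "coprime_rows N"
  have "?g summable_on - {(0, 0)}" using lattice_zeta_summable[OF z s] by (rule abs_summable_summable)
  moreover have P0: "?P \<subseteq> - {(0, 0)}" "pos_rows N \<subseteq> - {(0, 0)}" by (auto simp: coprime_rows_def pos_rows_def)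
  ultimately have smP: "?g summable_on ?P" "?g summable_on pos_rows N" by (auto intro: summable_on_subset)
  define G where "G = (\<Sum>\<^sub>\<infinity>p\<in>pos_rows N. ?g p)"
  have G: "(?g has_sum G) (pos_rows N)" unfolding G_def using smP(2) by (rule has_sum_infsum)
  have neg: "?g (- m, - n) = ?g (m, n)" for m n
    by (simp add: lattice_form_eq power2_eq_square algebra_simps)
  have "(?g has_sum G) {p. (- fst p, - snd p) \<in> pos_rows N}"
    using G by (rule has_sum_reindex_bij_witness[of _ "\<lambda>p. (- fst p, - snd p)" "\<lambda>p. (- fst p, - snd p)", THEN iffD1, rotated -1])
      (use neg in auto)
  with G have "(?g has_sum (G + G)) (pos_rows N \<union> {p. (- fst p, - snd p) \<in> pos_rows N})"
    by (rule has_sum_Un_disjoint) (auto simp: pos_rows_def)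
  moreover have "pos_rows N \<union> {p. (- fst p, - snd p) \<in> pos_rows N} = ?P"
  proof (intro set_eqI)
    fix p :: "int \<times> int"
    obtain c d where p: "p = (c, d)" by (cases p)
    have "c = 0 \<Longrightarrow> d = 0 \<Longrightarrow> \<not> coprime c d" by simp
    then show "p \<in> pos_rows N \<union> {p. (- fst p, - snd p) \<in> pos_rows N} \<longleftrightarrow> p \<in> ?P"
      unfolding p pos_rows_def coprime_rows_def by (cases "c > 0"; cases "c < 0"; cases "d > 0"; cases "d < 0"; auto)
  qed
  ultimately have GP: "(?g has_sum (2 * G)) ?P" by (simp only: mult_2)
  define i :: "nat \<times> int \<times> int \<Rightarrow> int \<times> int" where "i y = (int (fst y) * fst (snd y), int (fst y) * snd (snd y))" for y
  define j :: "int \<times> int \<Rightarrow> nat \<times> int \<times> int" where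
    "j x = (let g = gcd (fst x) (snd x) in (nat g, fst x div g, snd x div g))" for x
  have "((\<lambda>y. of_nat (fst y) powr (- (2 * s)) * ?g (snd y)) has_sum ?T) (?K \<times> ?P)"
    using lattice_zeta_sieved[OF z N s]
  proof (rule has_sum_reindex_bij_witness[of _ i j, THEN iffD1, rotated -1])
    fix x assume "x \<in> {p. p \<noteq> (0, 0) \<and> int N dvd fst p \<and> coprime (snd p) (int N)}"
    then obtain m n where x: "x = (m, n)" "(m, n) \<noteq> (0, 0)" "int N dvd m" "coprime n (int N)" by (cases x) auto
    define g where "g = gcd m n"
    have g: "g > 0" using x(2) by (auto simp: g_def)
    obtain c d where cd: "m = g * c" "n = g * d" unfolding g_def by (meson dvdE gcd_dvd1 gcd_dvd2)
    have div: "m div g = c" "n div g = d" using cd g by auto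
    have jx: "j x = (nat g, c, d)" by (simp add: j_def x(1) g_def[symmetric] div)
    have cop: "coprime c d" unfolding div[symmetric] g_def using x(2) by (intro div_gcd_coprime) auto
    \<comment> \<open>\<open>g\<close> divides \<open>n\<close> and so is coprime to
      \<open>N\<close>; hence divisibility of \<open>m = g c\<close> by \<open>N\<close> passes to
      \<open>c\<close>.\<close>
    have gN: "coprime g (int N)" using x(4) cd(2) by simp
    then have "int N dvd c" using x(3) cd(1) by (simp add: coprime_commute coprime_dvd_mult_right_iff)
    then have P: "(c, d) \<in> ?P" using cop by (simp add: coprime_rows_def)
    have "coprime (int (nat g)) (int N)" using g gN by simp
    then have K: "nat g \<in> ?K" using g by (simp only: coprime_int_iff) simp
    show "i (j x) = x" unfolding jx unfolding i_def x(1) cd using g by simp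
    show "j x \<in> ?K \<times> ?P" unfolding jx using P K by simp
    have c0: "(c, d) \<noteq> (0, 0)" using cop by auto
    have "?g (m, n) = of_nat (nat g) powr (- (2 * s)) * ?g (c, d)"
      unfolding fst_conv snd_conv
    proof (rule lattice_form_scale_powr[OF z c0])
      show "lattice_form z m (of_int n) = (real (nat g))\<^sup>2 * lattice_form z c (of_int d)"
        using g by (simp add: lattice_form_eq cd power2_eq_square algebra_simps)
    qed (use g in simp)
    then show "of_nat (fst (j x)) powr (- (2 * s)) * ?g (snd (j x)) = ?g x"
      unfolding jx unfolding x(1) fst_conv snd_conv by (rule sym)
  next
    fix y assume "y \<in> ?K \<times> ?P"
    then obtain k c d where y: "y = (k, (c, d))" "k > 0" "coprime k N" "coprime c d" "int N dvd c"
      by (cases y) (auto simp: coprime_rows_def)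
    have g: "gcd (int k * c) (int k * d) = int k" using y by (simp add: gcd_mult_left)
    \<comment> \<open>A common divisor of \<open>d\<close> and \<open>N\<close> also divides
      \<open>c\<close>, hence is a unit.\<close>
    have "coprime d (int N)" using y(4,5) by (metis coprime_commute coprime_divisors dvd_refl)
    moreover have "coprime (int k) (int N)" using y(3) by simp
    moreover have "(int k * c, int k * d) \<noteq> (0, 0)" using y(2,4) by auto
    ultimately show "i y \<in> {p. p \<noteq> (0, 0) \<and> int N dvd fst p \<and> coprime (snd p) (int N)}"
      using y by (simp add: i_def)
    show "j (i y) = y" using y(2) by (simp add: i_def j_def y(1) g)
  qed simp
  then have "((\<lambda>k. of_nat k powr (- (2 * s)) * (2 * G)) has_sum ?T) ?K"
    by (rule has_sum_SigmaD) (use has_sum_cmult_right[OF GP] in auto)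
  moreover have "((\<lambda>k. of_nat k powr (- (2 * s)) * (2 * G)) has_sum (zeta_level N (2 * s) * (2 * G))) ?K"
    using s by (intro has_sum_cmult_left zeta_level_has_sum N) auto
  ultimately have T: "?T = zeta_level N (2 * s) * (2 * G)" by (rule has_sum_unique)
  have "of_real (Im z / lattice_form z (fst p) (of_int (snd p))) powr s = of_real (Im z) powr s * ?g p"
    if "p \<in> pos_rows N" for p
  proof -
    have "(fst p, snd p) \<noteq> (0, 0)" using that by (auto simp: pos_rows_def)
    note pos = lattice_form_pos'[OF z this]
    then have pos': "Im z / lattice_form z (fst p) (of_int (snd p)) > 0" using z by simp
    show ?thesis
      unfolding of_real_powr_eq_exp[OF pos] of_real_powr_eq_exp[OF pos'] of_real_powr_eq_exp[OF z]
      using z pos by (simp add: ln_div exp_add[symmetric] algebra_simps)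
  qed
  then have "(\<Sum>\<^sub>\<infinity>p\<in>pos_rows N. of_real (Im z / lattice_form z (fst p) (of_int (snd p))) powr s) =
      (\<Sum>\<^sub>\<infinity>p\<in>pos_rows N. of_real (Im z) powr s * ?g p)" by (intro infsum_cong) auto
  also have "\<dots> = of_real (Im z) powr s * G" unfolding G_def by (rule infsum_cmult_right')
  finally show ?thesis unfolding infsum_cosets T by simp
qed

section \<open>The limit formula\<close>

lemma analytic_on_half_plane:
  assumes "f holomorphic_on {s. Re s > c}" "A \<subseteq> {s. Re s > c}" shows "f analytic_on A"
  using assms analytic_on_open[OF open_halfspace_Re_gt] analytic_on_subset by blast

lemma of_real_powr_holomorphic:
  assumes "x > 0" "f holomorphic_on A" shows "(\<lambda>s. of_real x powr f s) holomorphic_on A"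
  using assms by (simp add: of_real_powr_eq_exp holomorphic_intros)

lemma zeta_level_double_holomorphic: "(\<lambda>s. zeta_level N (2 * s)) holomorphic_on {s. Re s > 1 / 2}"
proof -
  have "(\<lambda>s. 1 - of_nat p powr (- (2 * s)) :: complex) holomorphic_on {s. Re s > 1 / 2}"
    if "p \<in> prime_factors N" for p
  proof -
    have "real p > 0" using that by (auto dest: in_prime_factors_imp_prime prime_gt_0_nat)
    from of_real_powr_holomorphic[OF this, of "\<lambda>s. - (2 * s)"]
    show ?thesis by (auto intro!: holomorphic_intros)
  qed
  then show ?thesis
    unfolding zeta_level_def by (intro holomorphic_on_mult zeta_double_holomorphic holomorphic_on_prod)
qed

lemma zeta_shift_meromorphic: "(\<lambda>s. zeta (2 * s - 1)) meromorphic_on {s. Re s > 1 / 2}"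
proof -
  have "(zeta_reg \<circ> (\<lambda>s. 2 * s - 1)) holomorphic_on {s. Re s > 1 / 2}"
    by (rule holomorphic_on_compose_gen[OF _ zeta_reg_holomorphic]) (auto intro!: holomorphic_intros)
  then have "(\<lambda>s. zeta_reg (2 * s - 1)) analytic_on {s. Re s > 1 / 2}"
    unfolding o_def by (rule analytic_on_half_plane) auto
  then have "(\<lambda>s. zeta_reg (2 * s - 1) + 1 / (2 * s - 1 - 1)) meromorphic_on {s. Re s > 1 / 2}"
    by (intro meromorphic_intros analytic_on_imp_meromorphic_on[of "\<lambda>s. zeta_reg (2 * s - 1)"])
  moreover have "\<forall>\<^sub>F w in at s. zeta_reg (2 * w - 1) + 1 / (2 * w - 1 - 1) = zeta (2 * w - 1)"
    if "s \<in> {s. Re s > 1 / 2}" for s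
  proof -
    have "\<forall>\<^sub>F w in at s. w \<in> {s. Re s > 1 / 2}"
      by (rule eventually_at_in_open'[OF open_halfspace_Re_gt that])
    moreover have "\<forall>\<^sub>F w in at s. w \<noteq> 1" by (rule eventually_neq_at_within)
    ultimately show ?thesis
    proof eventually_elim
      case (elim w)
      then have "2 * w - 1 \<noteq> 1" by auto
      then show ?case using elim by (intro zeta_eq[symmetric]) auto
    qed
  qed
  note meromorphic_on_cong[OF this refl]
  ultimately show ?thesis by blast
qed

lemma lattice_zeta_cont_meromorphic:
  assumes z: "Im z > 0"
  shows "lattice_zeta_cont z meromorphic_on {s. Re s > 1 / 2}"
proof -
  have "(\<lambda>s. zeta (2 * s)) meromorphic_on {s. Re s > 1 / 2}" "beta_factor meromorphic_on {s. Re s > 1 / 2}"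
    "lattice_reg z meromorphic_on {s. Re s > 1 / 2}"
    "(\<lambda>s. of_real (Im z) powr (1 - 2 * s)) meromorphic_on {s. Re s > 1 / 2}"
    by (intro analytic_on_imp_meromorphic_on analytic_on_half_plane[OF _ subset_refl]
          zeta_double_holomorphic beta_factor_holomorphic lattice_reg_holomorphic
          of_real_powr_holomorphic z holomorphic_intros)+
  then show ?thesis
    unfolding lattice_zeta_cont_def[abs_def] by (intro meromorphic_intros zeta_shift_meromorphic)
qed

text \<open>The continuation of \<open>zeta_level N (2s)\<close> times the Eisenstein series; the
  1/2 undoes the doubling by rows of opposite sign.\<close>

definition eisenstein_num :: "nat \<Rightarrow> complex \<Rightarrow> complex \<Rightarrow> complex" where
  "eisenstein_num N z s = of_real (Im z) powr s / 2 *
     (\<Sum>d | d dvd N. of_int (moebius_mu d) * (of_nat d powr (- (2 * s)) * lattice_zeta_cont (of_nat (N div d) * z) s))"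

lemma divisor_positivity:
  assumes "N > 0" "d \<in> {d. d dvd N}"
  shows "real d > 0" "real (N div d) > 0" "Im z > 0 \<Longrightarrow> Im (of_nat (N div d) * z) > 0"
proof -
  show "real d > 0" using assms dvd_pos_nat by auto
  show "real (N div d) > 0" using assms by (auto elim!: dvdE)
  then show "Im (of_nat (N div d) * z) > 0" if "Im z > 0" using that by simp
qed

lemma eisenstein_num_holomorphic:
  assumes z: "Im z > 0" and N: "N > 0"
  shows "eisenstein_num N z holomorphic_on ({s. Re s > 1 / 2} - {1})"
  unfolding eisenstein_num_def[abs_def]
proof (intro holomorphic_on_mult holomorphic_on_divide holomorphic_on_sum holomorphic_on_const of_real_powr_holomorphic z holomorphic_on_ident)
  fix d assume d: "d \<in> {d. d dvd N}"
  show "(\<lambda>s. of_nat d powr (- (2 * s))) holomorphic_on ({s. Re s > 1 / 2} - {1})"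
    using of_real_powr_holomorphic[OF divisor_positivity(1)[OF N d], of "\<lambda>s. - (2 * s)"] by (auto intro!: holomorphic_intros)
  show "lattice_zeta_cont (of_nat (N div d) * z) holomorphic_on ({s. Re s > 1 / 2} - {1})"
    by (rule lattice_zeta_cont_holomorphic[OF divisor_positivity(3)[OF N d z]])
qed auto

lemma eisenstein_num_meromorphic:
  assumes z: "Im z > 0" and N: "N > 0"
  shows "eisenstein_num N z meromorphic_on {s. Re s > 1 / 2}"
proof -
  have "(\<lambda>s. of_real (Im z) powr s) meromorphic_on {s. Re s > 1 / 2}"
    by (intro analytic_on_imp_meromorphic_on analytic_on_half_plane[OF _ subset_refl] of_real_powr_holomorphic z holomorphic_intros)
  moreover have "(\<lambda>s. of_nat d powr (- (2 * s))) meromorphic_on {s. Re s > 1 / 2}" if "d \<in> {d. d dvd N}" for d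
  proof -
    have "(\<lambda>s. of_real (real d) powr (- (2 * s))) meromorphic_on {s. Re s > 1 / 2}"
      by (intro analytic_on_imp_meromorphic_on analytic_on_half_plane[OF _ subset_refl]
            of_real_powr_holomorphic divisor_positivity(1)[OF N that] holomorphic_intros)
    then show ?thesis by simp
  qed
  moreover have "lattice_zeta_cont (of_nat (N div d) * z) meromorphic_on {s. Re s > 1 / 2}" if "d \<in> {d. d dvd N}" for d
    by (rule lattice_zeta_cont_meromorphic[OF divisor_positivity(3)[OF N that z]])
  ultimately show ?thesis
    unfolding eisenstein_num_def[abs_def] by (intro meromorphic_intros) auto
qed

text \<open>For Re s > 1 the quotient is the coset sum, since \<open>zeta_level\<close> has no zero
  with real part at least 2. Further left, nonvanishing at the point itself makes the quotient
  analytic there.\<close>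

lemma eisenstein_eq:
  assumes z: "Im z > 0" and N: "N > 0" and s: "Re s > 1 / 2" "s \<noteq> 1" "zeta_level N (2 * s) \<noteq> 0"
  shows "eisenstein N z s = eisenstein_num N z s / zeta_level N (2 * s)"
  unfolding eisenstein_def
proof (rule mero_cont_eqI[where c = "1 / 2" and G = "\<lambda>s. eisenstein_num N z s / zeta_level N (2 * s)"])
  have "(\<lambda>s. zeta_level N (2 * s)) meromorphic_on {s. Re s > 1 / 2}"
    by (intro analytic_on_imp_meromorphic_on analytic_on_half_plane[OF _ subset_refl] zeta_level_double_holomorphic)
  then show "(\<lambda>s. eisenstein_num N z s / zeta_level N (2 * s)) meromorphic_on {w. 1 / 2 < Re w}"
    by (intro meromorphic_intros eisenstein_num_meromorphic z N)
  show "eisenstein_num N z w / zeta_level N (2 * w) =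
      (\<Sum>\<^sub>\<infinity>C\<in>cosets N. of_real (Im (mat_act (SOME g. g \<in> C) z)) powr w)" if w: "1 < Re w" for w
  proof -
    have nz: "zeta_level N (2 * w) \<noteq> 0" using w by (intro zeta_level_nonzero N) auto
    have "(\<Sum>d | d dvd N. of_int (moebius_mu d) * (of_nat d powr (- (2 * w)) * lattice_zeta_cont (of_nat (N div d) * z) w)) =
        (\<Sum>d | d dvd N. of_int (moebius_mu d) * (of_nat d powr (- (2 * w)) * lattice_zeta (of_nat (N div d) * z) w))"
      by (intro sum.cong refl) (simp add: lattice_zeta_eq[OF divisor_positivity(3)[OF N _ z] w])
    then have "2 * eisenstein_num N z w =
        2 * zeta_level N (2 * w) * (\<Sum>\<^sub>\<infinity>C\<in>cosets N. of_real (Im (mat_act (SOME g. g \<in> C) z)) powr w)"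
      unfolding eisenstein_sum_eq[OF z N w] eisenstein_num_def by simp
    then show ?thesis using nz by (simp add: field_simps)
  qed
  have op: "open ({s. Re s > 1 / 2} - {1 :: complex})"
    by (intro open_Diff open_halfspace_Re_gt) auto
  have num: "eisenstein_num N z analytic_on ({s. Re s > 1 / 2} - {1})"
    using eisenstein_num_holomorphic[OF z N] analytic_on_open[OF op] by blast
  have den: "(\<lambda>s. zeta_level N (2 * s)) analytic_on A" if "A \<subseteq> {s. Re s > 1 / 2}" for A
    using zeta_level_double_holomorphic that by (rule analytic_on_half_plane)
  have nz: "zeta_level N (2 * s) \<noteq> 0" if "Re s > 1" for s
    by (rule zeta_level_nonzero[OF N]) (use that in simp)
  show "(\<lambda>s. eisenstein_num N z s / zeta_level N (2 * s)) analytic_on {w. 1 < Re w}"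
    by (intro analytic_on_divide den analytic_on_subset[OF num]) (use nz in auto)
  show "(\<lambda>s. eisenstein_num N z s / zeta_level N (2 * s)) analytic_on {s}"
    by (intro analytic_on_divide den analytic_on_subset[OF num]) (use s in auto)
qed (use s in auto)

section \<open>The completed series near s = 1\<close>

text \<open>What remains of the completed series after removing the multiple of \<^const>\<open>zeta_star\<close>; it is holomorphic at \<open>1\<close>.\<close>
definition regular_part :: "nat \<Rightarrow> complex \<Rightarrow> complex \<Rightarrow> complex" where
  "regular_part N z s = (\<Sum>t | t dvd N. of_int (moebius_mu (N div t)) * (of_nat t powr (2 * s) *
     (of_real (Im z) powr s * of_real pi powr (- s) * Gamma s * (zeta (2 * s) + lattice_reg (of_nat t * z) s))))"

text \<open>\<open>Gamma s\<close> cancels against the Beta factor and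
  \<open>pi^(-s) sqrt pi = pi^(-(2s-1)/2)\<close>: the polar term of the lattice sum is a completed
  zeta value.\<close>

lemma Gamma_beta_factor:
  assumes "Re s > 1 / 2"
  shows "of_real pi powr (- s) * Gamma s * beta_factor s * zeta (2 * s - 1) = zeta_star (2 * s - 1)"
proof -
  have "s \<notin> \<int>\<^sub>\<le>\<^sub>0" using assms by (auto elim!: nonpos_Ints_cases)
  then have "Gamma s \<noteq> 0" by (simp add: Gamma_eq_zero_iff)
  then have "of_real pi powr (- s) * Gamma s * beta_factor s = of_real pi powr (- s) * of_real (sqrt pi) * Gamma (s - 1 / 2)"
    by (simp add: beta_factor_def)
  also have "of_real pi powr (- s) * of_real (sqrt pi) = of_real pi powr (- (2 * s - 1) / 2)"
  proof -
    have "ln (sqrt pi) = ln pi / 2" by (simp add: ln_sqrt)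
    then have "complex_of_real (sqrt pi) = exp (of_real (ln pi) / 2)"
      by (metis exp_ln exp_of_real of_real_divide of_real_numeral pi_gt_zero real_sqrt_gt_zero)
    then show ?thesis
      by (simp add: of_real_powr_eq_exp exp_add[symmetric] field_simps)
  qed
  also have "s - 1 / 2 = (2 * s - 1) / 2" by (simp add: field_simps)
  finally show ?thesis by (simp add: zeta_star_def)
qed

lemma lattice_zeta_cont_scaled:
  assumes z: "Im z > 0" and t: "t > (0 :: nat)" and s: "Re s > 1 / 2"
  shows "of_nat t powr (2 * s) * (of_real pi powr (- s) * Gamma s * of_real (Im z) powr s / 2 * lattice_zeta_cont (of_nat t * z) s) =
    of_nat t powr (2 * s) * (of_real (Im z) powr s * of_real pi powr (- s) * Gamma s * (zeta (2 * s) + lattice_reg (of_nat t * z) s)) +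
    of_nat t * (of_real (Im z) powr (1 - s) * zeta_star (2 * s - 1))"
proof -
  let ?y = "complex_of_real (Im z)"
  have ty: "real t * Im z > 0" "real t > 0" using z t by auto
  have e1: "of_nat t powr (2 * s) = exp (2 * s * of_real (ln (real t)))"
    using of_real_powr_eq_exp[OF ty(2), of "2 * s"] by simp
  have e2: "?y powr s = exp (s * of_real (ln (Im z)))" by (rule of_real_powr_eq_exp[OF z])
  have "ln (real t * Im z) = ln (real t) + ln (Im z)" using ty z by (simp add: ln_mult)
  then have e3: "of_real (real t * Im z) powr (1 - 2 * s) = exp ((1 - 2 * s) * of_real (ln (real t) + ln (Im z)))"
    unfolding of_real_powr_eq_exp[OF ty(1)] by (simp only:)
  have "of_nat t powr (2 * s) * (?y powr s * of_real (real t * Im z) powr (1 - 2 * s)) =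
      exp (2 * s * of_real (ln (real t))) * (exp (s * of_real (ln (Im z))) * exp ((1 - 2 * s) * of_real (ln (real t) + ln (Im z))))"
    by (simp only: e1 e2 e3)
  also have "\<dots> = exp (of_real (ln (real t))) * exp ((1 - s) * of_real (ln (Im z)))"
    by (simp add: exp_add[symmetric] algebra_simps)
  also have "\<dots> = of_nat t * ?y powr (1 - s)"
    using ty z by (simp add: of_real_powr_eq_exp[OF z] exp_of_real)
  finally have P: "of_nat t powr (2 * s) * (?y powr s * of_real (Im (of_nat t * z)) powr (1 - 2 * s)) = of_nat t * ?y powr (1 - s)"
    by simp
  have "of_nat t powr (2 * s) * (of_real pi powr (- s) * Gamma s * ?y powr s / 2 * lattice_zeta_cont (of_nat t * z) s) =
    of_nat t powr (2 * s) * (?y powr s * of_real pi powr (- s) * Gamma s * (zeta (2 * s) + lattice_reg (of_nat t * z) s)) +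
    (of_nat t powr (2 * s) * (?y powr s * of_real (Im (of_nat t * z)) powr (1 - 2 * s))) *
      (of_real pi powr (- s) * Gamma s * beta_factor s * zeta (2 * s - 1))"
    unfolding lattice_zeta_cont_def by (simp only: algebra_simps) (simp add: field_simps)
  then show ?thesis unfolding P Gamma_beta_factor[OF s] by (simp only: mult.assoc)
qed

text \<open>After the substitution \<open>t = N/d\<close> the polar parts are multiples of one and
  the same function of \<open>s\<close>, so only their coefficients \<open>mu(N/t) t\<close> have to
  be added.\<close>

lemma eisenstein_completed_eq:
  assumes z: "Im z > 0" and N: "N > 0" and s: "Re s > 1 / 2" "s \<noteq> 1" "zeta_level N (2 * s) \<noteq> 0"
  shows "eisenstein_completed N z s =
    regular_part N z s + of_nat (totient N) * (of_real (Im z) powr (1 - s) * zeta_star (2 * s - 1))"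
proof -
  let ?X = "\<lambda>t. of_nat t powr (2 * s) * (of_real pi powr (- s) * Gamma s * of_real (Im z) powr s / 2 * lattice_zeta_cont (of_nat t * z) s)"
  have "eisenstein_completed N z s = of_nat N powr (2 * s) * of_real pi powr (- s) * Gamma s * eisenstein_num N z s"
    unfolding eisenstein_completed_def eisenstein_eq[OF z N s] using s(3) by simp
  also have "\<dots> = (\<Sum>d | d dvd N. of_int (moebius_mu d) * ?X (N div d))"
    unfolding eisenstein_num_def sum_distrib_left
  proof (intro sum.cong refl)
    fix d assume d: "d \<in> {d. d dvd N}"
    have E: "of_nat N powr (2 * s) * of_nat d powr (- (2 * s)) = (of_nat (N div d) :: complex) powr (2 * s)"
    proof -
      have "N = d * (N div d)" using d by simp
      then have "(of_nat N :: complex) powr (2 * s) = of_nat d powr (2 * s) * of_nat (N div d) powr (2 * s)"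
        by (metis of_nat_mult_powr)
      moreover have "(of_nat d :: complex) powr (2 * s) * of_nat d powr (- (2 * s)) = 1"
        using divisor_positivity(1)[OF N d] by (simp add: powr_add[symmetric])
      ultimately show ?thesis by (simp add: mult_ac)
    qed
    show "of_nat N powr (2 * s) * of_real pi powr (- s) * Gamma s * (of_real (Im z) powr s / 2 *
        (of_int (moebius_mu d) * (of_nat d powr (- (2 * s)) * lattice_zeta_cont (of_nat (N div d) * z) s))) =
        of_int (moebius_mu d) * ?X (N div d)"
      unfolding E[symmetric] by (simp only: times_divide_eq_left times_divide_eq_right mult_ac)
  qed
  also have "\<dots> = (\<Sum>t | t dvd N. of_int (moebius_mu (N div t)) * ?X t)"
    by (rule sum_dvd_flip[OF N, of "\<lambda>d t. of_int (moebius_mu d) * ?X t"])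
  also have "\<dots> = (\<Sum>t | t dvd N. of_int (moebius_mu (N div t)) * (of_nat t powr (2 * s) *
       (of_real (Im z) powr s * of_real pi powr (- s) * Gamma s * (zeta (2 * s) + lattice_reg (of_nat t * z) s))) +
       of_int (moebius_mu (N div t)) * of_nat t * (of_real (Im z) powr (1 - s) * zeta_star (2 * s - 1)))"
  proof (intro sum.cong refl)
    fix t assume "t \<in> {t. t dvd N}"
    then have "t > 0" using N dvd_pos_nat by auto
    from lattice_zeta_cont_scaled[OF z this s(1)]
    show "of_int (moebius_mu (N div t)) * ?X t = of_int (moebius_mu (N div t)) * (of_nat t powr (2 * s) *
       (of_real (Im z) powr s * of_real pi powr (- s) * Gamma s * (zeta (2 * s) + lattice_reg (of_nat t * z) s))) +
       of_int (moebius_mu (N div t)) * of_nat t * (of_real (Im z) powr (1 - s) * zeta_star (2 * s - 1))"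
      by (simp only: distrib_left mult.assoc)
  qed
  also have "\<dots> = regular_part N z s + (\<Sum>t | t dvd N. of_int (moebius_mu (N div t)) * of_nat t) *
       (of_real (Im z) powr (1 - s) * zeta_star (2 * s - 1))"
    unfolding sum.distrib sum_distrib_right regular_part_def ..
  also have "(\<Sum>t | t dvd N. of_int (moebius_mu (N div t)) * of_nat t) = (of_nat (totient N) :: complex)"
    using arg_cong[OF sum_moebius_mu_totient[OF N], of complex_of_real] by simp
  finally show ?thesis .
qed

text \<open>A zero against a pole: \<open>y^(1-s) - 1\<close> has derivative \<open>- ln y\<close>
  at 1, and \<open>zeta_star(2s-1)\<close> behaves like \<open>1/(2(s-1))\<close> because its Gamma
  factor tends to \<open>pi^(-1/2) Gamma(1/2) = 1\<close>.\<close>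

lemma tendsto_zeta_star_difference:
  assumes y: "y > 0"
  shows "((\<lambda>s. (of_real y powr (1 - s) - 1) * zeta_star (2 * s - 1)) \<longlongrightarrow> of_real (- ln y / 2)) (at 1)"
proof -
  have "((\<lambda>s::complex. exp ((1 - s) * of_real (ln y))) has_field_derivative - of_real (ln y)) (at 1)"
    by (auto intro!: derivative_eq_intros)
  then have 1: "((\<lambda>s::complex. (of_real y powr (1 - s) - 1) / (s - 1)) \<longlongrightarrow> - of_real (ln y)) (at 1)"
    by (simp add: has_field_derivative_iff of_real_powr_eq_exp[OF y])
  have "filterlim (\<lambda>s. 2 * s - 1 :: complex) (at 1) (at 1)"
    by (intro filterlim_atI) (auto intro!: tendsto_eq_intros simp: eventually_at_filter)
  then have "((\<lambda>s. (2 * s - 1 - 1) * zeta (2 * s - 1)) \<longlongrightarrow> 1) (at 1)"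
    by (rule filterlim_compose[OF tendsto_zeta_at_1])
  moreover have "((\<lambda>s. of_real pi powr (- (2 * s - 1) / 2) * Gamma ((2 * s - 1) / 2)) \<longlongrightarrow>
      of_real pi powr (- (2 * 1 - 1) / 2) * Gamma ((2 * 1 - 1) / 2)) (at (1 :: complex))"
    by (intro tendsto_intros) (auto simp: complex_nonpos_Reals_iff pi_gt_zero[unfolded not_le[symmetric]] elim!: nonpos_Ints_cases dest!: arg_cong[of _ _ Re])
  moreover have "of_real pi powr (- (2 * 1 - 1) / 2) * Gamma ((2 * 1 - 1) / 2) = (1 :: complex)"
  proof -
    have "Gamma (1 / 2 :: complex) = of_real (sqrt pi)"
      by (metis Gamma_complex_of_real Gamma_one_half_real of_real_1 of_real_divide of_real_numeral)
    moreover have "complex_of_real pi powr (- 1 / 2) = of_real (pi powr (- 1 / 2))"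
      by (subst powr_of_real[symmetric]) auto
    moreover have "pi powr (- 1 / 2) * sqrt pi = 1"
      using powr_half_sqrt[of pi] by (simp add: powr_minus field_simps)
    ultimately show ?thesis by (simp flip: of_real_mult)
  qed
  ultimately have 2: "((\<lambda>s. of_real pi powr (- (2 * s - 1) / 2) * Gamma ((2 * s - 1) / 2) * ((2 * s - 1 - 1) * zeta (2 * s - 1)) / 2) \<longlongrightarrow> 1 * 1 / 2) (at 1)"
    by (intro tendsto_mult tendsto_divide tendsto_const) auto
  from tendsto_mult[OF 1 2]
  have "((\<lambda>s. (of_real y powr (1 - s) - 1) / (s - 1) * (of_real pi powr (- (2 * s - 1) / 2) * Gamma ((2 * s - 1) / 2) * ((2 * s - 1 - 1) * zeta (2 * s - 1)) / 2))
      \<longlongrightarrow> of_real (- ln y / 2)) (at 1)" by simp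
  moreover have "\<forall>\<^sub>F s in at 1. (of_real y powr (1 - s) - 1) / (s - 1) * (of_real pi powr (- (2 * s - 1) / 2) * Gamma ((2 * s - 1) / 2) * ((2 * s - 1 - 1) * zeta (2 * s - 1)) / 2) =
      (of_real y powr (1 - s) - 1) * zeta_star (2 * s - 1)"
  proof -
    have "(A / (s - 1)) * (B * C * ((2 * s - 1 - 1) * Z) / 2) = A * (B * C * Z)" if "s \<noteq> 1" for A B C Z s :: complex
    proof -
      have "2 * s - 1 - 1 = 2 * (s - 1)" by simp
      then show ?thesis using that by (simp only:) (simp add: field_simps)
    qed
    then show ?thesis unfolding zeta_star_def eventually_at_filter by (intro always_eventually) blast
  qed
  ultimately show ?thesis using tendsto_cong by force
qed

lemma tendsto_regular_part:
  assumes z: "Im z > 0" and N: "N > 0"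
  shows "(regular_part N z \<longlongrightarrow> of_real (- (1 / 12) * (\<Sum>t | t dvd N. of_int (moebius_mu (N div t)) * real t * ln (norm (Delta (of_nat t * z)))))) (at 1)"
proof -
  let ?y = "Im z"
  have cont: "(f \<longlongrightarrow> f 1) (at 1)" if "f holomorphic_on {s. Re s > 1 / 2}" for f :: "complex \<Rightarrow> complex"
  proof -
    have "isCont f 1"
      using holomorphic_on_imp_continuous_on[OF that] open_halfspace_Re_gt[of "1 / 2"]
      by (subst (asm) continuous_on_eq_continuous_at) auto
    then show ?thesis by (simp add: isCont_def)
  qed
  have "(regular_part N z \<longlongrightarrow> regular_part N z 1) (at 1)"
    unfolding regular_part_def
  proof (intro tendsto_sum tendsto_mult tendsto_add tendsto_const)
    show "((\<lambda>s. of_real ?y powr s) \<longlongrightarrow> of_real ?y powr 1) (at (1::complex))" "((\<lambda>s. of_real pi powr - s) \<longlongrightarrow> of_real pi powr - 1) (at (1::complex))"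
      using cont[OF of_real_powr_holomorphic[OF z holomorphic_on_ident]]
        cont[OF of_real_powr_holomorphic[OF pi_gt_zero holomorphic_on_minus[OF holomorphic_on_ident]]] by simp_all
    show "(Gamma \<longlongrightarrow> Gamma 1) (at (1 :: complex))" by (intro tendsto_intros) auto
    show "((\<lambda>s. zeta (2 * s)) \<longlongrightarrow> zeta (2 * 1)) (at 1)" by (rule cont[OF zeta_double_holomorphic])
    fix t assume t: "t \<in> {t. t dvd N}"
    then have t0: "real t > 0" using N dvd_pos_nat by auto
    from cont[OF of_real_powr_holomorphic[OF this, of "\<lambda>s. 2 * s"]]
    show "((\<lambda>s. of_nat t powr (2 * s)) \<longlongrightarrow> of_nat t powr (2 * 1)) (at (1::complex))"
      by (auto intro!: holomorphic_intros)
    show "(lattice_reg (of_nat t * z) \<longlongrightarrow> lattice_reg (of_nat t * z) 1) (at 1)"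
      by (rule cont[OF lattice_reg_holomorphic]) (use z t0 in simp)
  qed
  also have "regular_part N z 1 = of_real (- (1 / 12) * (\<Sum>t | t dvd N. of_int (moebius_mu (N div t)) * real t * ln (norm (Delta (of_nat t * z)))))"
    unfolding regular_part_def sum_distrib_left of_real_sum
  proof (intro sum.cong refl)
    fix t assume "t \<in> {t. t dvd N}"
    then have t0: "real t > 0" using N dvd_pos_nat by auto
    define D where "D = ln (norm (Delta (of_nat t * z)))"
    have tz: "Im (of_nat t * z) > 0" using z t0 by simp
    have r: "lattice_reg (of_nat t * z) 1 = of_real (- (pi / (12 * (real t * ?y))) * (D + 2 * pi * (real t * ?y)))"
      using lattice_reg_at_1(2)[OF tz] by (simp add: D_def)
    have p1: "of_nat t powr (2 * 1) = complex_of_real ((real t)\<^sup>2)" using t0 by simp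
    have p2: "of_real ?y powr 1 = complex_of_real ?y" using z by simp
    have p3: "of_real pi powr - 1 = complex_of_real (1 / pi)"
      by (simp only: powr_minus_divide powr_one' of_real_divide of_real_1) simp
    have p4: "zeta (2 * 1) = complex_of_real (pi\<^sup>2 / 6)" using zeta_2 by simp
    have "(real t)\<^sup>2 * (?y * (1 / pi) * 1 * (pi\<^sup>2 / 6 + - (pi / (12 * (real t * ?y))) * (D + 2 * pi * (real t * ?y)))) = - (1 / 12) * real t * D"
    proof -
      define a where "a = real t * ?y"
      have a: "a \<noteq> 0" using z t0 by (simp add: a_def)
      \<comment> \<open>The value of zeta at 2 cancels the contribution of \<open>2 pi a\<close>;
        only the logarithm survives.\<close>
      have "pi\<^sup>2 / 6 + - (pi / (12 * a)) * (D + 2 * pi * a) = - (pi / (12 * a)) * D"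
        using a by (simp add: field_simps power2_eq_square)
      moreover have "(real t)\<^sup>2 * (?y * (1 / pi) * 1 * (- (pi / (12 * a)) * D)) = (real t * a) * (1 / pi) * (- (pi / (12 * a)) * D)"
        by (simp add: a_def power2_eq_square)
      moreover have "\<dots> = - (1 / 12) * real t * D" using a by simp
      ultimately show ?thesis unfolding a_def[symmetric] by (simp only:)
    qed
    from arg_cong[OF this, of complex_of_real]
    have "complex_of_real ((real t)\<^sup>2) * (of_real ?y * of_real (1 / pi) * 1 * (of_real (pi\<^sup>2 / 6) + of_real (- (pi / (12 * (real t * ?y))) * (D + 2 * pi * (real t * ?y))))) =
       of_real (- (1 / 12) * real t * D)"
      by (simp only: of_real_mult of_real_add of_real_1)
    then show "of_int (moebius_mu (N div t)) * (of_nat t powr (2 * 1) *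
       (of_real ?y powr 1 * of_real pi powr - 1 * Gamma 1 * (zeta (2 * 1) + lattice_reg (of_nat t * z) 1))) =
       complex_of_real (- (1 / 12) * (of_int (moebius_mu (N div t)) * real t * ln (norm (Delta (of_nat t * z)))))"
      unfolding p1 p2 p3 p4 r D_def[symmetric] Gamma_1 by (simp only:) simp
  qed
  finally show ?thesis .
qed

lemma ln_norm_Delta_level:
  assumes z: "Im z > 0" and N: "N > 0"
  shows "Delta_level N z \<noteq> 0"
    "ln (norm (Delta_level N z)) = (\<Sum>t | t dvd N. of_int (moebius_mu (N div t)) * real t * ln (norm (Delta (of_nat t * z))))"
proof -
  have nz: "Delta (of_nat t * z) \<noteq> 0" if "t \<in> {t. t dvd N}" for t
  proof -
    have "real t > 0" using that N dvd_pos_nat by auto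
    then show ?thesis using z by (intro lattice_reg_at_1(1)) auto
  qed
  then show "Delta_level N z \<noteq> 0" using N by (auto simp: Delta_level_def)
  have "norm (Delta_level N z) = (\<Prod>t | t dvd N. norm (Delta (of_nat t * z)) powi a_exp N t)"
    by (simp add: Delta_level_def norm_power_int flip: prod_norm)
  also have "ln \<dots> = (\<Sum>t | t dvd N. ln (norm (Delta (of_nat t * z)) powi a_exp N t))"
    using N nz by (intro ln_prod) auto
  also have "\<dots> = (\<Sum>t | t dvd N. of_int (moebius_mu (N div t)) * real t * ln (norm (Delta (of_nat t * z))))"
  proof (intro sum.cong refl)
    fix t assume t: "t \<in> {t. t dvd N}"
    have "ln (norm (Delta (of_nat t * z)) powi a_exp N t) = of_int (a_exp N t) * ln (norm (Delta (of_nat t * z)))"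
      using nz[OF t] by (subst powr_real_of_int'[symmetric]) (auto simp: ln_powr)
    then show "ln (norm (Delta (of_nat t * z)) powi a_exp N t) = of_int (moebius_mu (N div t)) * real t * ln (norm (Delta (of_nat t * z)))"
      using t by (simp add: a_exp_eq[OF N] mult_ac)
  qed
  finally show "ln (norm (Delta_level N z)) = (\<Sum>t | t dvd N. of_int (moebius_mu (N div t)) * real t * ln (norm (Delta (of_nat t * z))))" .
qed

text \<open>Subtraction turns the polar term into \<open>(y^(1-s) - 1) zeta_star(2s-1)\<close>, with
  limit \<open>-(ln y)/2\<close>; multiplied by phi(N) this is
  \<open>-(1/12) ln (y^(6 phi(N)))\<close>.\<close>

lemma kronecker_limit_level:
  assumes z: "Im z > 0" and N: "N > 0"
  shows "((\<lambda>s. eisenstein_completed N z s - of_nat (totient N) * zeta_star (2 * s - 1)) \<longlongrightarrow>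
           of_real (- (1 / 12) * ln (Im z ^ (6 * totient N) * norm (Delta_level N z)))) (at 1)"
proof -
  let ?L = "ln (norm (Delta_level N z))"
  have "((\<lambda>s. regular_part N z s + of_nat (totient N) * ((of_real (Im z) powr (1 - s) - 1) * zeta_star (2 * s - 1))) \<longlongrightarrow>
      of_real (- (1 / 12) * ?L) + of_nat (totient N) * of_real (- ln (Im z) / 2)) (at 1)"
    unfolding ln_norm_Delta_level(2)[OF z N]
    by (intro tendsto_add tendsto_mult tendsto_const tendsto_regular_part tendsto_zeta_star_difference z N)
  moreover have "of_real (- (1 / 12) * ?L) + of_nat (totient N) * of_real (- ln (Im z) / 2) =
      complex_of_real (- (1 / 12) * ln (Im z ^ (6 * totient N) * norm (Delta_level N z)))"
    using z ln_norm_Delta_level(1)[OF z N] by (simp add: ln_mult ln_realpow field_simps)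
  moreover have "\<forall>\<^sub>F s in at 1. regular_part N z s + of_nat (totient N) * ((of_real (Im z) powr (1 - s) - 1) * zeta_star (2 * s - 1)) =
      eisenstein_completed N z s - of_nat (totient N) * zeta_star (2 * s - 1)"
  proof -
    have "isCont (\<lambda>s. zeta_level N (2 * s)) 1"
      using holomorphic_on_imp_continuous_on[OF zeta_level_double_holomorphic] open_halfspace_Re_gt[of "1 / 2"]
      by (subst (asm) continuous_on_eq_continuous_at) auto
    moreover have "zeta_level N (2 * 1) \<noteq> 0" by (intro zeta_level_nonzero N) auto
    ultimately have "\<forall>\<^sub>F s in at 1. zeta_level N (2 * s) \<noteq> 0"
      unfolding isCont_def by (rule tendsto_imp_eventually_ne)
    moreover have "\<forall>\<^sub>F s in at 1. s \<in> {s :: complex. Re s > 1 / 2}"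
      by (rule eventually_at_in_open'[OF open_halfspace_Re_gt]) auto
    moreover have "\<forall>\<^sub>F s in at (1 :: complex). s \<noteq> 1" by (simp add: eventually_at_filter)
    ultimately show ?thesis
    proof eventually_elim
      case (elim s)
      then have "Re s > 1 / 2" "s \<noteq> 1" "zeta_level N (2 * s) \<noteq> 0" by auto
      from eisenstein_completed_eq[OF z N this] show ?case by (simp add: algebra_simps)
    qed
  qed
  ultimately show ?thesis using tendsto_cong by force
qed

theorem theorem1p5:
  fixes N :: nat and z :: complex
  assumes "N \<ge> 1" and "Im z > 0"
  shows "((\<lambda>s. eisenstein_completed N z s - of_nat (totient N) * zeta_star (2 * s - 1)) \<longlongrightarrow>
           of_real (- (1 / 12) * ln (Im z ^ (6 * totient N) * norm (Delta_level N z)))) (at 1)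
       \<and> ((\<lambda>s. eisenstein_completed N (mat_act (w_mat N) z) s
                - of_nat (totient N) * zeta_star (2 * s - 1)) \<longlongrightarrow>
           of_real (- (1 / 12) * ln (Im z ^ (6 * totient N) * norm (Delta_level0 N z)))) (at 1)"
proof
  have N: "N > 0" using assms(1) by simp
  define w where "w = mat_act (w_mat N) z"
  \<comment> \<open>Half the weight \<open>12 phi(N)\<close>, which is the exponent of the imaginary
    part.\<close>
  define k where "k = 6 * totient N"
  have nz: "z \<noteq> 0" using assms(2) by auto
  have Im_w: "Im w = Im z / (real N * (norm z)\<^sup>2)"
  proof -
    have "w = - (1 / (of_nat N * z))" by (simp add: w_def mat_act_def automorphy_def w_mat_def)
    moreover have "Im (- (1 / u)) = Im u / (norm u)\<^sup>2" for u by (simp add: Im_divide cmod_power2)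
    ultimately have "Im w = real N * Im z / (real N * norm z)\<^sup>2" by (simp add: norm_mult)
    then show ?thesis using N by (simp add: power2_eq_square)
  qed
  then have w: "Im w > 0" using assms(2) N nz by simp
  show "((\<lambda>s. eisenstein_completed N z s - of_nat (totient N) * zeta_star (2 * s - 1)) \<longlongrightarrow>
           of_real (- (1 / 12) * ln (Im z ^ (6 * totient N) * norm (Delta_level N z)))) (at 1)"
    using assms(2) N by (rule kronecker_limit_level)
  \<comment> \<open>Under \<open>w_N\<close> the imaginary part scales by
    \<open>N / |N z|^2\<close>, and the \<open>k\<close>-th power of this ratio is exactly the norm
    of the slash factor.\<close>
  have "Im z ^ (6 * totient N) * norm (Delta_level0 N z) = Im w ^ (6 * totient N) * norm (Delta_level N w)"
  proof -
    have "det (w_mat N) = real N" by (simp add: w_mat_def det_mat2)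
    moreover have "automorphy (w_mat N) z = of_nat N * z" by (simp add: automorphy_def w_mat_def)
    ultimately have "norm (Delta_level0 N z) =
        real N powr (real (2 * k) / 2) * (real N * norm z) powi (- int (2 * k)) * norm (Delta_level N w)"
      by (simp add: Delta_level0_def slash_def w_def[symmetric] k_def norm_mult norm_power_int)
    also have "real N powr (real (2 * k) / 2) = real N ^ k" using N by (simp add: powr_realpow)
    also have "(real N * norm z) powi (- int (2 * k)) = 1 / (real N * norm z) ^ (2 * k)"
      by (simp only: power_int_minus power_int_of_nat inverse_eq_divide)
    also have "\<dots> = 1 / (real N ^ k * (real N * (norm z)\<^sup>2) ^ k)"
      by (simp add: power_mult power_mult_distrib power2_eq_square)
    also have "real N ^ k * (1 / (real N ^ k * (real N * (norm z)\<^sup>2) ^ k)) = 1 / (real N * (norm z)\<^sup>2) ^ k" using N by simp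
    finally show ?thesis unfolding Im_w k_def[symmetric] by (simp add: power_divide)
  qed
  then show "((\<lambda>s. eisenstein_completed N (mat_act (w_mat N) z) s - of_nat (totient N) * zeta_star (2 * s - 1)) \<longlongrightarrow>
           of_real (- (1 / 12) * ln (Im z ^ (6 * totient N) * norm (Delta_level0 N z)))) (at 1)"
    using kronecker_limit_level[OF w N] by (simp only: w_def)
qed

end
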